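(* The distribution functions $\boldsymbol\lambda_{\sigma;j}$, $\boldsymbol\lambda_{\sigma;j,l;\tau}$, and $\boldsymbol\lambda_{\sigma,n;j}$, $\boldsymbol\lambda_{\sigma,n;j,l;\tau}$ for $n\geq n_0$, depend continuously on $\sigma$ (with respect to weak convergence), and their densities $G_{\sigma;j}(\mathbf{x})$, $G_{\sigma;j,l;\tau}(\mathbf{x})$, $G_{\sigma,n;j}(\mathbf{x})$, $G_{\sigma,n;j,l;\tau}(\mathbf{x})$, together with their partial derivatives of order $\leq q$ when $n\geq n_q$, are continuous in $\sigma$ for every $\sigma\geq1$, $j,l\in\{1,\ldots,N\}$, $j\neq l$, $\tau\in\{\pm1,\pm i\}$.
   Context: Setting: $N\geq1$ and $F_1,\ldots,F_N$ orthogonal functions satisfying (I) $F(s)=\sum_{n\geq1}a_F(n)n^{-s}$ absolutely convergent for $\sigma>1$, and (II) $\log F(s)=\sum_p\sum_{k\geq1}b_F(p^k)p^{-ks}$ absolutely convergent for $\sigma>1$ with $|b_F(p^k)|\ll p^{k\theta}$ for some $\theta<\frac12$; orthogonality means $\sum_{p\leq x}a_{F_i}(p)\overline{a_{F_j}(p)}/p=(m_{i,j}+o(1))\log\log x$ with $m_{i,i}>0$, $m_{i,j}=0$ for $i\neq j$. Local factors $\log F_{j,p}(s)=\sum_{k\geq1}b_{F_j}(p^k)p^{-ks}$; $p_m$ the $m$-th prime; for $\boldsymbol\theta\in[0,1]^n$, $s_m=\sigma+2\pi i\theta_m/\log p_m$, $\log F_{j,n}(\sigma,\boldsymbol\theta)=\sum_{m\leq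 n}\log F_{j,p_m}(s_m)$, $\frac{F'_{j,n}}{F_{j,n}}(\sigma,\boldsymbol\theta)=\sum_{m\leq n}\frac{F'_{j,p_m}}{F_{j,p_m}}(s_m)$, $\mathbf{\log F}_n=(\log F_{1,n},\ldots,\log F_{N,n})$. For Borel $\mathbf{E}\subseteq\mathbb{C}^N$, with $W_n=\{\boldsymbol\theta\in[0,1)^n:\mathbf{\log F}_n(\sigma,\boldsymbol\theta)\in\mathbf{E}\}$: $\boldsymbol\lambda_{\sigma,n;j}(\mathbf{E})=\int_{W_n}|\frac{F'_{j,n}}{F_{j,n}}|^2d\boldsymbol\theta$ and $\boldsymbol\lambda_{\sigma,n;j,l;\tau}(\mathbf{E})=\int_{W_n}|\frac{F'_{j,n}}{F_{j,n}}+\tau\frac{F'_{l,n}}{F_{l,n}}|^2d\boldsymbol\theta$. It is known (established in the paper) that there are integers $n_0\leq n_1\leq\cdots$ such that for $n\geq n_q$ and $\sigma\geq1$ these measures are absolutely continuous with densities $G_{\sigma,n;j}$, $G_{\sigma,n;j,l;\tau}$ of class $\mathcal{C}^q(\mathbb{C}^N)$, and that as $n\to\infty$ they converge weakly to absolutely continuous measures $\boldsymbol\lambda_{\sigma;j}$, $\boldsymbol\lambda_{\sigma;j,l;\tau}$ with $\mathcal{C}^\infty$ densities $G_{\sigma;j}$, $G_{\sigma;j,l;\tau}$. *)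

theory Defs
  imports "HOL-Analysis.Analysis" "HOL-Library.Landau_Symbols"
begin

definition abs_conv_dirichlet_series :: "(complex \<Rightarrow> complex) \<Rightarrow> (nat \<Rightarrow> complex) \<Rightarrow> bool" where
  "abs_conv_dirichlet_series F a \<longleftrightarrow>
     (\<forall>s. Re s > 1 \<longrightarrow>
        (\<lambda>n. norm (a n * of_nat n powr (- s))) summable_on {1..} \<and>
        ((\<lambda>n. a n * of_nat n powr (- s)) has_sum F s) {1..})"

text \<open>Only the values of \<open>b\<close> at prime powers \<open>p ^ k\<close>, \<open>k \<ge> 1\<close>, matter.  That the double series
  is a logarithm of \<open>F s\<close> is expressed through \<open>exp\<close>; this series is the branch meant
  by \<open>log F\<close>.\<close>

definition log_euler_product :: "(complex \<Rightarrow> complex) \<Rightarrow> (nat \<Rightarrow> complex) \<Rightarrow> bool" where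
  "log_euler_product F b \<longleftrightarrow>
     (\<forall>s. Re s > 1 \<longrightarrow>
        (\<lambda>(p, k). norm (b (p ^ k) * of_nat p powr (- (of_nat k * s))))
            summable_on ({p. prime p} \<times> {1..}) \<and>
        F s = exp (\<Sum>\<^sub>\<infinity>(p, k)\<in>{p. prime p} \<times> {1..}.
                     b (p ^ k) * of_nat p powr (- (of_nat k * s)))) \<and>
     (\<exists>\<theta> C :: real. \<theta> < 1 / 2 \<and>
        (\<forall>p k. prime p \<and> k \<ge> 1 \<longrightarrow> norm (b (p ^ k)) \<le> C * real p powr (real k * \<theta>)))"

definition orthogonal_coeffs :: "('n \<Rightarrow> nat \<Rightarrow> complex) \<Rightarrow> bool" where
  "orthogonal_coeffs a \<longleftrightarrow>
     (\<exists>m :: 'n \<Rightarrow> 'n \<Rightarrow> real.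
        (\<forall>i. m i i > 0) \<and> (\<forall>i j. i \<noteq> j \<longrightarrow> m i j = 0) \<and>
        (\<forall>i j. (\<lambda>x :: real.
                   (\<Sum>p | prime p \<and> real p \<le> x. a i p * cnj (a j p) / of_nat p)
                     - of_real (m i j * ln (ln x)))
               \<in> o[at_top](\<lambda>x. of_real (ln (ln x)))))"

definition log_local_factor :: "(nat \<Rightarrow> complex) \<Rightarrow> nat \<Rightarrow> complex \<Rightarrow> complex" where
  "log_local_factor b p s =
     (\<Sum>k. b (p ^ Suc k) * of_nat p powr (- (of_nat (Suc k) * s)))"

definition local_factor :: "(nat \<Rightarrow> complex) \<Rightarrow> nat \<Rightarrow> complex \<Rightarrow> complex" where
  "local_factor b p s = exp (log_local_factor b p s)"

text \<open>Primes are numbered from \<open>0\<close>: \<open>nth_prime 0 = 2\<close>.  Accordingly the coordinates of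
  \<open>\<theta>\<close> below are indexed by \<open>{..<n}\<close> instead of \<open>{1..n}\<close>.\<close>

definition nth_prime :: "nat \<Rightarrow> nat" where
  "nth_prime m = enumerate {p. prime p} m"

definition shifted_arg :: "real \<Rightarrow> (nat \<Rightarrow> real) \<Rightarrow> nat \<Rightarrow> complex" where
  "shifted_arg \<sigma> \<theta> m = Complex \<sigma> (2 * pi * \<theta> m / ln (real (nth_prime m)))"

definition log_trunc ::
    "('n::finite \<Rightarrow> nat \<Rightarrow> complex) \<Rightarrow> nat \<Rightarrow> real \<Rightarrow> (nat \<Rightarrow> real) \<Rightarrow> complex ^ 'n" where
  "log_trunc b n \<sigma> \<theta> =
     (\<chi> j. \<Sum>m<n. log_local_factor (b j) (nth_prime m) (shifted_arg \<sigma> \<theta> m))"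

definition logderiv_trunc ::
    "(nat \<Rightarrow> complex) \<Rightarrow> nat \<Rightarrow> real \<Rightarrow> (nat \<Rightarrow> real) \<Rightarrow> complex" where
  "logderiv_trunc b n \<sigma> \<theta> =
     (\<Sum>m<n. deriv (local_factor b (nth_prime m)) (shifted_arg \<sigma> \<theta> m)
             / local_factor b (nth_prime m) (shifted_arg \<sigma> \<theta> m))"

definition unit_cube :: "nat \<Rightarrow> (nat \<Rightarrow> real) measure" where
  "unit_cube n = Pi\<^sub>M {..<n} (\<lambda>_. restrict_space lborel {0..<1})"

text \<open>The push-forward of \<open>w(\<theta>) d\<theta>\<close> under \<open>log_trunc\<close>; its value on a Borel set \<open>E\<close> is the
  integral of \<open>w\<close> over all \<open>\<theta>\<close> in the half-open cube with \<open>log_trunc b n \<sigma> \<theta> \<in> E\<close>.\<close>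

definition weighted_distr ::
    "('n::finite \<Rightarrow> nat \<Rightarrow> complex) \<Rightarrow> nat \<Rightarrow> real \<Rightarrow> ((nat \<Rightarrow> real) \<Rightarrow> real)
       \<Rightarrow> (complex ^ 'n) measure" where
  "weighted_distr b n \<sigma> w =
     distr (density (unit_cube n) (\<lambda>\<theta>. ennreal (w \<theta>))) borel (log_trunc b n \<sigma>)"

definition lam_single ::
    "('n::finite \<Rightarrow> nat \<Rightarrow> complex) \<Rightarrow> 'n \<Rightarrow> nat \<Rightarrow> real \<Rightarrow> (complex ^ 'n) measure" where
  "lam_single b j n \<sigma> =
     weighted_distr b n \<sigma> (\<lambda>\<theta>. (norm (logderiv_trunc (b j) n \<sigma> \<theta>))\<^sup>2)"

definition lam_pair ::
    "('n::finite \<Rightarrow> nat \<Rightarrow> complex) \<Rightarrow> 'n \<Rightarrow> 'n \<Rightarrow> complex \<Rightarrow> nat \<Rightarrow> real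
       \<Rightarrow> (complex ^ 'n) measure" where
  "lam_pair b j l \<tau> n \<sigma> =
     weighted_distr b n \<sigma>
       (\<lambda>\<theta>. (norm (logderiv_trunc (b j) n \<sigma> \<theta> + \<tau> * logderiv_trunc (b l) n \<sigma> \<theta>))\<^sup>2)"

text \<open>The measures are finite but need not have mass 1.  Finiteness is demanded explicitly
  since the Bochner integral of a non-integrable function is \<open>0\<close>.\<close>

definition finite_borel :: "'a::topological_space measure \<Rightarrow> bool" where
  "finite_borel M \<longleftrightarrow> finite_measure M \<and> sets M = sets borel"

definition weakly_converges ::
    "('i \<Rightarrow> 'a::topological_space measure) \<Rightarrow> 'a measure \<Rightarrow> 'i filter \<Rightarrow> bool" where
  "weakly_converges M L A \<longleftrightarrow>
     (\<forall>\<^sub>F i in A. finite_borel (M i)) \<and> finite_borel L \<and>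
     (\<forall>f :: 'a \<Rightarrow> real. continuous_on UNIV f \<and> bounded (range f) \<longrightarrow>
        ((\<lambda>i. \<integral>x. f x \<partial>M i) \<longlongrightarrow> (\<integral>x. f x \<partial>L)) A)"

definition has_density :: "'a::euclidean_space measure \<Rightarrow> ('a \<Rightarrow> real) \<Rightarrow> bool" where
  "has_density M g \<longleftrightarrow>
     g \<in> borel_measurable borel \<and> (\<forall>x. 0 \<le> g x) \<and> M = density lborel (\<lambda>x. ennreal (g x))"

text \<open>Partial derivatives are with respect to the real coordinates; for \<open>complex ^ 'n\<close> the
  set \<open>Basis\<close> consists of the unit vectors and their multiples by the imaginary unit.\<close>

definition partial :: "'a::euclidean_space \<Rightarrow> ('a \<Rightarrow> real) \<Rightarrow> 'a \<Rightarrow> real" where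
  "partial v f x = deriv (\<lambda>t :: real. f (x + t *\<^sub>R v)) 0"

fun partials :: "'a::euclidean_space list \<Rightarrow> ('a \<Rightarrow> real) \<Rightarrow> 'a \<Rightarrow> real" where
  "partials [] f = f"
| "partials (v # vs) f = partials vs (partial v f)"

fun C_k :: "nat \<Rightarrow> ('a::euclidean_space \<Rightarrow> real) \<Rightarrow> bool" where
  "C_k 0 f \<longleftrightarrow> continuous_on UNIV f"
| "C_k (Suc q) f \<longleftrightarrow> continuous_on UNIV f \<and>
     (\<forall>v\<in>Basis. (\<forall>x. (\<lambda>t :: real. f (x + t *\<^sub>R v)) differentiable (at 0)) \<and> C_k q (partial v f))"

end

theory Submission
  imports Defs "HOL-Probability.Probability"
begin

text \<open>The two kinds of measures are treated at once: with independent uniform \<open>\<theta>\<^sub>m\<close>, let \<open>X\<^sub>n\<close> be the sum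
  of the local vectors \<open>log F\<^sub>p\<close> and \<open>V\<^sub>n\<close> the sum of the local (combinations of) logarithmic
  derivatives.  The Fourier transform \<open>R\<^sub>n(y) = E[exp(i y\<cdot>X\<^sub>n) |V\<^sub>n|\<^sup>2]\<close> satisfies, together with the
  same expectations without weight and with weights \<open>V\<^sub>n\<close> and its conjugate, a linear recursion in \<open>n\<close>.
  All local summands have mean zero and are square summable, uniformly in \<open>\<sigma> \<ge> 1\<close>, since \<open>\<theta> < 1/2\<close>;
  so \<open>R\<^sub>n\<close> converges uniformly.  The one-prime integral \<open>K\<^sub>p(y)\<close> is \<open>O(|y|\<^sup>-\<^sup>1\<^sup>/\<^sup>2)\<close> whenever the linear term
  of \<open>y\<cdot>log F\<^sub>p\<close> dominates the higher ones.  Orthogonality makes the series over \<open>p\<close> of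
  \<open>|\<beta>\<^sub>p(y)|\<^sup>2/p\<close> diverge for every \<open>y \<noteq> 0\<close>, where \<open>\<beta>\<^sub>p(y)\<close> is the coefficient of that term.  Hence
  \<open>|\<beta>\<^sub>p(y)|\<close> exceeds a fixed small negative power of \<open>p\<close> for infinitely many \<open>p\<close>, and by compactness of
  the sphere any number of such primes occurs among the first \<open>n\<^sub>q\<close>, for all directions at once.
  The recursion then bounds \<open>R\<^sub>n\<close> by an arbitrary power of \<open>|y|\<^sup>-\<^sup>1\<close>, locally uniformly in \<open>\<sigma>\<close>.
  Fourier inversion, dominated convergence and Scheffe's lemma (the total masses \<open>R\<^sub>n(0)\<close> converge) do the rest.\<close>

section \<open>Fourier inversion on Euclidean spaces\<close>

text \<open>The weight |V_n|^2 couples all primes, so the transform is not a product over primes.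
  Expanded, however, each of its terms singles out at most two primes and is a product over the
  others; at worst two good primes are lost, which a larger supply of them repairs.

  Convergence rests on second order cancellation: the sizes of the local terms, about p^(-1/2 -
  \<eta>), need not be summable over p, but their squares are, and the vanishing means remove
  everything of first order.

  The limit transform is not known beforehand to belong to a measure. The limit measure is therefore
  built from its density: positivity is inherited pointwise from finite n, and no mass is lost
  because the integral of a nonnegative density is read off from the transform at y = 0. No
  tightness argument occurs.

  Orthogonality is a statement on the coefficients a(p), while the local factors involve b(p^k)
  alone; that a(p) = b(p) has to be extracted from the exponential relation between the two
  series.\<close>

lemma borel_measurable_cis [measurable (raw)]:
  "f \<in> borel_measurable M \<Longrightarrow> (\<lambda>x. cis (f x)) \<in> borel_measurable M"
  by (rule borel_measurable_continuous_on[of cis]) (intro continuous_intros)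

section \<open>Gaussian integrals in several variables\<close>

definition gauss :: "'a::euclidean_space \<Rightarrow> real" where
  "gauss z = exp (- (norm z)\<^sup>2 / 2)"

lemma gauss_pos: "0 < gauss z" and gauss_le_1: "gauss z \<le> 1"
  by (simp_all add: gauss_def)

lemma continuous_gauss: "continuous_on A gauss"
  unfolding gauss_def by (intro continuous_intros) auto

lemma borel_measurable_gauss [measurable]: "gauss \<in> borel_measurable borel"
  by (rule borel_measurable_continuous_onI[OF continuous_gauss])

lemma gauss_prod: "gauss z = (\<Prod>b\<in>Basis. exp (- (z \<bullet> b)\<^sup>2 / 2))"
proof -
  have "(norm z)\<^sup>2 = (\<Sum>b\<in>Basis. (z \<bullet> b)\<^sup>2)"
    unfolding power2_norm_eq_inner by (subst euclidean_inner) (simp add: power2_eq_square)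
  then show ?thesis
    by (simp add: gauss_def exp_sum[symmetric] sum_negf sum_divide_distrib)
qed

text \<open>The characteristic function of the standard normal law, with the normalising factor 1 /
  sqrt (2 pi) cleared.\<close>

lemma gauss_1D:
  shows "integrable lborel (\<lambda>x::real. cis (t * x) * of_real (exp (- x\<^sup>2 / 2)))"
    and "(\<integral>x. cis (t * x) * of_real (exp (- x\<^sup>2 / 2)) \<partial>lborel) = of_real (sqrt (2 * pi) * exp (- t\<^sup>2 / 2))"
proof -
  have i0: "integrable lborel (\<lambda>x::real. std_normal_density x)" by simp
  have "integrable lborel (\<lambda>x::real. sqrt (2 * pi) * std_normal_density x)"
    using i0 by (rule integrable_mult_right)
  then have "integrable lborel (\<lambda>x::real. exp (- x\<^sup>2 / 2))"
    by (simp add: std_normal_density_def)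
  then show "integrable lborel (\<lambda>x::real. cis (t * x) * of_real (exp (- x\<^sup>2 / 2)))"
    by (rule Bochner_Integration.integrable_bound) (auto simp: norm_mult)
  have "of_real (exp (- t\<^sup>2 / 2)) = char std_normal_distribution t"
    by (simp add: char_std_normal_distribution)
  also have "\<dots> = (\<integral>x. std_normal_density x *\<^sub>R cis (t * x) \<partial>lborel)"
    unfolding char_def by (subst integral_density) (auto simp: cis_conv_exp)
  also have "\<dots> = (\<integral>x. of_real (1 / sqrt (2 * pi)) * (cis (t * x) * of_real (exp (- x\<^sup>2 / 2))) \<partial>lborel)"
    by (simp add: std_normal_density_def scaleR_conv_of_real mult_ac)
  also have "\<dots> = of_real (1 / sqrt (2 * pi)) * (\<integral>x. cis (t * x) * of_real (exp (- x\<^sup>2 / 2)) \<partial>lborel)"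
    by (rule integral_mult_right_zero)
  finally show "(\<integral>x. cis (t * x) * of_real (exp (- x\<^sup>2 / 2)) \<partial>lborel) = of_real (sqrt (2 * pi) * exp (- t\<^sup>2 / 2))"
    by (simp add: field_simps)
qed

text \<open>Lebesgue measure on a Euclidean space is the image of a product of one-dimensional ones
  under summation along \<open>Basis\<close>, so Fubini for finite products applies. Values are
  complex in order to admit oscillating factors.\<close>

lemma lborel_prod_integral:
  fixes f :: "'a::euclidean_space \<Rightarrow> real \<Rightarrow> complex"
  assumes "\<And>b. b \<in> Basis \<Longrightarrow> integrable lborel (f b)"
  shows "integrable lborel (\<lambda>x. \<Prod>b\<in>Basis. f b (x \<bullet> b))"
    and "(\<integral>x. (\<Prod>b\<in>Basis. f b (x \<bullet> b)) \<partial>lborel) = (\<Prod>b\<in>Basis. \<integral>x. f b x \<partial>lborel)"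
proof -
  interpret product_sigma_finite "\<lambda>_::'a. lborel :: real measure" by standard
  have m[measurable]: "f b \<in> borel_measurable borel" if "b \<in> Basis" for b
    using assms[OF that] by auto
  have m2: "(\<lambda>x. \<Prod>b\<in>Basis. f b (x \<bullet> b)) \<in> borel_measurable borel"
    by (intro borel_measurable_prod) measurable
  have m3: "(\<lambda>f. \<Sum>b\<in>Basis. f b *\<^sub>R b) \<in> (\<Pi>\<^sub>M b\<in>(Basis::'a set). lborel) \<rightarrow>\<^sub>M borel"
    by measurable
  have *: "(\<Prod>b\<in>Basis. f b ((\<Sum>b\<in>Basis. x b *\<^sub>R b) \<bullet> b)) = (\<Prod>b\<in>Basis. f b (x b))" for x
    by (intro prod.cong refl) simp
  have "integrable (\<Pi>\<^sub>M b\<in>(Basis::'a set). lborel) (\<lambda>x. \<Prod>b\<in>Basis. f b (x b))"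
    by (intro product_integrable_prod) (use assms in auto)
  then show "integrable lborel (\<lambda>x. \<Prod>b\<in>Basis. f b (x \<bullet> b))"
    unfolding lborel_eq[where 'a='a] by (subst integrable_distr_eq[OF m3 m2]) (simp only: *)
  show "(\<integral>x. (\<Prod>b\<in>Basis. f b (x \<bullet> b)) \<partial>lborel) = (\<Prod>b\<in>Basis. \<integral>x. f b x \<partial>lborel)"
    unfolding lborel_eq[where 'a='a] 
    apply (subst integral_distr[OF m3 m2])
    apply (simp only: *)
    by (intro product_integral_prod) (use assms in auto)
qed

lemma gauss_fourier:
  fixes y :: "'a::euclidean_space"
  shows "integrable lborel (\<lambda>x. cis (y \<bullet> x) * of_real (gauss x))"
    and "(\<integral>x. cis (y \<bullet> x) * of_real (gauss x) \<partial>lborel) = of_real (sqrt (2 * pi) ^ DIM('a) * gauss y)"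
proof -
  let ?f = "\<lambda>b x. cis ((y \<bullet> b) * x) * of_real (exp (- x\<^sup>2 / 2))"
  have cs: "cis (sum g A) = (\<Prod>b\<in>A. cis (g b))" if "finite A" for g and A :: "'a set"
    using that by (induction rule: finite_induct) (simp_all add: cis_mult[symmetric])
  have "cis (y \<bullet> x) = (\<Prod>b\<in>Basis. cis ((y \<bullet> b) * (x \<bullet> b)))" for x
    by (subst euclidean_inner) (simp add: cs)
  then have *: "cis (y \<bullet> x) * of_real (gauss x) = (\<Prod>b\<in>Basis. ?f b (x \<bullet> b))" for x
    by (simp add: gauss_prod prod.distrib)
  show "integrable lborel (\<lambda>x. cis (y \<bullet> x) * of_real (gauss x))"
    unfolding * by (rule lborel_prod_integral) (rule gauss_1D)
  show "(\<integral>x. cis (y \<bullet> x) * of_real (gauss x) \<partial>lborel) = of_real (sqrt (2 * pi) ^ DIM('a) * gauss y)"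
    unfolding *
    by (subst lborel_prod_integral(2)[OF gauss_1D(1)])
       (simp only: gauss_1D(2) gauss_prod of_real_mult prod.distrib prod_constant of_real_prod of_real_power)
qed

lemma integrable_gauss: "integrable lborel (gauss :: 'a::euclidean_space \<Rightarrow> real)"
proof -
  have "integrable lborel (\<lambda>x::'a. Re (cis (0 \<bullet> x) * of_real (gauss x)))"
    by (intro integrable_Re gauss_fourier)
  then show ?thesis by simp
qed

lemma integral_gauss: "(\<integral>x. gauss (x::'a) \<partial>lborel) = sqrt (2 * pi) ^ DIM('a::euclidean_space)"
proof -
  have "of_real (\<integral>x. gauss (x::'a) \<partial>lborel) = (\<integral>x. cis (0 \<bullet> x) * of_real (gauss (x::'a)) \<partial>lborel)"
    by simp
  also have "\<dots> = of_real (sqrt (2 * pi) ^ DIM('a))"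
    by (subst gauss_fourier) (simp add: gauss_def)
  finally show ?thesis by (simp only: of_real_eq_iff)
qed

lemma lborel_affine_integral:
  fixes f :: "'a::euclidean_space \<Rightarrow> 'b::{banach, second_countable_topology}"
  assumes [measurable]: "f \<in> borel_measurable borel" and "c \<noteq> 0"
  shows "(\<integral>x. f x \<partial>lborel) = \<bar>c\<bar> ^ DIM('a) *\<^sub>R (\<integral>x. f (t + c *\<^sub>R x) \<partial>lborel)"
    and "integrable lborel f \<longleftrightarrow> integrable lborel (\<lambda>x. f (t + c *\<^sub>R x))"
proof -
  show "(\<integral>x. f x \<partial>lborel) = \<bar>c\<bar> ^ DIM('a) *\<^sub>R (\<integral>x. f (t + c *\<^sub>R x) \<partial>lborel)"
    apply (subst lborel_affine[OF \<open>c \<noteq> 0\<close>, where t=t])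
    apply (subst integral_density)
       apply (auto simp: integral_distr)
    done
  have *: "integrable lborel (\<lambda>x. k *\<^sub>R h x) \<longleftrightarrow> integrable lborel h" if "k \<noteq> 0"
    for k :: real and h :: "'a \<Rightarrow> 'b"
    using integrable_scaleR_right[of "inverse k" lborel "\<lambda>x. k *\<^sub>R h x"] that by auto
  show "integrable lborel f \<longleftrightarrow> integrable lborel (\<lambda>x. f (t + c *\<^sub>R x))"
    apply (subst lborel_affine[OF \<open>c \<noteq> 0\<close>, where t=t])
    apply (subst integrable_density)
       apply (auto simp: integrable_distr_eq * \<open>c \<noteq> 0\<close>)
    done
qed

lemma gauss_fourier_scaled:
  fixes y :: "'a::euclidean_space"
  assumes "e > 0"
  shows "integrable lborel (\<lambda>x. cis (y \<bullet> x) * of_real (gauss (e *\<^sub>R x)))"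
    and "(\<integral>x. cis (y \<bullet> x) * of_real (gauss (e *\<^sub>R x)) \<partial>lborel)
          = of_real ((sqrt (2 * pi) / e) ^ DIM('a) * gauss (y /\<^sub>R e))"
proof -
  have eq: "(\<lambda>x. cis (y \<bullet> (0 + (1/e) *\<^sub>R x)) * of_real (gauss (e *\<^sub>R (0 + (1/e) *\<^sub>R x))))
          = (\<lambda>x. cis ((y /\<^sub>R e) \<bullet> x) * complex_of_real (gauss x))"
    using assms by (auto simp: field_simps)
  show "integrable lborel (\<lambda>x. cis (y \<bullet> x) * of_real (gauss (e *\<^sub>R x)))"
    apply (subst lborel_affine_integral(2)[where c = "1/e" and t = 0])
    using assms gauss_fourier(1)[of "y /\<^sub>R e"] unfolding eq by auto
  show "(\<integral>x. cis (y \<bullet> x) * of_real (gauss (e *\<^sub>R x)) \<partial>lborel)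
          = of_real ((sqrt (2 * pi) / e) ^ DIM('a) * gauss (y /\<^sub>R e))"
    apply (subst lborel_affine_integral(1)[where c = "1/e" and t = 0])
    using assms apply (simp, simp)
    unfolding eq gauss_fourier(2)
    using assms by (simp add: scaleR_conv_of_real power_divide field_simps)
qed

lemma gauss_minus [simp]: "gauss (- x) = gauss x"
  by (simp add: gauss_def)

section \<open>Inversion of integrable characteristic functions\<close>

text \<open>Conjugate sign and no factor (2 pi)^(-d): the normalisation is deferred to
  \<open>dens\<close>.\<close>

definition ift :: "('a::euclidean_space \<Rightarrow> complex) \<Rightarrow> 'a \<Rightarrow> complex" where
  "ift \<phi> x = (\<integral>y. cis (- (x \<bullet> y)) * \<phi> y \<partial>lborel)"

lemma integrable_cis_mult:
  fixes \<phi> :: "'a::euclidean_space \<Rightarrow> complex"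
  assumes "integrable M \<phi>" "g \<in> borel_measurable M"
  shows "integrable M (\<lambda>y. cis (g y) * \<phi> y)"
  by (rule Bochner_Integration.integrable_bound[OF assms(1)]) (use assms in \<open>auto simp: norm_mult\<close>)

lemma scale_seq: "(\<lambda>n. inverse (real (Suc n)) *\<^sub>R x) \<longlonglongrightarrow> (0::'a::real_normed_vector)"
  using tendsto_scaleR[OF LIMSEQ_inverse_real_of_nat tendsto_const[of x]] by simp

text \<open>Integrability of \<open>g\<close> is a conclusion here; only its sign is known. Against
  the damping factor \<open>gauss\<close> at scale \<open>e n\<close>, Fubini turns the integral of
  \<open>g\<close> into an average of \<phi> over a Gaussian that shrinks to 0. As
  \<open>e n\<close> decreases to 0 the damping increases to 1, and monotone convergence yields both
  claims.\<close>

lemma ift_mass: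
  fixes \<phi> :: "'a::euclidean_space \<Rightarrow> complex"
  assumes int: "integrable lborel \<phi>" and bd: "\<And>y. norm (\<phi> y) \<le> B" and cont: "isCont \<phi> 0"
    and g: "\<And>x. ift \<phi> x = of_real (g x)" "\<And>x. 0 \<le> g x" "g \<in> borel_measurable borel"
  shows "integrable lborel g" and "of_real (\<integral>x. g x \<partial>lborel) = (2 * pi) ^ DIM('a) * \<phi> 0"
proof -
  have [measurable]: "\<phi> \<in> borel_measurable borel" using int by auto
  note [measurable] = g(3)
  define e where "e n = inverse (real (Suc n))" for n
  have e: "e n > 0" for n by (simp add: e_def)
  define h where "h n x = gauss (e n *\<^sub>R x) * g x" for n x
  let ?s = "sqrt (2 * pi)"
  have ig: "integrable lborel (\<lambda>x::'a. gauss (e n *\<^sub>R x))" for n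
  proof -
    have "integrable lborel (\<lambda>x::'a. Re (cis (0 \<bullet> x) * of_real (gauss (e n *\<^sub>R x))))"
      by (intro integrable_Re gauss_fourier_scaled e)
    then show ?thesis by simp
  qed
  have cint: "complex_of_real (h n x) = (\<integral>y. of_real (gauss (e n *\<^sub>R x)) * (cis (- (x \<bullet> y)) * \<phi> y) \<partial>lborel)" for n x
    by (simp add: h_def g(1)[symmetric] ift_def)
  have fub: "integrable (lborel \<Otimes>\<^sub>M lborel) (\<lambda>(x, y). of_real (gauss (e n *\<^sub>R x)) * (cis (- (x \<bullet> y)) * \<phi> y))" for n
  proof (rule lborel_pair.Fubini_integrable)
    have *: "norm (case (x, y) of (x, y) \<Rightarrow> complex_of_real (gauss (e n *\<^sub>R x)) * (cis (- (x \<bullet> y)) * \<phi> y))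
       = gauss (e n *\<^sub>R x) * norm (\<phi> y)" for x y
      using gauss_pos[of "e n *\<^sub>R x"] by (simp add: norm_mult)
    show "integrable lborel (\<lambda>x. \<integral>y. norm (case (x, y) of (x, y) \<Rightarrow> complex_of_real (gauss (e n *\<^sub>R x)) * (cis (- (x \<bullet> y)) * \<phi> y)) \<partial>lborel)"
      unfolding * using ig[of n] by simp
    show "AE x in lborel. integrable lborel (\<lambda>y. case (x, y) of (x, y) \<Rightarrow> complex_of_real (gauss (e n *\<^sub>R x)) * (cis (- (x \<bullet> y)) * \<phi> y))"
      unfolding prod.case by (intro AE_I2 integrable_mult_right integrable_cis_mult int) measurable
  qed measurable
  have hint: "integrable lborel (h n)" for n
  proof -
    have "integrable lborel (\<lambda>x. Re (complex_of_real (h n x)))"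
      unfolding cint by (intro integrable_Re lborel_pair.integrable_fst[OF fub])
    then show ?thesis by simp
  qed
  have hval: "complex_of_real (\<integral>x. h n x \<partial>lborel) = ?s ^ DIM('a) * (\<integral>y. of_real (gauss y) * \<phi> (e n *\<^sub>R y) \<partial>lborel)" for n
  proof -
    have "complex_of_real (\<integral>x. h n x \<partial>lborel) = (\<integral>x. complex_of_real (h n x) \<partial>lborel)" by simp
    also have "\<dots> = (\<integral>x. (\<integral>y. of_real (gauss (e n *\<^sub>R x)) * (cis (- (x \<bullet> y)) * \<phi> y) \<partial>lborel) \<partial>lborel)"
      unfolding cint ..
    also have "\<dots> = (\<integral>y. (\<integral>x. of_real (gauss (e n *\<^sub>R x)) * (cis (- (x \<bullet> y)) * \<phi> y) \<partial>lborel) \<partial>lborel)"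
      by (rule lborel_pair.Fubini_integral[symmetric]) (rule fub)
    also have "\<dots> = (\<integral>y. of_real ((?s / e n) ^ DIM('a) * gauss (y /\<^sub>R e n)) * \<phi> y \<partial>lborel)"
    proof (rule Bochner_Integration.integral_cong[OF refl])
      fix y :: 'a
      have "(\<integral>x. of_real (gauss (e n *\<^sub>R x)) * (cis (- (x \<bullet> y)) * \<phi> y) \<partial>lborel)
          = (\<integral>x. \<phi> y * (cis ((- y) \<bullet> x) * of_real (gauss (e n *\<^sub>R x))) \<partial>lborel)"
        by (simp add: inner_commute mult_ac)
      also have "\<dots> = \<phi> y * of_real ((?s / e n) ^ DIM('a) * gauss (y /\<^sub>R e n))"
        by (subst integral_mult_right_zero, subst gauss_fourier_scaled[OF e]) simp
      finally show "(\<integral>x. of_real (gauss (e n *\<^sub>R x)) * (cis (- (x \<bullet> y)) * \<phi> y) \<partial>lborel)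
         = of_real ((?s / e n) ^ DIM('a) * gauss (y /\<^sub>R e n)) * \<phi> y" by simp
    qed
    also have "\<dots> = e n ^ DIM('a) *\<^sub>R (\<integral>y. of_real ((?s / e n) ^ DIM('a) * gauss ((0 + e n *\<^sub>R y) /\<^sub>R e n)) * \<phi> (0 + e n *\<^sub>R y) \<partial>lborel)"
      using e[of n] by (subst lborel_affine_integral(1)[where c = "e n" and t = 0]) (auto simp: abs_of_pos)
    also have "\<dots> = e n ^ DIM('a) *\<^sub>R (of_real ((?s / e n) ^ DIM('a)) * (\<integral>y. of_real (gauss y) * \<phi> (e n *\<^sub>R y) \<partial>lborel))"
      using e[of n] by (subst integral_mult_right_zero[symmetric]) (simp add: mult_ac)
    also have "\<dots> = ?s ^ DIM('a) * (\<integral>y. of_real (gauss y) * \<phi> (e n *\<^sub>R y) \<partial>lborel)"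
      using e[of n] by (simp add: scaleR_conv_of_real power_divide)
    finally show ?thesis .
  qed
  have "(\<lambda>n. \<integral>y. of_real (gauss y) * \<phi> (e n *\<^sub>R y) \<partial>lborel) \<longlonglongrightarrow> (\<integral>y. of_real (gauss (y::'a)) * \<phi> 0 \<partial>lborel)"
  proof (rule integral_dominated_convergence[where w = "\<lambda>y::'a. gauss y * B"])
    show "AE y in lborel. (\<lambda>n. complex_of_real (gauss y) * \<phi> (e n *\<^sub>R y)) \<longlonglongrightarrow> of_real (gauss y) * \<phi> 0"
      unfolding e_def using isCont_tendsto_compose[OF cont scale_seq] by (auto intro!: tendsto_intros)
    show "AE y in lborel. norm (complex_of_real (gauss y) * \<phi> (e n *\<^sub>R y)) \<le> gauss y * B" for n
      using bd by (auto simp: norm_mult abs_of_pos[OF gauss_pos] less_imp_le[OF gauss_pos] intro!: AE_I2 mult_left_mono)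
  qed (auto intro: integrable_gauss)
  also have "(\<integral>y. of_real (gauss (y::'a)) * \<phi> 0 \<partial>lborel) = ?s ^ DIM('a) * \<phi> 0"
    using integral_gauss[where 'a='a] integrable_gauss[where 'a='a] by simp
  finally have "(\<lambda>n. complex_of_real (\<integral>x. h n x \<partial>lborel)) \<longlonglongrightarrow> ?s ^ DIM('a) * (?s ^ DIM('a) * \<phi> 0)"
    unfolding hval by (intro tendsto_intros) auto
  moreover have "complex_of_real ?s ^ DIM('a) * (?s ^ DIM('a) * \<phi> 0) = (2 * pi) ^ DIM('a) * \<phi> 0"
  proof -
    have "complex_of_real ?s * of_real ?s = 2 * pi" by (simp only: of_real_mult[symmetric]) simp
    then show ?thesis by (simp only: of_real_power mult.assoc[symmetric] power_mult_distrib[symmetric])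
  qed
  ultimately have lim: "(\<lambda>n. complex_of_real (\<integral>x. h n x \<partial>lborel)) \<longlonglongrightarrow> (2 * pi) ^ DIM('a) * \<phi> 0"
    by (simp only: of_real_power)
  have limR: "(\<lambda>n. \<integral>x. h n x \<partial>lborel) \<longlonglongrightarrow> Re ((2 * pi) ^ DIM('a) * \<phi> 0)"
    using tendsto_Re[OF lim] by simp
  have limI: "Im ((2 * pi) ^ DIM('a) * \<phi> 0) = 0"
    using tendsto_Im[OF lim] by (simp add: LIMSEQ_const_iff)
  have mono: "mono (\<lambda>n. h n x)" for x
  proof (rule incseq_SucI)
    fix n
    have "e (Suc n) \<le> e n" by (simp add: e_def field_simps)
    then have "(e (Suc n) * norm x)\<^sup>2 \<le> (e n * norm x)\<^sup>2"
      using e[of "Suc n"] by (intro power_mono mult_right_mono) (auto simp: less_imp_le)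
    then have "gauss (e n *\<^sub>R x) \<le> gauss (e (Suc n) *\<^sub>R x)"
      using e[of n] e[of "Suc n"] by (simp add: gauss_def)
    then show "h n x \<le> h (Suc n) x"
      unfolding h_def by (intro mult_right_mono g(2))
  qed
  have ptw: "(\<lambda>n. h n x) \<longlonglongrightarrow> g x" for x
  proof -
    have "isCont gauss (0::'a)" using continuous_gauss[where A = "UNIV :: 'a set"] by (simp add: continuous_on_eq_continuous_at)
    then have "(\<lambda>n. gauss (e n *\<^sub>R x)) \<longlonglongrightarrow> gauss (0::'a)"
      unfolding e_def by (rule isCont_tendsto_compose[OF _ scale_seq])
    then have "(\<lambda>n. gauss (e n *\<^sub>R x) * g x) \<longlonglongrightarrow> gauss (0::'a) * g x" by (intro tendsto_intros)
    then show ?thesis by (simp add: h_def gauss_def)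
  qed
  have *: "has_bochner_integral lborel g (Re ((2 * pi) ^ DIM('a) * \<phi> 0))"
    by (rule has_bochner_integral_monotone_convergence[where f = h])
       (use hint mono ptw limR in auto)
  then show "integrable lborel g" by (rule integrable.intros)
  show "of_real (\<integral>x. g x \<partial>lborel) = (2 * pi) ^ DIM('a) * \<phi> 0"
    using has_bochner_integral_integral_eq[OF *] limI by (simp add: complex_eq_iff)
qed

text \<open>Pointwise convergence of nonnegative functions together with convergence of their
  integrals is convergence in L1, which survives multiplication by a bounded \<open>f\<close>. No
  common majorant of the \<open>G n\<close> is assumed.\<close>

lemma scheffe_bounded:
  fixes G :: "nat \<Rightarrow> 'a \<Rightarrow> real"
  assumes G: "\<And>n. integrable M (G n)" "\<And>n x. 0 \<le> G n x" and g: "integrable M g" "\<And>x. 0 \<le> g x"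
    and ptw: "\<And>x. (\<lambda>n. G n x) \<longlonglongrightarrow> g x"
    and mass: "(\<lambda>n. \<integral>x. G n x \<partial>M) \<longlonglongrightarrow> (\<integral>x. g x \<partial>M)"
    and f: "f \<in> borel_measurable M" "\<And>x. \<bar>f x\<bar> \<le> B"
  shows "(\<lambda>n. \<integral>x. f x * G n x \<partial>M) \<longlonglongrightarrow> (\<integral>x. f x * g x \<partial>M)"
proof -
  have nn: "(\<integral>\<^sup>+x. norm (G n x) \<partial>M) = ennreal (\<integral>x. G n x \<partial>M)" for n
    using G by (simp add: nn_integral_eq_integral)
  have nn2: "(\<integral>\<^sup>+x. norm (g x) \<partial>M) = ennreal (\<integral>x. g x \<partial>M)"
    using g by (simp add: nn_integral_eq_integral)
  have "(\<lambda>n. ennreal (\<integral>x. G n x \<partial>M)) \<longlonglongrightarrow> ennreal (\<integral>x. g x \<partial>M)"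
    using mass by (rule tendsto_ennrealI)
  then have "limsup (\<lambda>n. \<integral>\<^sup>+x. norm (G n x) \<partial>M) \<le> (\<integral>\<^sup>+x. norm (g x) \<partial>M)"
    unfolding nn nn2 by (simp add: lim_imp_Limsup)
  then have lim: "(\<lambda>n. \<integral>\<^sup>+x. norm (G n x - g x) \<partial>M) \<longlonglongrightarrow> 0"
    using G g ptw by (intro Scheffe_lemma1) auto
  have i: "integrable M (\<lambda>x. norm (G n x - g x))" for n using G g by auto
  have "(\<lambda>n. ennreal (\<integral>x. norm (G n x - g x) \<partial>M)) \<longlonglongrightarrow> ennreal 0"
    using lim by (subst (asm) nn_integral_eq_integral[OF i]) auto
  then have lim': "(\<lambda>n. \<integral>x. norm (G n x - g x) \<partial>M) \<longlonglongrightarrow> 0"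
    by (subst (asm) tendsto_ennreal_iff) auto
  have fi: "integrable M (\<lambda>x. f x * h x)" if "integrable M h" for h :: "'a \<Rightarrow> real"
    by (rule Bochner_Integration.integrable_bound[OF integrable_mult_right[of B, OF that]])
       (use f that order_trans[OF abs_ge_zero f(2)] in \<open>auto simp: abs_mult intro!: mult_right_mono\<close>)
  have B: "B \<ge> 0" using f(2) abs_ge_zero order_trans by blast
  show ?thesis
  proof (rule LIM_zero_cancel, rule tendsto_rabs_zero_cancel, rule tendsto_sandwich[OF _ _ tendsto_const])
    show "(\<lambda>n. B * (\<integral>x. norm (G n x - g x) \<partial>M)) \<longlonglongrightarrow> 0"
      using tendsto_mult[OF tendsto_const lim', of B] by simp
    have "\<bar>(\<integral>x. f x * G n x \<partial>M) - (\<integral>x. f x * g x \<partial>M)\<bar> \<le> B * (\<integral>x. norm (G n x - g x) \<partial>M)" for n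
    proof -
      have "(\<integral>x. f x * G n x \<partial>M) - (\<integral>x. f x * g x \<partial>M) = (\<integral>x. f x * (G n x - g x) \<partial>M)"
        using fi[OF G(1)] fi[OF g(1)] by (simp add: right_diff_distrib)
      also have "norm \<dots> \<le> (\<integral>x. norm (f x * (G n x - g x)) \<partial>M)" by (rule integral_norm_bound)
      also have "\<dots> \<le> (\<integral>x. B * norm (G n x - g x) \<partial>M)"
      proof (rule integral_mono)
        show "integrable M (\<lambda>x. norm (f x * (G n x - g x)))" using fi[of "\<lambda>x. G n x - g x"] G g by auto
      qed (use i f in \<open>auto simp: abs_mult intro!: mult_right_mono\<close>)
      finally show ?thesis by simp
    qed
    then show "\<forall>\<^sub>F n in sequentially. \<bar>(\<integral>x. f x * G n x \<partial>M) - (\<integral>x. f x * g x \<partial>M)\<bar> \<le> B * (\<integral>x. norm (G n x - g x) \<partial>M)"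
      by simp
  qed simp
qed

text \<open>The indicator of an open set U is the increasing limit of the functions
  \<open>min 1 (n * infdist x (- U))\<close>, so the hypothesis determines both measures on the open
  sets, an intersection-stable generator.\<close>

lemma measure_eqI_bounded_continuous:
  fixes M N :: "'a::metric_space measure"
  assumes "finite_measure M" "finite_measure N" and sets: "sets M = sets borel" "sets N = sets borel"
    and eq: "\<And>f :: 'a \<Rightarrow> real. continuous_on UNIV f \<Longrightarrow> (\<forall>x. \<bar>f x\<bar> \<le> 1) \<Longrightarrow> (\<integral>x. f x \<partial>M) = (\<integral>x. f x \<partial>N)"
  shows "M = N"
proof (rule measure_eqI_generator_eq[where E = "{S. open S}" and \<Omega> = UNIV and A = "\<lambda>_. UNIV"])
  interpret M: finite_measure M by fact
  interpret N: finite_measure N by fact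
  have sp: "space M = UNIV" "space N = UNIV" using sets by (auto dest: sets_eq_imp_space_eq)
  have op: "measure M U = measure N U" if "open U" for U
  proof (cases "U = UNIV")
    \<comment> \<open>\<open>infdist\<close> to the empty set is 0 by convention, so the
      approximation used below fails for the whole space.\<close>
    case True
    then show ?thesis using eq[of "\<lambda>_. 1"] sp by simp
  next
    case False
    define f where "f n x = min 1 (real n * infdist x (- U))" for n x
    have c: "continuous_on UNIV (f n)" for n
      unfolding f_def by (intro continuous_intros)
    have b: "\<bar>f n x\<bar> \<le> 1" for n x unfolding f_def using infdist_nonneg[of x "- U"] by auto
    have e: "(\<integral>x. f n x \<partial>M) = (\<integral>x. f n x \<partial>N)" for n using eq[OF c] b by auto
    have ptw: "(\<lambda>n. f n x) \<longlonglongrightarrow> indicator U x" for x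
    proof (cases "x \<in> U")
      case True
      have "infdist x (- U) > 0"
        using True False that infdist_pos_not_in_closed[of "- U" x] by (auto simp: closed_def)
      then obtain n0 where "1 < real n0 * infdist x (- U)" using reals_Archimedean3 by blast
      then have "f n x = 1" if "n \<ge> n0" for n
      proof -
        have "real n0 * infdist x (- U) \<le> real n * infdist x (- U)"
          using that infdist_nonneg[of x "- U"] by (intro mult_right_mono) auto
        then show ?thesis using \<open>1 < _\<close> by (simp add: f_def)
      qed
      then have "\<forall>\<^sub>F n in sequentially. f n x = 1" by (auto simp: eventually_sequentially)
      then show ?thesis using True by (simp add: tendsto_eventually)
    qed (simp add: f_def)
    have lim: "(\<lambda>n. \<integral>x. f n x \<partial>K) \<longlonglongrightarrow> (\<integral>x. indicator U x \<partial>K)"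
      if "finite_measure K" "sets K = sets borel" for K
    proof (rule integral_dominated_convergence[where w = "\<lambda>_. 1"])
      interpret K: finite_measure K by fact
      show "integrable K (\<lambda>_. 1::real)" by simp
      show "f n \<in> borel_measurable K" for n
        using borel_measurable_continuous_onI[OF c] that(2) by (simp cong: measurable_cong_sets)
      have "indicator U \<in> borel_measurable (borel :: 'a measure)"
        using \<open>open U\<close> by (intro borel_measurable_indicator) auto
      then show "(indicator U :: 'a \<Rightarrow> real) \<in> borel_measurable K" 
        using that(2) by (simp cong: measurable_cong_sets)
    qed (use ptw b in auto)
    have "(\<integral>x. indicator U x \<partial>M) = (\<integral>x. indicator U x \<partial>N :: real)"
      using LIMSEQ_unique[OF lim[OF M.finite_measure_axioms sets(1)]] lim[OF N.finite_measure_axioms sets(2)]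
      unfolding e by blast
    then show ?thesis using sp by simp
  qed
  show "emeasure M X = emeasure N X" if "X \<in> {S. open S}" for X
    using op[of X] that M.emeasure_eq_measure N.emeasure_eq_measure by simp
  show "Int_stable {S::'a set. open S}" by (auto simp: Int_stable_def)
  show "sets M = sigma_sets UNIV {S. open S}" "sets N = sigma_sets UNIV {S. open S}"
    using sets by (simp_all add: borel_def)
qed (auto simp: finite_measure.emeasure_finite assms)

lemma gauss_nonneg [simp]: "0 \<le> gauss z" and abs_gauss [simp]: "\<bar>gauss z\<bar> = gauss z"
  by (simp_all add: gauss_def)

lemma borel_measurable_ift:
  fixes \<phi> :: "'a::euclidean_space \<Rightarrow> complex"
  assumes [measurable]: "\<phi> \<in> borel_measurable borel"
  shows "ift \<phi> \<in> borel_measurable borel"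
  unfolding ift_def by measurable

definition charf :: "'a::euclidean_space measure \<Rightarrow> 'a \<Rightarrow> complex" where
  "charf M y = (\<integral>u. cis (y \<bullet> u) \<partial>M)"

text \<open>The candidate \<open>g\<close> is the pointwise limit of the densities
  \<open>G n\<close> of M convolved with shrinking Gaussians. These are nonnegative with the mass of
  M, and \<open>ift_mass\<close> gives \<open>g\<close> the same mass, so nothing escapes: integrals
  of test functions against \<open>G n\<close> tend both to the integral against \<open>g\<close>,
  by \<open>scheffe_bounded\<close>, and to the integral against M.\<close>

lemma fourier_inversion:
  fixes M :: "'a::euclidean_space measure"
  assumes fin: "finite_measure M" and sets [measurable_cong]: "sets M = sets borel"
    and int: "integrable lborel (charf M)"
  defines "g \<equiv> \<lambda>x. Re (ift (charf M) x) / (2 * pi) ^ DIM('a)"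
  shows "has_density M g" "integrable lborel g" "(\<integral>x. g x \<partial>lborel) = measure M UNIV"
    "\<And>x. ift (charf M) x = of_real ((2 * pi) ^ DIM('a) * g x)"
proof -
  let ?\<phi> = "charf M"
  let ?s = "sqrt (2 * pi)"
  let ?k = "(2 * pi) ^ DIM('a)"
  interpret finite_measure M by fact
  interpret P: pair_sigma_finite M "lborel :: 'a measure" by standard
  have sp: "space M = UNIV" using sets by (auto dest: sets_eq_imp_space_eq)
  have \<phi>[measurable]: "?\<phi> \<in> borel_measurable borel" using int by auto
  have ci: "integrable M (\<lambda>u. cis (h u))" if "h \<in> borel_measurable M" for h :: "'a \<Rightarrow> real"
    using that by (intro integrable_const_bound[where B = 1]) auto
  have bd: "norm (?\<phi> y) \<le> measure M UNIV" for y
  proof -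
    have "norm (?\<phi> y) \<le> (\<integral>u. norm (cis (y \<bullet> u)) \<partial>M)" unfolding charf_def by (rule integral_norm_bound)
    then show ?thesis using sp by simp
  qed
  have cont: "isCont ?\<phi> 0"
  proof -
    have "?\<phi> \<midarrow>0\<rightarrow> ?\<phi> 0"
      unfolding tendsto_at_iff_sequentially comp_def charf_def
    proof (intro allI impI, rule integral_dominated_convergence[where w = "\<lambda>_. 1"])
      fix X :: "nat \<Rightarrow> 'a" assume "X \<longlonglongrightarrow> 0"
      then show "AE u in M. (\<lambda>i. cis (X i \<bullet> u)) \<longlonglongrightarrow> cis (0 \<bullet> u)"
        by (intro AE_I2 isCont_tendsto_compose[of _ cis] tendsto_intros) auto
    qed auto
    then show ?thesis by (simp add: isCont_def)
  qed
  define e where "e n = inverse (real (Suc n))" for n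
  have e: "e n > 0" for n by (simp add: e_def)
  \<comment> \<open>Density of the convolution of M with the centred Gaussian of standard deviation
    \<open>e n\<close>; the constant equals (2 pi)^(-d/2) times \<open>e n\<close> to the power
    -d.\<close>
  define G where "G n x = (?s / e n) ^ DIM('a) / ?k * (\<integral>u. gauss ((u - x) /\<^sub>R e n) \<partial>M)" for n x
  have gi: "integrable M (\<lambda>u. gauss (h u))" if "h \<in> borel_measurable M" for h :: "'a \<Rightarrow> 'a"
    using that by (intro integrable_const_bound[where B = 1] AE_I2) (auto simp: abs_of_pos[OF gauss_pos] gauss_le_1)
  have ig: "integrable lborel (\<lambda>x::'a. gauss (e n *\<^sub>R x))" for n
  proof -
    have "integrable lborel (\<lambda>x::'a. Re (cis (0 \<bullet> x) * of_real (gauss (e n *\<^sub>R x))))"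
      by (intro integrable_Re gauss_fourier_scaled e)
    then show ?thesis by simp
  qed
  have Gnn: "0 \<le> G n x" for n x
    unfolding G_def using e[of n] 
    by (intro mult_nonneg_nonneg divide_nonneg_nonneg integral_nonneg_AE AE_I2) auto
  \<comment> \<open>Damping the inversion integral by a Gaussian amounts to convolving M with one;
    hence the undamped limit is real and nonnegative.\<close>
  have Gft: "of_real (G n x * ?k) = (\<integral>y. of_real (gauss (e n *\<^sub>R y)) * (cis (- (x \<bullet> y)) * ?\<phi> y) \<partial>lborel)" for n x
  proof -
    let ?F = "\<lambda>u y. complex_of_real (gauss (e n *\<^sub>R y)) * (cis (- (x \<bullet> y)) * cis (y \<bullet> u))"
    have fub: "integrable (M \<Otimes>\<^sub>M lborel) (\<lambda>(u, y). ?F u y)"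
    proof (rule P.Fubini_integrable)
      have *: "norm (case (u, y) of (u, y) \<Rightarrow> ?F u y) = gauss (e n *\<^sub>R y)" for u y
        by (simp add: norm_mult abs_of_pos[OF gauss_pos])
      show "integrable M (\<lambda>u. \<integral>y. norm (case (u, y) of (u, y) \<Rightarrow> ?F u y) \<partial>lborel)"
        unfolding * by simp
      show "AE u in M. integrable lborel (\<lambda>y. case (u, y) of (u, y) \<Rightarrow> ?F u y)"
        using ig[of n] by (intro AE_I2 Bochner_Integration.integrable_bound[OF ig[of n]]) (auto simp: norm_mult)
    qed measurable
    have "(\<integral>y. of_real (gauss (e n *\<^sub>R y)) * (cis (- (x \<bullet> y)) * ?\<phi> y) \<partial>lborel) = (\<integral>y. (\<integral>u. ?F u y \<partial>M) \<partial>lborel)"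
      unfolding charf_def by simp
    also have "\<dots> = (\<integral>u. (\<integral>y. ?F u y \<partial>lborel) \<partial>M)"
      by (rule P.Fubini_integral) (rule fub)
    also have "\<dots> = (\<integral>u. of_real ((?s / e n) ^ DIM('a) * gauss ((u - x) /\<^sub>R e n)) \<partial>M)"
    proof (rule Bochner_Integration.integral_cong[OF refl])
      fix u
      have "(\<integral>y. ?F u y \<partial>lborel) = (\<integral>y. cis ((u - x) \<bullet> y) * of_real (gauss (e n *\<^sub>R y)) \<partial>lborel)"
        by (intro Bochner_Integration.integral_cong) 
           (auto simp: cis_mult inner_diff_left inner_diff_right inner_commute algebra_simps)
      then show "(\<integral>y. ?F u y \<partial>lborel) = of_real ((?s / e n) ^ DIM('a) * gauss ((u - x) /\<^sub>R e n))"
        using gauss_fourier_scaled(2)[OF e] by metis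
    qed
    also have "\<dots> = of_real ((?s / e n) ^ DIM('a) * (\<integral>u. gauss ((u - x) /\<^sub>R e n) \<partial>M))"
      by simp
    finally show ?thesis by (simp add: G_def)
  qed
  have lim: "(\<lambda>n. complex_of_real (G n x * ?k)) \<longlonglongrightarrow> ift ?\<phi> x" for x
    unfolding Gft ift_def
  proof (rule integral_dominated_convergence[where w = "\<lambda>y. norm (?\<phi> y)"])
    have "isCont gauss (0::'a)" using continuous_gauss[where A = "UNIV :: 'a set"] by (simp add: continuous_on_eq_continuous_at)
    then have "(\<lambda>n. gauss (e n *\<^sub>R y)) \<longlonglongrightarrow> gauss (0::'a)" for y :: 'a
      unfolding e_def by (rule isCont_tendsto_compose[OF _ scale_seq])
    then have "(\<lambda>n. complex_of_real (gauss (e n *\<^sub>R y)) * (cis (- (x \<bullet> y)) * ?\<phi> y)) \<longlonglongrightarrow>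
        of_real (gauss (0::'a)) * (cis (- (x \<bullet> y)) * ?\<phi> y)" for y :: 'a
      by (intro tendsto_intros)
    then show "AE y in lborel. (\<lambda>n. complex_of_real (gauss (e n *\<^sub>R y)) * (cis (- (x \<bullet> y)) * ?\<phi> y)) \<longlonglongrightarrow>
        cis (- (x \<bullet> y)) * ?\<phi> y"
      by (auto simp: gauss_def)
    show "AE y in lborel. norm (complex_of_real (gauss (e n *\<^sub>R y)) * (cis (- (x \<bullet> y)) * ?\<phi> y)) \<le> norm (?\<phi> y)" for n
      using gauss_le_1 by (intro AE_I2) (auto simp: norm_mult abs_of_pos[OF gauss_pos] intro!: mult_left_le_one_le less_imp_le[OF gauss_pos])
  qed (use int in auto)
  have imz: "Im (ift ?\<phi> x) = 0" for x
    using tendsto_Im[OF lim[of x]] by (simp add: LIMSEQ_const_iff)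
  have limG: "(\<lambda>n. G n x) \<longlonglongrightarrow> g x" for x
    unfolding g_def using tendsto_divide[OF tendsto_Re[OF lim[of x]] tendsto_const, of ?k] by simp
  have gnn: "0 \<le> g x" for x
    using LIMSEQ_le_const[OF limG] Gnn by blast
  show eq: "ift ?\<phi> x = of_real (?k * g x)" for x
    using imz[of x] by (simp add: g_def complex_eq_iff)
  have gm: "g \<in> borel_measurable borel"
    unfolding g_def using borel_measurable_ift[OF \<phi>] by measurable
  have m: "integrable lborel (\<lambda>x. ?k * g x)" "of_real (\<integral>x. ?k * g x \<partial>lborel) = ?k * ?\<phi> 0"
    using ift_mass[OF int bd cont, of "\<lambda>x. ?k * g x"] eq gnn gm by auto
  then show gint: "integrable lborel g" by simp
  have "?\<phi> 0 = of_real (measure M UNIV)" using sp by (simp add: charf_def scaleR_conv_of_real)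
  then have "complex_of_real (?k * (\<integral>x. g x \<partial>lborel)) = of_real (?k * measure M UNIV)"
    using m(2) by (simp del: of_real_mult) simp
  then show gmass: "(\<integral>x. g x \<partial>lborel) = measure M UNIV"
    by (subst (asm) of_real_eq_iff) simp
  \<comment> \<open>Fubini and the substitution x = u + \<open>e n\<close> w move the smoothing from
    M to the test function.\<close>
  have smooth: "integrable lborel (\<lambda>x. f x * G n x)"
    "(\<integral>x. f x * G n x \<partial>lborel) = (\<integral>u. (\<integral>w. f (u + e n *\<^sub>R w) * gauss w \<partial>lborel) / ?s ^ DIM('a) \<partial>M)"
    if f[measurable]: "f \<in> borel_measurable borel" and B: "\<And>x. \<bar>f x\<bar> \<le> B" for f :: "'a \<Rightarrow> real" and n and B :: real
  proof -
    let ?c = "(?s / e n) ^ DIM('a) / ?k"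
    let ?F = "\<lambda>u x. f x * (?c * gauss ((u - x) /\<^sub>R e n))"
    have af: "(\<lambda>w. h (u + e n *\<^sub>R w) * (?c * gauss ((u - (u + e n *\<^sub>R w)) /\<^sub>R e n))) = (\<lambda>w. ?c * (h (u + e n *\<^sub>R w) * gauss w))" for u :: 'a and h :: "'a \<Rightarrow> real"
      using e[of n] by (auto simp: gauss_def)
    have i1: "integrable lborel (\<lambda>w. h (u + e n *\<^sub>R w) * gauss w)" if "h \<in> borel_measurable borel" "\<And>x. \<bar>h x\<bar> \<le> B" for u :: 'a and h :: "'a \<Rightarrow> real"
      by (rule Bochner_Integration.integrable_bound[OF integrable_mult_right[OF integrable_gauss, of B]])
         (use that order_trans[OF abs_ge_zero B] in \<open>auto simp: abs_mult abs_of_pos[OF gauss_pos] intro!: mult_right_mono less_imp_le[OF gauss_pos]\<close>)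
    have i2: "integrable lborel (\<lambda>x. h x * (?c * gauss ((u - x) /\<^sub>R e n)))" 
       "(\<integral>x. h x * (?c * gauss ((u - x) /\<^sub>R e n)) \<partial>lborel) = (\<integral>w. h (u + e n *\<^sub>R w) * gauss w \<partial>lborel) / ?s ^ DIM('a)"
      if [measurable]: "h \<in> borel_measurable borel" and "\<And>x. \<bar>h x\<bar> \<le> B" for u and h :: "'a \<Rightarrow> real"
    proof -
      show "integrable lborel (\<lambda>x. h x * (?c * gauss ((u - x) /\<^sub>R e n)))"
        apply (subst lborel_affine_integral(2)[where t = u and c = "e n"])
        using e[of n] i1[of h u] that unfolding af by auto
      have "(\<integral>x. h x * (?c * gauss ((u - x) /\<^sub>R e n)) \<partial>lborel)
          = \<bar>e n\<bar> ^ DIM('a) *\<^sub>R (\<integral>w. h (u + e n *\<^sub>R w) * (?c * gauss ((u - (u + e n *\<^sub>R w)) /\<^sub>R e n)) \<partial>lborel)"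
        using e[of n] by (intro lborel_affine_integral(1)) auto
      also have "\<dots> = e n ^ DIM('a) * (?c * (\<integral>w. h (u + e n *\<^sub>R w) * gauss w \<partial>lborel))"
        unfolding af abs_of_pos[OF e] real_scaleR_def by (subst integral_mult_right_zero) (rule refl)
      also have "\<dots> = (e n ^ DIM('a) * ?c) * (\<integral>w. h (u + e n *\<^sub>R w) * gauss w \<partial>lborel)" by (simp only: mult.assoc)
      also have "e n ^ DIM('a) * ?c = 1 / ?s ^ DIM('a)"
      proof -
        have *: "y * ((x / y) / (x * x)) = 1 / x" if "x \<noteq> 0" "y \<noteq> 0" for x y :: real
          using that by (simp add: field_simps)
        have "?s * ?s = 2 * pi" by simp
        then have "?k = ?s ^ DIM('a) * ?s ^ DIM('a)" by (metis power_mult_distrib)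
        then show ?thesis
          using e[of n] *[of "?s ^ DIM('a)" "e n ^ DIM('a)"] by (simp only: power_divide) simp
      qed
      finally show "(\<integral>x. h x * (?c * gauss ((u - x) /\<^sub>R e n)) \<partial>lborel) = (\<integral>w. h (u + e n *\<^sub>R w) * gauss w \<partial>lborel) / ?s ^ DIM('a)"
        by (simp only: mult_1_left times_divide_eq_left)
    qed
    have fub: "integrable (M \<Otimes>\<^sub>M lborel) (\<lambda>(u, x). ?F u x)"
    proof (rule P.Fubini_integrable)
      have *: "norm (case (u, x) of (u, x) \<Rightarrow> ?F u x) = \<bar>f x\<bar> * (?c * gauss ((u - x) /\<^sub>R e n))" for u x
        using e[of n] by (simp add: abs_mult abs_of_pos[OF gauss_pos])
      have **: "\<bar>\<integral>w. \<bar>f (u + e n *\<^sub>R w)\<bar> * gauss w \<partial>lborel\<bar> \<le> B * (\<integral>w. gauss (w::'a) \<partial>lborel)" for u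
      proof -
        have "\<bar>\<integral>w. \<bar>f (u + e n *\<^sub>R w)\<bar> * gauss w \<partial>lborel\<bar> = (\<integral>w. \<bar>f (u + e n *\<^sub>R w)\<bar> * gauss w \<partial>lborel)"
          by (intro abs_of_nonneg integral_nonneg_AE AE_I2) (auto simp: less_imp_le[OF gauss_pos])
        also have "\<dots> \<le> (\<integral>w. B * gauss (w::'a) \<partial>lborel)"
          using B i1[of "\<lambda>x. \<bar>f x\<bar>"] by (intro integral_mono) (auto simp: integrable_gauss intro!: mult_right_mono less_imp_le[OF gauss_pos])
        finally show ?thesis by simp
      qed
      show "integrable M (\<lambda>u. \<integral>x. norm (case (u, x) of (u, x) \<Rightarrow> ?F u x) \<partial>lborel)"
        unfolding * using ** B
        by (subst i2(2)) (force, force, intro integrable_divide integrable_const_bound[where B = "B * (\<integral>w. gauss (w::'a) \<partial>lborel)"] AE_I2, simp, measurable)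
      show "AE u in M. integrable lborel (\<lambda>x. case (u, x) of (u, x) \<Rightarrow> ?F u x)"
        unfolding prod.case by (intro AE_I2 i2(1) f B)
    qed measurable
    have GF: "f x * G n x = (\<integral>u. ?F u x \<partial>M)" for x by (simp add: G_def)
    show "integrable lborel (\<lambda>x. f x * G n x)"
      unfolding GF by (rule P.integrable_snd[OF fub])
    have "(\<integral>x. f x * G n x \<partial>lborel) = (\<integral>u. (\<integral>x. ?F u x \<partial>lborel) \<partial>M)"
      unfolding GF by (rule P.Fubini_integral[OF fub])
    also have "\<dots> = (\<integral>u. (\<integral>w. f (u + e n *\<^sub>R w) * gauss w \<partial>lborel) / ?s ^ DIM('a) \<partial>M)"
      by (subst i2(2)[OF f B]) simp
    finally show "(\<integral>x. f x * G n x \<partial>lborel) = (\<integral>u. (\<integral>w. f (u + e n *\<^sub>R w) * gauss w \<partial>lborel) / ?s ^ DIM('a) \<partial>M)" .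
  qed
  have Gint: "integrable lborel (G n)" for n using smooth(1)[of "\<lambda>_. 1" 1] by simp
  have Gmass: "(\<integral>x. G n x \<partial>lborel) = measure M UNIV" for n
    using smooth(2)[of "\<lambda>_. 1" 1] sp by (simp add: integral_gauss)
  have limf: "(\<lambda>n. \<integral>x. f x * G n x \<partial>lborel) \<longlonglongrightarrow> (\<integral>x. f x \<partial>M)"
    if f: "continuous_on UNIV f" "\<And>x. \<bar>f x\<bar> \<le> 1" for f :: "'a \<Rightarrow> real"
  proof -
    have fm[measurable]: "f \<in> borel_measurable borel" by (rule borel_measurable_continuous_onI) fact
    have ib: "integrable lborel (\<lambda>w. f (u + c *\<^sub>R w) * gauss w)" for u c
      by (rule Bochner_Integration.integrable_bound[OF integrable_gauss])
         (use f in \<open>auto simp: abs_mult abs_of_pos[OF gauss_pos] intro!: mult_left_le_one_le less_imp_le[OF gauss_pos]\<close>)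
    have inner: "(\<lambda>n. (\<integral>w. f (u + e n *\<^sub>R w) * gauss w \<partial>lborel) / ?s ^ DIM('a)) \<longlonglongrightarrow> f u" for u
    proof -
      have "(\<lambda>n. (\<integral>w. f (u + e n *\<^sub>R w) * gauss w \<partial>lborel)) \<longlonglongrightarrow> (\<integral>w. f u * gauss (w::'a) \<partial>lborel)"
      proof (rule integral_dominated_convergence[where w = gauss])
        show "AE w in lborel. (\<lambda>n. f (u + e n *\<^sub>R w) * gauss w) \<longlonglongrightarrow> f u * gauss w"
        proof (rule AE_I2)
          fix w :: 'a
          have "(\<lambda>n. u + e n *\<^sub>R w) \<longlonglongrightarrow> u + 0" unfolding e_def by (intro tendsto_intros scale_seq)
          moreover have "isCont f u" using f(1) by (simp add: continuous_on_eq_continuous_at)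
          ultimately have "(\<lambda>n. f (u + e n *\<^sub>R w)) \<longlonglongrightarrow> f u" using isCont_tendsto_compose by fastforce
          then show "(\<lambda>n. f (u + e n *\<^sub>R w) * gauss w) \<longlonglongrightarrow> f u * gauss w" by (intro tendsto_intros)
        qed
      qed (use f(2) in \<open>auto simp: integrable_gauss abs_mult abs_of_pos[OF gauss_pos] intro!: mult_left_le_one_le less_imp_le[OF gauss_pos]\<close>)
      then have "(\<lambda>n. (\<integral>w. f (u + e n *\<^sub>R w) * gauss w \<partial>lborel) / ?s ^ DIM('a)) \<longlonglongrightarrow> (\<integral>w. f u * gauss (w::'a) \<partial>lborel) / ?s ^ DIM('a)"
        by (intro tendsto_intros) auto
      then show ?thesis by (simp add: integral_gauss)
    qed
    show ?thesis
      unfolding smooth(2)[OF fm f(2)]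
    proof (rule integral_dominated_convergence[where w = "\<lambda>_. 1"])
      have "\<bar>\<integral>w. f (u + e n *\<^sub>R w) * gauss w \<partial>lborel\<bar> \<le> ?s ^ DIM('a)" for u n
      proof -
        have "norm (\<integral>w. f (u + e n *\<^sub>R w) * gauss w \<partial>lborel) \<le> (\<integral>w. norm (f (u + e n *\<^sub>R w) * gauss w) \<partial>lborel)"
          by (rule integral_norm_bound)
        also have "\<dots> \<le> (\<integral>w. gauss (w::'a) \<partial>lborel)"
          using ib by (intro integral_mono integrable_norm integrable_gauss)
            (use f(2) in \<open>auto simp: abs_mult abs_of_pos[OF gauss_pos] intro!: mult_left_le_one_le less_imp_le[OF gauss_pos]\<close>)
        finally show ?thesis by (simp add: integral_gauss)
      qed
      then show "AE u in M. norm ((\<integral>w. f (u + e n *\<^sub>R w) * gauss w \<partial>lborel) / ?s ^ DIM('a)) \<le> 1" for n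
        by (auto simp: abs_divide divide_le_eq)
    qed (use inner in auto)
  qed
  have "M = density lborel (\<lambda>x. ennreal (g x))"
  proof (rule measure_eqI_bounded_continuous)
    show "finite_measure (density lborel (\<lambda>x. ennreal (g x)))"
      using gint gnn gm by (intro finite_measureI) (simp add: emeasure_density nn_integral_eq_integral)
    show "(\<integral>x. f x \<partial>M) = (\<integral>x. f x \<partial>density lborel (\<lambda>x. ennreal (g x)))"
      if "continuous_on UNIV f" "\<forall>x. \<bar>f x\<bar> \<le> 1" for f :: "'a \<Rightarrow> real"
    proof -
      have fm[measurable]: "f \<in> borel_measurable borel" by (rule borel_measurable_continuous_onI) fact
      have "(\<lambda>n. \<integral>x. f x * G n x \<partial>lborel) \<longlonglongrightarrow> (\<integral>x. f x * g x \<partial>lborel)"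
        by (rule scheffe_bounded[where B = 1]) (use Gint Gnn gint gnn limG Gmass gmass that fm in auto)
      then have "(\<integral>x. f x \<partial>M) = (\<integral>x. f x * g x \<partial>lborel)"
        using limf that LIMSEQ_unique by blast
      also have "\<dots> = (\<integral>x. f x \<partial>density lborel (\<lambda>x. ennreal (g x)))"
        using gm gnn by (subst integral_density) (auto simp: mult.commute)
      finally show ?thesis .
    qed
  qed (use fin sets in auto)
  then show "has_density M g"
    unfolding has_density_def using gm gnn by auto
qed

section \<open>Differentiation and limits under the inverse transform\<close>

text \<open>The real part makes the value real for every \<phi>; for the transforms to which it is
  applied the discarded imaginary part is shown to vanish.\<close>

definition dens :: "('a::euclidean_space \<Rightarrow> complex) \<Rightarrow> 'a \<Rightarrow> real" where
  "dens \<phi> x = Re (ift \<phi> x) / (2 * pi) ^ DIM('a)"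

text \<open>Function and base point vary together, so that continuity in x and continuity in an
  external parameter are both instances.\<close>

lemma ift_tendsto:
  fixes \<phi> :: "'a::euclidean_space \<Rightarrow> complex"
  assumes "\<And>n. f n \<in> borel_measurable borel" "\<phi> \<in> borel_measurable borel"
    and "\<And>y. (\<lambda>n. f n y) \<longlonglongrightarrow> \<phi> y" "X \<longlonglongrightarrow> x"
    and "integrable lborel H" "\<And>n y. norm (f n y) \<le> H y"
  shows "(\<lambda>n. ift (f n) (X n)) \<longlonglongrightarrow> ift \<phi> x"
  unfolding ift_def
proof (rule integral_dominated_convergence[where w = H])
  note [measurable] = assms(1,2)
  show "(\<lambda>y. cis (- (x \<bullet> y)) * \<phi> y) \<in> borel_measurable lborel" by measurable
  show "(\<lambda>y. cis (- (X n \<bullet> y)) * f n y) \<in> borel_measurable lborel" for n by measurable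
  show "AE y in lborel. (\<lambda>n. cis (- (X n \<bullet> y)) * f n y) \<longlonglongrightarrow> cis (- (x \<bullet> y)) * \<phi> y"
    using assms(3,4) by (intro AE_I2 tendsto_intros isCont_tendsto_compose[of _ cis]) auto
qed (use assms in \<open>auto simp: norm_mult\<close>)

lemma dens_tendsto:
  fixes \<phi> :: "'a::euclidean_space \<Rightarrow> complex"
  assumes "\<And>n. f n \<in> borel_measurable borel" "\<phi> \<in> borel_measurable borel"
    and "\<And>y. (\<lambda>n. f n y) \<longlonglongrightarrow> \<phi> y" "X \<longlonglongrightarrow> x"
    and "integrable lborel H" "\<And>n y. norm (f n y) \<le> H y"
  shows "(\<lambda>n. dens (f n) (X n)) \<longlonglongrightarrow> dens \<phi> x"
  unfolding dens_def by (intro tendsto_divide tendsto_const tendsto_Re ift_tendsto[OF assms]) auto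

text \<open>Finiteness of this moment permits q differentiations under the inverse transform; the
  weight 1 + |y| in place of |y| makes the condition monotone in q.\<close>

definition weighted_integrable :: "nat \<Rightarrow> ('a::euclidean_space \<Rightarrow> complex) \<Rightarrow> bool" where
  "weighted_integrable q \<phi> \<longleftrightarrow>
     \<phi> \<in> borel_measurable borel \<and> integrable lborel (\<lambda>y. (1 + norm y) ^ q * norm (\<phi> y))"

text \<open>Multiplication by the symbol of the directional derivative along \<open>v\<close>:
  differentiating cis (- (x . y)) in x produces the factor - i (v . y).\<close>

definition dmul :: "'a::euclidean_space \<Rightarrow> ('a \<Rightarrow> complex) \<Rightarrow> 'a \<Rightarrow> complex" where
  "dmul v \<phi> y = - \<i> * of_real (v \<bullet> y) * \<phi> y"

lemma borel_measurable_dmul [measurable]: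
  "\<phi> \<in> borel_measurable borel \<Longrightarrow> dmul v \<phi> \<in> borel_measurable borel"
  unfolding dmul_def by measurable

lemma norm_dmul: "norm v \<le> 1 \<Longrightarrow> norm (dmul v \<phi> y) \<le> norm y * norm (\<phi> y)"
  using Cauchy_Schwarz_ineq2[of v y] mult_right_mono[of "norm v" 1 "norm y"]
  by (auto simp: dmul_def norm_mult intro!: mult_right_mono)

lemma weighted_integrable_bound:
  assumes "weighted_integrable q f" "g \<in> borel_measurable borel"
    and "\<And>y. (1 + norm y) ^ p * norm (g y) \<le> (1 + norm y) ^ q * norm (f y)"
  shows "weighted_integrable p g"
  unfolding weighted_integrable_def
proof
  show "integrable lborel (\<lambda>y. (1 + norm y) ^ p * norm (g y))"
    by (rule Bochner_Integration.integrable_bound[of _ "\<lambda>y. (1 + norm y) ^ q * norm (f y)"])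
       (use assms in \<open>auto simp: weighted_integrable_def\<close>)
qed fact

lemma weighted_integrable_mono:
  assumes "weighted_integrable q \<phi>" "p \<le> q"
  shows "weighted_integrable p \<phi>"
  using assms(1)
  by (rule weighted_integrable_bound)
     (use assms in \<open>auto simp: weighted_integrable_def intro!: mult_right_mono power_increasing\<close>)

lemma weighted_integrable_dmul:
  assumes "weighted_integrable (Suc q) \<phi>" "norm v \<le> 1"
  shows "weighted_integrable q (dmul v \<phi>)"
  using assms(1)
proof (rule weighted_integrable_bound)
  show "dmul v \<phi> \<in> borel_measurable borel"
    using assms by (auto simp: weighted_integrable_def)
  fix y
  have "norm (dmul v \<phi> y) \<le> (1 + norm y) * norm (\<phi> y)"
    using norm_dmul[OF assms(2), of \<phi> y] by (simp add: algebra_simps add_increasing)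
  then show "(1 + norm y) ^ q * norm (dmul v \<phi> y) \<le> (1 + norm y) ^ Suc q * norm (\<phi> y)"
    using mult_left_mono[of "norm (dmul v \<phi> y)" "(1 + norm y) * norm (\<phi> y)" "(1 + norm y) ^ q"]
    by (simp add: mult_ac)
qed

lemma weighted_integrable_0:
  "weighted_integrable q \<phi> \<Longrightarrow> integrable lborel \<phi>"
  using weighted_integrable_mono[of q \<phi> 0] integrable_norm_cancel[of lborel \<phi>]
  by (auto simp: weighted_integrable_def)

lemma continuous_dens:
  fixes \<phi> :: "'a::euclidean_space \<Rightarrow> complex"
  assumes "integrable lborel \<phi>"
  shows "continuous_on UNIV (dens \<phi>)"
  unfolding continuous_on_sequentially comp_def
  using assms by (auto intro!: dens_tendsto[where H = "\<lambda>y. norm (\<phi> y)"])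

lemma cis_diff_quotient:
  "((\<lambda>h. (cis (a + h * b) - cis a) / of_real h) \<longlongrightarrow> \<i> * of_real b * cis a) (at 0)"
proof (subst tendsto_complex_iff, intro conjI)
  have "((\<lambda>h. cos (a + h * b)) has_real_derivative - sin a * b) (at 0)"
    by (auto intro!: derivative_eq_intros)
  then show "((\<lambda>h. Re ((cis (a + h * b) - cis a) / of_real h)) \<longlongrightarrow> Re (\<i> * of_real b * cis a)) (at 0)"
    by (simp add: DERIV_def Re_divide_of_real mult_ac)
  have "((\<lambda>h. sin (a + h * b)) has_real_derivative cos a * b) (at 0)"
    by (auto intro!: derivative_eq_intros)
  then show "((\<lambda>h. Im ((cis (a + h * b) - cis a) / of_real h)) \<longlongrightarrow> Im (\<i> * of_real b * cis a)) (at 0)"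
    by (simp add: DERIV_def Im_divide_of_real mult_ac)
qed

lemma norm_cis_diff: "norm (cis a - cis b) \<le> \<bar>a - b\<bar>"
proof -
  have "norm (cis a - cis b) = norm (cis b * (cis (a - b) - 1))"
    by (simp add: algebra_simps cis_mult)
  also have "\<dots> = norm (exp (\<i> * of_real (a - b)) - 1)" by (simp add: norm_mult cis_conv_exp)
  also have "\<dots> \<le> \<bar>a - b\<bar>" 
    using iexp_approx1[of "a - b" 0] by simp
  finally show ?thesis .
qed

text \<open>The difference quotients of the exponential are bounded by |v . y| \<le> |y|, so |y|
  |\<phi>(y)| is an integrable majorant for them.\<close>

lemma dens_has_derivative:
  fixes \<phi> :: "'a::euclidean_space \<Rightarrow> complex"
  assumes w: "weighted_integrable (Suc 0) \<phi>" and v: "norm v \<le> 1"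
  shows "((\<lambda>t. dens \<phi> (x + t *\<^sub>R v)) has_real_derivative dens (dmul v \<phi>) x) (at 0)"
proof -
  have [measurable]: "\<phi> \<in> borel_measurable borel" using w by (simp add: weighted_integrable_def)
  have i0: "integrable lborel \<phi>" by (rule weighted_integrable_0[OF w])
  have i1: "integrable lborel (\<lambda>y. norm y * norm (\<phi> y))"
    by (rule Bochner_Integration.integrable_bound[of _ "\<lambda>y. (1 + norm y) ^ Suc 0 * norm (\<phi> y)"])
       (use w in \<open>auto simp: weighted_integrable_def intro!: mult_right_mono\<close>)
  have ic: "integrable lborel (\<lambda>y. cis (- (x \<bullet> y)) * \<phi> y)" for x
    by (rule integrable_cis_mult[OF i0]) measurable
  have "((\<lambda>h. (ift \<phi> (x + h *\<^sub>R v) - ift \<phi> x) / of_real h) \<longlongrightarrow> ift (dmul v \<phi>) x) (at 0)"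
    unfolding tendsto_at_iff_sequentially comp_def
  proof (intro allI impI)
    fix X :: "nat \<Rightarrow> real" assume X: "\<forall>i. X i \<in> UNIV - {0}" "X \<longlonglongrightarrow> 0"
    let ?f = "\<lambda>n y. (cis (- (x \<bullet> y) + X n * (- (v \<bullet> y))) - cis (- (x \<bullet> y))) / of_real (X n) * \<phi> y"
    have eq: "(ift \<phi> (x + X n *\<^sub>R v) - ift \<phi> x) / of_real (X n) = (\<integral>y. ?f n y \<partial>lborel)" for n
    proof -
      have "ift \<phi> (x + X n *\<^sub>R v) - ift \<phi> x = (\<integral>y. cis (- ((x + X n *\<^sub>R v) \<bullet> y)) * \<phi> y - cis (- (x \<bullet> y)) * \<phi> y \<partial>lborel)"
        unfolding ift_def by (rule Bochner_Integration.integral_diff[symmetric]) (rule ic)+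
      then show ?thesis
        by (simp add: inner_add_left left_diff_distrib diff_divide_distrib flip: integral_divide_zero)
    qed
    show "(\<lambda>n. (ift \<phi> (x + X n *\<^sub>R v) - ift \<phi> x) / of_real (X n)) \<longlonglongrightarrow> ift (dmul v \<phi>) x"
      unfolding eq unfolding ift_def
    proof (rule integral_dominated_convergence[where w = "\<lambda>y. norm y * norm (\<phi> y)"])
      show "AE y in lborel. (\<lambda>n. ?f n y) \<longlonglongrightarrow> cis (- (x \<bullet> y)) * dmul v \<phi> y"
      proof (rule AE_I2)
        fix y
        have "(\<lambda>n. (cis (- (x \<bullet> y) + X n * (- (v \<bullet> y))) - cis (- (x \<bullet> y))) / of_real (X n)) \<longlonglongrightarrow> \<i> * of_real (- (v \<bullet> y)) * cis (- (x \<bullet> y))"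
          using cis_diff_quotient[of "- (x \<bullet> y)" "- (v \<bullet> y)"] X
          unfolding tendsto_at_iff_sequentially comp_def by blast
        from tendsto_mult[OF this tendsto_const[of "\<phi> y"]]
        show "(\<lambda>n. ?f n y) \<longlonglongrightarrow> cis (- (x \<bullet> y)) * dmul v \<phi> y" by (simp add: dmul_def mult_ac)
      qed
      show "AE y in lborel. norm (?f n y) \<le> norm y * norm (\<phi> y)" for n
      proof (rule AE_I2)
        fix y
        have "norm (cis (- (x \<bullet> y) + X n * (- (v \<bullet> y))) - cis (- (x \<bullet> y))) \<le> \<bar>X n\<bar> * \<bar>v \<bullet> y\<bar>"
          using norm_cis_diff[of "- (x \<bullet> y) + X n * (- (v \<bullet> y))" "- (x \<bullet> y)"] by (simp add: abs_mult)
        also have "\<dots> \<le> \<bar>X n\<bar> * norm y"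
          using Cauchy_Schwarz_ineq2[of v y] mult_right_mono[OF v, of "norm y"]
          by (intro mult_left_mono) auto
        finally have "norm ((cis (- (x \<bullet> y) + X n * (- (v \<bullet> y))) - cis (- (x \<bullet> y))) / of_real (X n)) \<le> norm y"
          using X(1) by (simp add: norm_divide divide_le_eq mult_ac)
        then show "norm (?f n y) \<le> norm y * norm (\<phi> y)"
          unfolding norm_mult by (rule mult_right_mono) simp
      qed
    qed (use i1 in auto)
  qed
  then have "((\<lambda>h. Re ((ift \<phi> (x + h *\<^sub>R v) - ift \<phi> x) / of_real h) / (2 * pi) ^ DIM('a)) \<longlongrightarrow> dens (dmul v \<phi>) x) (at 0)"
    unfolding dens_def by (intro tendsto_intros) auto
  then show ?thesis
    unfolding DERIV_def by (simp add: dens_def Re_divide_of_real diff_divide_distrib mult_ac)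
qed

lemma partial_dens:
  assumes "weighted_integrable (Suc 0) \<phi>" "norm v \<le> 1"
  shows "partial v (dens \<phi>) = dens (dmul v \<phi>)"
proof
  show "partial v (dens \<phi>) x = dens (dmul v \<phi>) x" for x
    unfolding partial_def by (rule DERIV_imp_deriv[OF dens_has_derivative[OF assms]])
qed

text \<open>One derivative replaces \<phi> by \<open>dmul v \<phi>\<close> at the price of one power
  of the weight, in step with the recursion that defines \<open>C_k\<close>.\<close>

lemma C_k_dens:
  assumes "weighted_integrable q \<phi>"
  shows "C_k q (dens \<phi>)"
  using assms
proof (induction q arbitrary: \<phi>)
  case 0
  then show ?case by (simp add: continuous_dens weighted_integrable_0)
next
  case (Suc q)
  have w: "weighted_integrable (Suc 0) \<phi>" using weighted_integrable_mono[OF Suc.prems] by simp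
  show ?case
    using Suc dens_has_derivative[OF w]
    by (auto simp: partial_dens[OF w] weighted_integrable_dmul intro!: continuous_dens weighted_integrable_0[OF w])
       (metis norm_Basis order_refl real_differentiable_def)
qed

text \<open>\<open>partials\<close> differentiates along the head of the list first, which is the
  order in which \<open>fold\<close> applies \<open>dmul\<close>.\<close>

lemma partials_dens:
  assumes "weighted_integrable (length vs) \<phi>" "set vs \<subseteq> Basis"
  shows "partials vs (dens \<phi>) = dens (fold dmul vs \<phi>)"
  using assms
proof (induction vs arbitrary: \<phi>)
  case (Cons v vs)
  have w: "weighted_integrable (Suc 0) \<phi>" using weighted_integrable_mono[OF Cons.prems(1)] by simp
  then show ?case using Cons by (simp add: partial_dens weighted_integrable_dmul)
qed simp

lemma fold_dmul_tendsto:
  assumes "\<And>y. (\<lambda>n. f n y) \<longlonglongrightarrow> \<phi> y"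
  shows "(\<lambda>n. fold dmul vs (f n) y) \<longlonglongrightarrow> fold dmul vs \<phi> y"
  using assms
proof (induction vs arbitrary: f \<phi>)
  case (Cons v vs)
  have "(\<lambda>n. dmul v (f n) y) \<longlonglongrightarrow> dmul v \<phi> y" for y
    unfolding dmul_def by (intro tendsto_intros Cons.prems)
  then show ?case using Cons.IH[of "\<lambda>n. dmul v (f n)" "dmul v \<phi>"] by simp
qed simp

lemma norm_fold_dmul:
  assumes "set vs \<subseteq> Basis"
  shows "norm (fold dmul vs \<phi> y) \<le> (1 + norm y) ^ length vs * norm (\<phi> y)"
  using assms
proof (induction vs arbitrary: \<phi>)
  case (Cons v vs)
  have "norm (fold dmul (v # vs) \<phi> y) \<le> (1 + norm y) ^ length vs * norm (dmul v \<phi> y)"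
    using Cons by simp
  also have "\<dots> \<le> (1 + norm y) ^ length vs * ((1 + norm y) * norm (\<phi> y))"
    using norm_dmul[of v \<phi> y] Cons.prems
    by (intro mult_left_mono) (auto simp: algebra_simps add_increasing)
  finally show ?case by (simp add: mult_ac)
qed simp

lemma borel_measurable_fold_dmul:
  "\<phi> \<in> borel_measurable borel \<Longrightarrow> fold dmul vs \<phi> \<in> borel_measurable borel"
  by (induction vs arbitrary: \<phi>) auto

text \<open>A common majorant of the weighted functions bounds their limit too, so the derivative
  formula is available on both sides; dominated convergence then acts on the transforms multiplied
  by the symbols.\<close>

lemma partials_dens_tendsto:
  fixes \<phi> :: "'a::euclidean_space \<Rightarrow> complex"
  assumes m: "\<And>n. f n \<in> borel_measurable borel" "\<phi> \<in> borel_measurable borel"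
    and lim: "\<And>y. (\<lambda>n. f n y) \<longlonglongrightarrow> \<phi> y"
    and H: "integrable lborel H" "\<And>n y. (1 + norm y) ^ q * norm (f n y) \<le> H y"
    and vs: "set vs \<subseteq> Basis" "length vs \<le> q"
  shows "(\<lambda>n. partials vs (dens (f n)) x) \<longlonglongrightarrow> partials vs (dens \<phi>) x"
proof -
  have H\<phi>: "(1 + norm y) ^ q * norm (\<phi> y) \<le> H y" for y
    by (rule Lim_bounded[of "\<lambda>n. (1 + norm y) ^ q * norm (f n y)"])
       (use H lim in \<open>auto intro!: tendsto_intros\<close>)
  have wi: "weighted_integrable (length vs) h"
    if "h \<in> borel_measurable borel" "\<And>y. (1 + norm y) ^ q * norm (h y) \<le> H y" for h :: "'a \<Rightarrow> complex"
  proof (rule weighted_integrable_mono[OF _ vs(2)])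
    show "weighted_integrable q h" unfolding weighted_integrable_def
      using that by (auto intro!: Bochner_Integration.integrable_bound[OF H(1)] intro!: AE_I2 order_trans[OF _ abs_ge_self])
  qed
  have "(\<lambda>n. dens (fold dmul vs (f n)) x) \<longlonglongrightarrow> dens (fold dmul vs \<phi>) x"
  proof (rule dens_tendsto[where H = H])
    show "norm (fold dmul vs (f n) y) \<le> H y" for n y
    proof -
      have "norm (fold dmul vs (f n) y) \<le> (1 + norm y) ^ length vs * norm (f n y)"
        by (rule norm_fold_dmul[OF vs(1)])
      also have "\<dots> \<le> (1 + norm y) ^ q * norm (f n y)"
        using vs(2) by (intro mult_right_mono power_increasing) auto
      finally show ?thesis using H(2) order_trans by blast
    qed
  qed (use m lim H in \<open>auto intro: borel_measurable_fold_dmul fold_dmul_tendsto\<close>)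
  then show ?thesis
    using partials_dens[OF wi vs(1)] m H H\<phi> by simp
qed

section \<open>Oscillatory integrals over a circle\<close>

text \<open>Periodicity removes all boundary terms.  Integrating the derivative of
  \<open>exp(i p) p1 / (p1\<^sup>2 + A)\<close> bounds the oscillatory integral by a multiple of the integral of
  \<open>q = A / (p1\<^sup>2 + A)\<close>; integrating the derivative of \<open>p2 arctan(p1 / sqrt A)\<close> bounds the latter
  by a multiple of \<open>1 / sqrt A\<close>, so that the zeros of \<open>p1\<close> need not be located.\<close>

lemma oscillatory_integral_bound:
  fixes p p1 p2 p3 :: "real \<Rightarrow> real"
  assumes d: "\<And>t. (p has_real_derivative p1 t) (at t)" "\<And>t. (p1 has_real_derivative p2 t) (at t)"
      "\<And>t. (p2 has_real_derivative p3 t) (at t)"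
    and c3: "continuous_on UNIV p3"
    and per: "p 1 = p 0" "p1 1 = p1 0" "p2 1 = p2 0"
    and bd: "\<And>t. \<bar>p2 t\<bar> \<le> M * A" "\<And>t. \<bar>p3 t\<bar> \<le> M * A"
    and lower: "\<And>t. A\<^sup>2 \<le> (p1 t)\<^sup>2 + (p2 t)\<^sup>2"
    and A: "A > 0" and M: "M \<ge> 0"
  shows "norm (integral {0..1} (\<lambda>t. cis (p t))) \<le> (M + 1) * (2 * M + 1) / sqrt A"
proof -
  have "continuous_on UNIV p" "continuous_on UNIV p1" "continuous_on UNIV p2"
    by (rule DERIV_continuous_on, rule has_field_derivative_at_within, rule d)+
  then have cont: "continuous_on S p" "continuous_on S p1" "continuous_on S p2" "continuous_on S p3" for S
    using c3 continuous_on_subset subset_UNIV by blast+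
  note [continuous_intros] = cont
  have pos: "0 < (p1 t)\<^sup>2 + A" for t using A by (simp add: add_nonneg_pos)
  then have nz: "(p1 t)\<^sup>2 + A \<noteq> 0" for t using less_irrefl by metis
  have ci: "continuous_on S (\<lambda>t. cis (p t))" for S by (intro continuous_intros)
  have triv: "norm (integral {0..1} (\<lambda>t. cis (p t))) \<le> 1"
    using integral_bound[of 0 1 "\<lambda>t. cis (p t)" 1] ci by simp
  have one: "1 \<le> (M + 1) * (2 * M + 1)"
    using M mult_mono[of 1 "M + 1" 1 "2 * M + 1"] by simp
  show ?thesis
  proof (cases "A \<ge> 1")
    \<comment> \<open>For A < 1 the right-hand side exceeds the trivial bound 1. In the other case A
      \<ge> 1 lets a constant 1 be absorbed into sqrt A.\<close>
    case False
    then have "1 \<le> 1 / sqrt A" using A by simp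
    also have "\<dots> \<le> (M + 1) * (2 * M + 1) / sqrt A" using one A by (intro divide_right_mono) auto
    finally show ?thesis using triv by simp
  next
    case True
    define q where "q t = A / ((p1 t)\<^sup>2 + A)" for t
    define w where "w t = p1 t / ((p1 t)\<^sup>2 + A)" for t
    define w' where "w' t = p2 t * (A - (p1 t)\<^sup>2) / ((p1 t)\<^sup>2 + A)\<^sup>2" for t
    have q0: "q t \<ge> 0" for t using pos[of t] A by (simp add: q_def)
    have cq: "continuous_on S q" for S unfolding q_def by (intro continuous_intros) (use nz in auto)
    have cw': "continuous_on S w'" for S unfolding w'_def by (intro continuous_intros) (use nz in auto)
    have dw: "(w has_real_derivative w' t) (at t)" for t
      unfolding w_def w'_def
      by (rule derivative_eq_intros d refl nz)+ (use nz[of t] in \<open>simp add: power2_eq_square field_simps\<close>)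
    have dcis: "((\<lambda>t. cis (p t)) has_vector_derivative (\<i> * of_real (p1 t) * cis (p t))) (at t within S)" for t S
    proof (rule has_vector_derivative_at_within)
      show "((\<lambda>t. cis (p t)) has_vector_derivative (\<i> * of_real (p1 t) * cis (p t))) (at t)"
        unfolding has_vector_derivative_complex_iff by (auto intro!: derivative_eq_intros d)
    qed
    have "((\<lambda>t. cis (p t) * of_real (w t)) has_vector_derivative
        (\<i> * of_real (p1 t) * cis (p t) * of_real (w t) + cis (p t) * of_real (w' t))) (at t within {0..1})" for t
    proof -
      have "((\<lambda>t. complex_of_real (w t)) has_vector_derivative of_real (w' t)) (at t within {0..1})"
        using DERIV_subset[OF dw[of t], of "{0..1}"]
        by (auto simp: has_real_derivative_iff_has_vector_derivative intro!: has_vector_derivative_of_real)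
      from has_vector_derivative_mult[OF dcis[of t "{0..1}"] this] show ?thesis by (simp add: algebra_simps)
    qed
    then have "((\<lambda>t. \<i> * of_real (p1 t) * cis (p t) * of_real (w t) + cis (p t) * of_real (w' t)) has_integral
        (cis (p 1) * of_real (w 1) - cis (p 0) * of_real (w 0))) {0..1}"
      by (intro fundamental_theorem_of_calculus) auto
    then have hi: "((\<lambda>t. \<i> * of_real (p1 t) * cis (p t) * of_real (w t) + cis (p t) * of_real (w' t)) has_integral 0) {0..1}"
      by (simp add: w_def per)
    have e1: "p1 t * w t = 1 - q t" for t
      using nz[of t] by (simp add: w_def q_def power2_eq_square field_simps)
    \<comment> \<open>As p1 * w = 1 - q, adding i times the exact derivative of
      \<open>cis (p t) * w t\<close>, whose integral is 0 by periodicity, cancels the non-stationary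
      part 1 - q of the integrand.\<close>
    have "((\<lambda>t. cis (p t) + \<i> * (\<i> * of_real (p1 t) * cis (p t) * of_real (w t) + cis (p t) * of_real (w' t))) has_integral
        (integral {0..1} (\<lambda>t. cis (p t)) + \<i> * 0)) {0..1}"
      by (intro has_integral_add has_integral_mult_right hi integrable_integral integrable_continuous_interval ci)
    moreover have "cis (p t) + \<i> * (\<i> * of_real (p1 t) * cis (p t) * of_real (w t) + cis (p t) * of_real (w' t))
        = cis (p t) * (of_real (q t) + \<i> * of_real (w' t))" for t
    proof -
      have "cis (p t) + \<i> * (\<i> * of_real (p1 t) * cis (p t) * of_real (w t) + cis (p t) * of_real (w' t))
        = cis (p t) * (1 - of_real (p1 t * w t) + \<i> * of_real (w' t))" by (simp add: algebra_simps)
      then show ?thesis by (simp add: e1)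
    qed
    ultimately have I: "integral {0..1} (\<lambda>t. cis (p t)) = integral {0..1} (\<lambda>t. cis (p t) * (of_real (q t) + \<i> * of_real (w' t)))"
      by (simp add: integral_unique)
    have w'b: "\<bar>w' t\<bar> \<le> M * q t" for t
    proof -
      have "\<bar>A - (p1 t)\<^sup>2\<bar> \<le> (p1 t)\<^sup>2 + A" using A by (auto simp: abs_le_iff)
      then have "\<bar>w' t\<bar> \<le> (M * A) * ((p1 t)\<^sup>2 + A) / ((p1 t)\<^sup>2 + A)\<^sup>2"
        unfolding w'_def abs_divide abs_mult using bd(1)[of t] by (intro frac_le mult_mono) (use pos[of t] M A in auto)
      also have "\<dots> = M * q t" using nz[of t] by (simp add: q_def power2_eq_square)
      finally show ?thesis .
    qed
    have "norm (integral {0..1} (\<lambda>t. cis (p t))) \<le> integral {0..1} (\<lambda>t. (M + 1) * q t)"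
      unfolding I
    proof (rule integral_norm_bound_integral)
      show "norm (cis (p t) * (of_real (q t) + \<i> * of_real (w' t))) \<le> (M + 1) * q t" for t :: real
      proof -
        have "norm (cis (p t) * (of_real (q t) + \<i> * of_real (w' t))) = norm (of_real (q t) + \<i> * complex_of_real (w' t))"
          by (simp only: norm_mult norm_cis mult_1_left)
        also have "\<dots> \<le> q t + \<bar>w' t\<bar>"
          using norm_triangle_ineq[of "complex_of_real (q t)" "\<i> * of_real (w' t)"] q0[of t] by (simp add: norm_mult)
        finally show ?thesis using w'b[of t] by (simp add: algebra_simps)
      qed
    qed (intro integrable_continuous_interval continuous_intros cq cw')+
    also have "\<dots> = (M + 1) * integral {0..1} q" by simp
    finally have K: "norm (integral {0..1} (\<lambda>t. cis (p t))) \<le> (M + 1) * integral {0..1} q" .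
    let ?a = "\<lambda>t. arctan (p1 t / sqrt A)"
    let ?r = "\<lambda>t. (p2 t)\<^sup>2 / ((p1 t)\<^sup>2 + A)"
    have "((\<lambda>t. p2 t * ?a t) has_real_derivative (p3 t * ?a t + sqrt A * ?r t)) (at t)" for t
    proof -
      have "inverse (1 + (p1 t / sqrt A)\<^sup>2) * (p2 t / sqrt A) = sqrt A * p2 t / ((p1 t)\<^sup>2 + A)"
      proof -
        have "1 + (p1 t / sqrt A)\<^sup>2 = ((p1 t)\<^sup>2 + A) / A" using A by (simp add: power_divide field_simps)
        then have "inverse (1 + (p1 t / sqrt A)\<^sup>2) * (p2 t / sqrt A) = (A / sqrt A) * (p2 t / ((p1 t)\<^sup>2 + A))"
          by simp
        then show ?thesis using A by (simp add: real_div_sqrt)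
      qed
      then have "(?a has_real_derivative sqrt A * p2 t / ((p1 t)\<^sup>2 + A)) (at t)"
        using DERIV_chain2[OF DERIV_arctan DERIV_cdivide[OF d(2)], of "sqrt A" t] by simp
      from DERIV_mult[OF d(3)[of t] this] show ?thesis by (simp add: power2_eq_square algebra_simps)
    qed
    then have "((\<lambda>t. p3 t * ?a t + sqrt A * ?r t) has_integral (p2 1 * ?a 1 - p2 0 * ?a 0)) {0..1}"
      by (intro fundamental_theorem_of_calculus) 
         (auto simp flip: has_real_derivative_iff_has_vector_derivative intro: DERIV_subset)
    then have h2: "((\<lambda>t. p3 t * ?a t + sqrt A * ?r t) has_integral 0) {0..1}" by (simp add: per)
    have ca: "continuous_on {0..1} (\<lambda>t. p3 t * ?a t)" by (intro continuous_intros) (use A in auto)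
    have cr: "continuous_on {0..1} ?r" by (intro continuous_intros) (use nz in auto)
    have "integral {0..1} (\<lambda>t. p3 t * ?a t + sqrt A * ?r t)
        = integral {0..1} (\<lambda>t. p3 t * ?a t) + integral {0..1} (\<lambda>t. sqrt A * ?r t)"
      by (rule Henstock_Kurzweil_Integration.integral_add)
         (rule integrable_continuous_interval, rule ca, rule integrable_continuous_interval, rule continuous_on_mult_left[OF cr])
    also have "integral {0..1} (\<lambda>t. sqrt A * ?r t) = sqrt A * integral {0..1} ?r"
      by (rule Henstock_Kurzweil_Integration.integral_mult_right)
    finally have "integral {0..1} (\<lambda>t. p3 t * ?a t + sqrt A * ?r t)
        = integral {0..1} (\<lambda>t. p3 t * ?a t) + sqrt A * integral {0..1} ?r" .
    then have "sqrt A * integral {0..1} ?r = - integral {0..1} (\<lambda>t. p3 t * ?a t)"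
      using integral_unique[OF h2] by linarith
    also have "\<dots> \<le> norm (integral {0..1} (\<lambda>t. p3 t * ?a t))" by simp
    also have "\<dots> \<le> (M * A * 2) * (1 - 0)"
    proof (rule integral_bound)
      show "norm (p3 t * ?a t) \<le> M * A * 2" for t
        using bd(2)[of t] arctan_bounded[of "p1 t / sqrt A"] pi_less_4 unfolding norm_mult
        by (intro mult_mono) auto
    qed (use ca in auto)
    also have "\<dots> = sqrt A * (2 * M * sqrt A)" using A by simp
    finally have r: "integral {0..1} ?r \<le> 2 * M * sqrt A" using A by simp
    \<comment> \<open>Here the lower bound on p1^2 + p2^2 enters: where p1 is small, p2 is of size
      at least about A, so q is controlled by p2^2 / (p1^2 + A).\<close>
    have "q t \<le> (?r t + 1) / A" for t
    proof -
      have "A\<^sup>2 \<le> (p2 t)\<^sup>2 + ((p1 t)\<^sup>2 + A)" using lower[of t] A by linarith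
      then have "A * A / ((p1 t)\<^sup>2 + A) \<le> ?r t + 1"
        using divide_right_mono[of "A\<^sup>2" "(p2 t)\<^sup>2 + ((p1 t)\<^sup>2 + A)" "(p1 t)\<^sup>2 + A"] pos[of t] nz[of t]
        by (simp add: add_divide_distrib[of "(p2 t)\<^sup>2"] power2_eq_square[of A])
      then show ?thesis using A by (simp add: q_def field_simps)
    qed
    then have "integral {0..1} q \<le> integral {0..1} (\<lambda>t. (?r t + 1) / A)"
      using A by (intro integral_le integrable_continuous_interval cq
          continuous_on_divide[OF continuous_on_add[OF cr continuous_on_const] continuous_on_const]) auto
    also have "\<dots> = (integral {0..1} ?r + 1) / A"
      using cr by (simp add: Henstock_Kurzweil_Integration.integral_add integrable_continuous_interval)
    also have "\<dots> \<le> (2 * M * sqrt A + sqrt A) / A"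
      using r True by (intro divide_right_mono add_mono) auto
    also have "\<dots> = (2 * M + 1) / sqrt A"
      using A by (simp add: field_simps)
    finally have "integral {0..1} q \<le> (2 * M + 1) / sqrt A" .
    then have "(M + 1) * integral {0..1} q \<le> (M + 1) * ((2 * M + 1) / sqrt A)"
      using M by (intro mult_left_mono) auto
    then show ?thesis using K by simp
  qed
qed

section \<open>Power series on circles about the origin\<close>

text \<open>The operator z d/dz, applied r times to the power series with coefficients
  \<open>c\<close>. On a circle about 0 this operator is, up to a constant, differentiation in the
  angle.\<close>

definition ps :: "(nat \<Rightarrow> complex) \<Rightarrow> nat \<Rightarrow> complex \<Rightarrow> complex" where
  "ps c r z = (\<Sum>k. of_nat k ^ r * c k * z ^ k)"

text \<open>Termwise differentiation keeps the disc of convergence, and multiplication by z restores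
  the exponent.\<close>

lemma ps_summable:
  assumes "\<And>z. norm z < R \<Longrightarrow> summable (\<lambda>k. c k * z ^ k)" "norm z < R"
  shows "summable (\<lambda>k. of_nat k ^ r * c k * z ^ k :: complex)"
  using assms(2)
proof (induction r arbitrary: z)
  case (Suc r)
  have "summable (\<lambda>n. diffs (\<lambda>k. of_nat k ^ r * c k) n * z ^ n)"
    by (rule termdiff_converges[OF Suc.prems]) (rule Suc.IH)
  then have "summable (\<lambda>n. z * (diffs (\<lambda>k. of_nat k ^ r * c k) n * z ^ n))" by (rule summable_mult)
  then have "summable (\<lambda>n. of_nat (Suc n) ^ Suc r * c (Suc n) * z ^ Suc n)"
    by (simp add: diffs_def mult_ac)
  then show ?case by (subst (asm) summable_Suc_iff)
qed (use assms in auto)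

text \<open>The derivative is described through \<open>z * D\<close>, since it is this product that
  is again a \<open>ps\<close>, and z may be 0.\<close>

lemma ps_has_derivative:
  assumes "\<And>z. norm z < R \<Longrightarrow> summable (\<lambda>k. c k * z ^ k)" "norm z < R"
  obtains D where "(ps c r has_field_derivative D) (at z)" "z * D = ps c (Suc r) z"
proof
  let ?c = "\<lambda>k. of_nat k ^ r * c k"
  obtain K where K: "norm z < K" "K < R" using assms(2) dense by blast
  have K0: "K > 0" using K(1) norm_ge_zero[of z] by linarith
  show "(ps c r has_field_derivative (\<Sum>n. diffs ?c n * z ^ n)) (at z)"
    unfolding ps_def
    by (rule termdiffs_strong[of _ "of_real K"]) (use K K0 in \<open>auto intro: ps_summable[OF assms(1)]\<close>)
  have s: "summable (\<lambda>n. diffs ?c n * z ^ n)"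
    by (rule termdiff_converges[OF assms(2)]) (rule ps_summable[OF assms(1)])
  have "z * (\<Sum>n. diffs ?c n * z ^ n) = (\<Sum>n. z * (diffs ?c n * z ^ n))" using s by (rule suminf_mult[symmetric])
  also have "\<dots> = (\<Sum>n. of_nat (Suc n) ^ Suc r * c (Suc n) * z ^ Suc n)" by (simp add: diffs_def mult_ac)
  also have "\<dots> = ps c (Suc r) z"
    unfolding ps_def using suminf_split_head[OF ps_summable[OF assms, of "Suc r"]] by simp
  finally show "z * (\<Sum>n. diffs ?c n * z ^ n) = ps c (Suc r) z" .
qed

text \<open>The negative angle is that of p^(-s) when the imaginary part of s grows.\<close>

lemma ps_circle_derivative:
  assumes "\<And>z. norm z < R \<Longrightarrow> summable (\<lambda>k. c k * z ^ k)" "norm z < R"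
  shows "((\<lambda>t. ps c r (z * cis (- (2 * pi * t)))) has_vector_derivative
     (- (2 * pi) * \<i> * ps c (Suc r) (z * cis (- (2 * pi * t))))) (at t)"
proof -
  let ?z = "\<lambda>t. z * cis (- (2 * pi * t))"
  have "norm (?z t) < R" using assms(2) by (simp add: norm_mult)
  then obtain D where D: "(ps c r has_field_derivative D) (at (?z t))" "?z t * D = ps c (Suc r) (?z t)"
    using ps_has_derivative[OF assms(1)] by blast
  have "(?z has_vector_derivative (- (2 * pi) * \<i> * ?z t)) (at t)"
    by (auto intro!: derivative_eq_intros simp: has_vector_derivative_complex_iff algebra_simps)
  from field_vector_diff_chain_at[OF this D(1)]
  show ?thesis unfolding D(2)[symmetric] by (simp add: o_def mult_ac)
qed

text \<open>Let A = |c 1 * z|. The first two derivatives of the real part of the linear term are 2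
  pi times its imaginary part and - (2 pi)^2 times its real part, which never vanish together. The
  cubic weight in \<open>tail\<close> covers derivatives up to the third, and 1/8 is small enough to
  keep the sum of the squares above A^2. The constant is that of
  \<open>oscillatory_integral_bound\<close> for M = 2 (2 pi)^3.\<close>

lemma circle_decay:
  fixes c :: "nat \<Rightarrow> complex"
  assumes conv: "\<And>z. norm z < R \<Longrightarrow> summable (\<lambda>k. c k * z ^ k)" and zR: "norm z < R"
    and c0: "c 0 = 0" and pos: "0 < norm (c 1 * z)"
    and sm: "summable (\<lambda>k. real (k + 2) ^ 3 * norm (c (k + 2) * z ^ (k + 2)))"
    and tail: "(\<Sum>k. real (k + 2) ^ 3 * norm (c (k + 2) * z ^ (k + 2))) \<le> norm (c 1 * z) / 8"
  shows "norm (integral {0..1} (\<lambda>t. cis (Re (ps c 0 (z * cis (- (2 * pi * t)))))))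
           \<le> (2 * (2 * pi) ^ 3 + 1) * (4 * (2 * pi) ^ 3 + 1) / sqrt (norm (c 1 * z))"
proof -
  let ?z = "\<lambda>t. z * cis (- (2 * pi * t))"
  let ?A = "norm (c 1 * z)"
  define p where "p r t = Re ((- (2 * pi) * \<i>) ^ r * ps c r (?z t))" for r t
  have nz: "norm (?z t) = norm z" for t by (simp add: norm_mult)
  have d: "(p r has_real_derivative p (Suc r) t) (at t)" for r t
  proof -
    have "((\<lambda>t. (- (2 * pi) * \<i>) ^ r * ps c r (?z t)) has_vector_derivative
        (- (2 * pi) * \<i>) ^ r * (- (2 * pi) * \<i> * ps c (Suc r) (?z t))) (at t)"
      by (intro has_vector_derivative_mult_right ps_circle_derivative[OF conv zR])
    from bounded_linear.has_vector_derivative[OF bounded_linear_Re this] show ?thesis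
      unfolding p_def[abs_def] has_real_derivative_iff_has_vector_derivative by (simp only: power_Suc mult_ac)
  qed
  define E where "E r t = (\<Sum>k. of_nat (k + 2) ^ r * c (k + 2) * ?z t ^ (k + 2))" for r t
  have split: "ps c r (?z t) = c 1 * ?z t + E r t" for r t
  proof -
    have s: "summable (\<lambda>k. of_nat k ^ r * c k * ?z t ^ k)"
      by (rule ps_summable[OF conv]) (use zR nz in auto)
    show ?thesis
      unfolding ps_def E_def by (subst suminf_split_initial_segment[OF s, of 2]) (simp add: numeral_2_eq_2 c0)
  qed
  have Eb: "norm (E r t) \<le> ?A / 8" if "r \<le> 3" for r t
  proof -
    have le: "norm (of_nat (k + 2) ^ r * c (k + 2) * ?z t ^ (k + 2)) \<le> real (k + 2) ^ 3 * norm (c (k + 2) * z ^ (k + 2))" for k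
    proof -
      have "norm (of_nat (k + 2) ^ r * c (k + 2) * ?z t ^ (k + 2)) = real (k + 2) ^ r * norm (c (k + 2) * z ^ (k + 2))"
      proof -
        have "norm (?z t ^ (k + 2)) = norm (z ^ (k + 2))" unfolding norm_power nz ..
        then show ?thesis
          by (simp only: norm_mult norm_power[of "of_nat (k + 2)" r] norm_of_nat mult.assoc)
      qed
      also have "\<dots> \<le> real (k + 2) ^ 3 * norm (c (k + 2) * z ^ (k + 2))"
        using that by (intro mult_right_mono power_increasing) auto
      finally show ?thesis .
    qed
    have "norm (E r t) \<le> (\<Sum>k. real (k + 2) ^ 3 * norm (c (k + 2) * z ^ (k + 2)))"
      unfolding E_def by (rule norm_suminf_le[OF le sm]) 
    then show ?thesis using tail by simp
  qed
  have tb: "norm (ps c r (?z t)) \<le> 2 * ?A" if "r \<le> 3" for r t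
  proof -
    have "norm (c 1 * ?z t) = ?A" unfolding norm_mult[of "c 1"] nz ..
    then show ?thesis
      using Eb[OF that, of t] norm_triangle_ineq[of "c 1 * ?z t" "E r t"] norm_ge_zero[of "c 1 * z"]
      unfolding split by linarith
  qed
  have pb: "\<bar>p r t\<bar> \<le> (2 * (2 * pi) ^ 3) * ?A" if "r \<le> 3" for r t
  proof -
    have "\<bar>p r t\<bar> \<le> norm ((- (2 * pi) * \<i>) ^ r * ps c r (?z t))"
      unfolding p_def by (rule abs_Re_le_cmod)
    also have "\<dots> = (2 * pi) ^ r * norm (ps c r (?z t))" by (simp add: norm_mult norm_power)
    also have "\<dots> \<le> (2 * pi) ^ 3 * (2 * ?A)"
      using tb[OF that, of t] that pi_gt3 by (intro mult_mono power_increasing) auto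
    finally show ?thesis by (simp only: mult_ac)
  qed
  have low: "?A\<^sup>2 \<le> (p 1 t)\<^sup>2 + (p 2 t)\<^sup>2" for t
  proof -
    let ?w = "c 1 * ?z t"
    \<comment> \<open>With errors at most A/8 this leaves (1/2 - 2/64) A^2 \<ge> A^2 / 4; the
      factors (2 pi)^2 and (2 pi)^4, both at least 4, then restore A^2.\<close>
    have sq: "x\<^sup>2 / 2 - y\<^sup>2 \<le> (x + y)\<^sup>2" for x y :: real
      using sum_squares_ge_zero[of "x / 2 + y"  "x/2 + y"] zero_le_power2[of "x + 2 * y"]
      by (simp add: power2_eq_square algebra_simps)
    have p1: "p 1 t = 2 * pi * (Im ?w + Im (E 1 t))" unfolding p_def split by simp
    have "(- (2 * pi) * \<i>) ^ 2 = - ((2 * pi) ^ 2 :: complex)" by (simp add: power_mult_distrib power2_eq_square)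
    then have p2: "p 2 t = - ((2 * pi)\<^sup>2 * (Re ?w + Re (E 2 t)))" unfolding p_def split
      by (simp add: power2_eq_square)
    have "(Im (E 1 t))\<^sup>2 \<le> (?A / 8)\<^sup>2" "(Re (E 2 t))\<^sup>2 \<le> (?A / 8)\<^sup>2"
    proof -
      have sqm: "x\<^sup>2 \<le> b\<^sup>2" if "\<bar>x\<bar> \<le> b" for x b :: real
        using power_mono[OF that abs_ge_zero, of 2] by simp
      show "(Im (E 1 t))\<^sup>2 \<le> (?A / 8)\<^sup>2" "(Re (E 2 t))\<^sup>2 \<le> (?A / 8)\<^sup>2"
        by (rule sqm, rule order_trans[OF abs_Im_le_cmod], rule Eb, simp)
           (rule sqm, rule order_trans[OF abs_Re_le_cmod], rule Eb, simp)
    qed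
    moreover have "(Re ?w)\<^sup>2 + (Im ?w)\<^sup>2 = ?A\<^sup>2"
      using cmod_power2[of ?w] by (simp add: norm_mult)
    ultimately have 1: "?A\<^sup>2 / 4 \<le> (Im ?w + Im (E 1 t))\<^sup>2 + (Re ?w + Re (E 2 t))\<^sup>2"
    proof -
      assume *: "(Im (E 1 t))\<^sup>2 \<le> (?A / 8)\<^sup>2" "(Re (E 2 t))\<^sup>2 \<le> (?A / 8)\<^sup>2"
        "(Re ?w)\<^sup>2 + (Im ?w)\<^sup>2 = ?A\<^sup>2"
      have "(?A / 8)\<^sup>2 = ?A\<^sup>2 / 64" by (simp add: power_divide)
      then show ?thesis
        using * sq[of "Im ?w" "Im (E 1 t)"] sq[of "Re ?w" "Re (E 2 t)"] zero_le_power2[of ?A] by linarith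
    qed
    have f1: "4 \<le> (2 * pi)\<^sup>2"
      using mult_mono[of 2 "2 * pi" 2 "2 * pi"] pi_gt3 by (simp add: power2_eq_square)
    have f2: "2 * 2 \<le> (2 * pi)\<^sup>2 * (2 * pi)\<^sup>2"
      by (rule mult_mono) (use f1 in linarith)+
    then have four: "4 \<le> (2 * pi)\<^sup>2" "4 \<le> ((2 * pi)\<^sup>2)\<^sup>2"
      using f1 unfolding power2_eq_square[of "(2 * pi)\<^sup>2"] by linarith+
    have "?A\<^sup>2 \<le> 4 * (Im ?w + Im (E 1 t))\<^sup>2 + 4 * (Re ?w + Re (E 2 t))\<^sup>2" using 1 by simp
    also have "\<dots> \<le> (2 * pi)\<^sup>2 * (Im ?w + Im (E 1 t))\<^sup>2 + ((2 * pi)\<^sup>2)\<^sup>2 * (Re ?w + Re (E 2 t))\<^sup>2"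
      using four by (intro add_mono mult_right_mono) auto
    also have "\<dots> = (p 1 t)\<^sup>2 + (p 2 t)\<^sup>2" unfolding p1 p2 by (simp add: power_mult_distrib)
    finally show ?thesis .
  qed
  have "norm (integral {0..1} (\<lambda>t. cis (p 0 t))) \<le> (2 * (2 * pi) ^ 3 + 1) * (2 * (2 * (2 * pi) ^ 3) + 1) / sqrt ?A"
  proof (rule oscillatory_integral_bound[where p = "p 0" and ?p1.0 = "p 1" and ?p2.0 = "p 2" and ?p3.0 = "p 3"])
    show "(p 0 has_real_derivative p 1 t) (at t)" "(p 1 has_real_derivative p 2 t) (at t)" "(p 2 has_real_derivative p 3 t) (at t)" for t
      using d[of 0 t] d[of 1 t] d[of 2 t] by (simp_all add: numeral_2_eq_2 numeral_3_eq_3)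
    show "continuous_on UNIV (p 3)"
      using d[of 3] by (intro DERIV_continuous_on) (auto intro: DERIV_subset)
    have "cis (- (2 * pi * 1)) = cis (- (2 * pi * 0))" by (simp add: complex_eq_iff)
    then show "p 0 1 = p 0 0" "p 1 1 = p 1 0" "p 2 1 = p 2 0" unfolding p_def by metis+
    show "\<bar>p 2 t\<bar> \<le> 2 * (2 * pi) ^ 3 * ?A" "\<bar>p 3 t\<bar> \<le> 2 * (2 * pi) ^ 3 * ?A" for t
      by (rule pb, simp)+
  qed (rule low, rule pos, simp)
  then show ?thesis by (simp add: p_def)
qed

section \<open>Characteristic functions on the torus\<close>

text \<open>Each index in \<open>G\<close> contributes a factor \<open>D\<close>, except for at most two of them that are used
  up by the weights.\<close>

lemma recursion_bound:
  fixes P Q Qc R K Kv Kw Kvv :: "nat \<Rightarrow> complex" and D :: real and G :: "nat set"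
  defines "c \<equiv> \<lambda>n. card (G \<inter> {..<n})"
  assumes init: "P 0 = 1" "Q 0 = 0" "Qc 0 = 0" "R 0 = 0"
    and P: "\<And>n. P (Suc n) = K n * P n"
    and Q: "\<And>n. Q (Suc n) = K n * Q n + Kv n * P n"
    and Qc: "\<And>n. Qc (Suc n) = K n * Qc n + Kw n * P n"
    and R: "\<And>n. R (Suc n) = K n * R n + Kw n * Q n + Kv n * Qc n + Kvv n * P n"
    and K: "\<And>n. norm (K n) \<le> 1" "\<And>n. n \<in> G \<Longrightarrow> norm (K n) \<le> D" and D: "0 \<le> D" "D \<le> 1"
    and bd: "\<And>n. norm (Kv n) \<le> \<beta> n" "\<And>n. norm (Kw n) \<le> \<beta> n" "\<And>n. norm (Kvv n) \<le> \<gamma> n"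
  shows "norm (P n) \<le> D ^ c n \<and> norm (Q n) \<le> sum \<beta> {..<n} * D ^ (c n - 1) \<and>
     norm (Qc n) \<le> sum \<beta> {..<n} * D ^ (c n - 1) \<and>
     norm (R n) \<le> ((sum \<beta> {..<n})\<^sup>2 + sum \<gamma> {..<n}) * D ^ (c n - 2)"
proof (induction n)
  case 0
  then show ?case by (simp add: init c_def)
next
  case (Suc n)
  have \<beta>0: "0 \<le> \<beta> m" and \<gamma>0: "0 \<le> \<gamma> m" for m using bd[of m] norm_ge_zero order_trans by blast+
  define B where "B = sum \<beta> {..<n}"
  define \<Gamma> where "\<Gamma> = sum \<gamma> {..<n}"
  have B0: "B \<ge> 0" and \<Gamma>0: "\<Gamma> \<ge> 0" unfolding B_def \<Gamma>_def using \<beta>0 \<gamma>0 by (auto intro: sum_nonneg)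
  have cS: "c (Suc n) = (if n \<in> G then Suc (c n) else c n)"
    unfolding c_def by (simp add: lessThan_Suc Int_insert_right)
  \<comment> \<open>With truncated subtraction \<open>Suc (c n) - i\<close> is at most
    \<open>Suc (c n - i)\<close>, so D \<le> 1 makes this valid also when i exceeds
    \<open>c n\<close>.\<close>
  have Kp: "norm (K n) * D ^ (c n - i) \<le> D ^ (c (Suc n) - i)" for i
  proof (cases "n \<in> G")
    case True
    have "norm (K n) * D ^ (c n - i) \<le> D * D ^ (c n - i)"
      using K(2)[OF True] D by (intro mult_right_mono) auto
    also have "\<dots> = D ^ (Suc (c n - i))" by simp
    also have "\<dots> \<le> D ^ (c (Suc n) - i)"
      unfolding cS using True D by (intro power_decreasing) auto
    finally show ?thesis .
  next
    case False
    then show ?thesis unfolding cS using K(1)[of n] D by (simp add: mult_left_le_one_le)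
  qed
  \<comment> \<open>An index used by a weight may lie in \<open>G\<close> without yielding a factor
    D; the loss is paid for by raising the number of spent indices from i to j.\<close>
  have sh: "D ^ (c n - i) \<le> D ^ (c (Suc n) - j)" if "i < j" for i j
    using that D unfolding cS by (intro power_decreasing) auto
  have IH: "norm (P n) \<le> D ^ (c n - 0)" "norm (Q n) \<le> B * D ^ (c n - 1)" "norm (Qc n) \<le> B * D ^ (c n - 1)"
     "norm (R n) \<le> (B\<^sup>2 + \<Gamma>) * D ^ (c n - 2)"
    using Suc by (auto simp: B_def \<Gamma>_def)
  have Kx: "norm (K n * x) \<le> b * D ^ (c (Suc n) - i)" if "norm x \<le> b * D ^ (c n - i)" "0 \<le> b" for x :: complex and b i
  proof -
    have "norm (K n * x) \<le> norm (K n) * (b * D ^ (c n - i))"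
      unfolding norm_mult by (intro mult_left_mono that norm_ge_zero)
    also have "\<dots> = b * (norm (K n) * D ^ (c n - i))" by simp
    also have "\<dots> \<le> b * D ^ (c (Suc n) - i)" by (intro mult_left_mono Kp that)
    finally show ?thesis .
  qed
  have kx: "norm (k * x) \<le> (a * b) * D ^ (c (Suc n) - j)"
    if "norm k \<le> a" "norm x \<le> b * D ^ (c n - i)" "i < j" "0 \<le> b" for k x :: complex and a b i j
  proof -
    have a0: "0 \<le> a" using that(1) norm_ge_zero order_trans by blast
    have "norm (k * x) \<le> a * (b * D ^ (c n - i))"
      unfolding norm_mult by (rule mult_mono[OF that(1,2) a0 norm_ge_zero])
    also have "\<dots> = (a * b) * D ^ (c n - i)" by simp
    also have "\<dots> \<le> (a * b) * D ^ (c (Suc n) - j)"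
      by (rule mult_left_mono[OF sh[OF that(3)] mult_nonneg_nonneg[OF a0 that(4)]])
    finally show ?thesis .
  qed
  have p: "norm (P (Suc n)) \<le> D ^ c (Suc n)"
    unfolding P using Kx[of "P n" 1 0] IH by simp
  have q: "norm (Q (Suc n)) \<le> (B + \<beta> n) * D ^ (c (Suc n) - 1)"
    unfolding Q using norm_triangle_ineq[of "K n * Q n" "Kv n * P n"] Kx[OF IH(2) B0] kx[OF bd(1)[of n], of "P n" 1 0 1] IH(1)
    by (simp add: algebra_simps)
  have qc: "norm (Qc (Suc n)) \<le> (B + \<beta> n) * D ^ (c (Suc n) - 1)"
    unfolding Qc using norm_triangle_ineq[of "K n * Qc n" "Kw n * P n"] Kx[OF IH(3) B0] kx[OF bd(2)[of n], of "P n" 1 0 1] IH(1)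
    by (simp add: algebra_simps)
  have r: "norm (R (Suc n)) \<le> ((B + \<beta> n)\<^sup>2 + (\<Gamma> + \<gamma> n)) * D ^ (c (Suc n) - 2)"
  proof -
    let ?E = "D ^ (c (Suc n) - 2)"
    have "norm (R (Suc n)) \<le> norm (K n * R n) + norm (Kw n * Q n) + norm (Kv n * Qc n) + norm (Kvv n * P n)"
      unfolding R by (intro norm_triangle_le add_mono order_refl)
    also have "\<dots> \<le> (B\<^sup>2 + \<Gamma>) * ?E + (\<beta> n * B) * ?E + (\<beta> n * B) * ?E + (\<gamma> n * 1) * ?E"
      using IH B0 \<Gamma>0 by (intro add_mono Kx kx[OF bd(2), of _ _ 1] kx[OF bd(1), of _ _ 1] kx[OF bd(3), of _ _ 0]) auto
    also have "\<dots> = (B\<^sup>2 + \<Gamma> + 2 * \<beta> n * B + \<gamma> n) * ?E" by (simp add: algebra_simps)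
    \<comment> \<open>The two cross terms complete the square.\<close>
    also have "\<dots> \<le> ((B + \<beta> n)\<^sup>2 + (\<Gamma> + \<gamma> n)) * ?E"
      using D by (intro mult_right_mono) (auto simp: power2_eq_square algebra_simps)
    finally show ?thesis .
  qed
  show ?case using p q qc r by (simp add: B_def \<Gamma>_def)
qed

section \<open>Expectations over the unit cube, one coordinate at a time\<close>

lemma borel_measurable_cnj [measurable (raw)]:
  "f \<in> borel_measurable M \<Longrightarrow> (\<lambda>x. cnj (f x)) \<in> borel_measurable M"
  by (rule borel_measurable_continuous_on[of cnj]) (intro continuous_intros)

abbreviation unit_interval :: "real measure" where
  "unit_interval \<equiv> restrict_space lborel {0..<1}"

lemma prob_space_unit_interval: "prob_space unit_interval"
  by (rule prob_spaceI) (simp add: space_restrict_space emeasure_restrict_space)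

interpretation unit_interval: prob_space unit_interval
  by (rule prob_space_unit_interval)

interpretation torus_prod: product_sigma_finite "\<lambda>_::nat. unit_interval"
  by standard

lemma prob_space_unit_cube: "prob_space (unit_cube n)"
  unfolding unit_cube_def by (rule prob_space_PiM) (rule prob_space_unit_interval)

lemma borel_measurable_unit_interval:
  "f \<in> borel_measurable borel \<Longrightarrow> f \<in> borel_measurable unit_interval"
  by (rule measurable_restrict_space1) simp

lemma unit_cube_Suc:
  fixes f :: "(nat \<Rightarrow> real) \<Rightarrow> complex"
  assumes "f \<in> borel_measurable (unit_cube (Suc n))" "\<And>x. norm (f x) \<le> B"
  shows "(\<integral>x. f x \<partial>unit_cube (Suc n)) = (\<integral>x. (\<integral>t. f (x(n := t)) \<partial>unit_interval) \<partial>unit_cube n)"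
proof -
  interpret prob_space "unit_cube (Suc n)" by (rule prob_space_unit_cube)
  have "integrable (unit_cube (Suc n)) f"
    by (rule integrable_const_bound[where B = B]) (use assms in auto)
  then show ?thesis
    unfolding unit_cube_def lessThan_Suc by (intro torus_prod.product_integral_insert) auto
qed

text \<open>What convergence needs of the primes: \<open>u\<close> holds the local logarithms,
  \<open>v\<close> the local summands of the weight, and \<open>W\<close> bounds both for every s
  \<ge> 1. The mean zero conditions turn bounds linear in \<open>W\<close> into quadratic ones, and
  it is the squares that are assumed summable.\<close>

locale torus =
  fixes u :: "nat \<Rightarrow> real \<Rightarrow> real \<Rightarrow> 'v::euclidean_space"
    and v :: "nat \<Rightarrow> real \<Rightarrow> real \<Rightarrow> complex" and W :: "nat \<Rightarrow> real"
  assumes cont_u: "\<And>m. continuous_on ({1..} \<times> UNIV) (\<lambda>(s, t). u m s t)"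
    and cont_v: "\<And>m. continuous_on ({1..} \<times> UNIV) (\<lambda>(s, t). v m s t)"
    and bound_u: "\<And>m s t. 1 \<le> s \<Longrightarrow> norm (u m s t) \<le> W m"
    and bound_v: "\<And>m s t. 1 \<le> s \<Longrightarrow> norm (v m s t) \<le> W m"
    and sumW: "summable (\<lambda>m. (W m)\<^sup>2)"
    and mean_u: "\<And>m s. 1 \<le> s \<Longrightarrow> (\<integral>t. u m s t \<partial>unit_interval) = 0"
    and mean_v: "\<And>m s. 1 \<le> s \<Longrightarrow> (\<integral>t. v m s t \<partial>unit_interval) = 0"
begin

definition X :: "nat \<Rightarrow> real \<Rightarrow> (nat \<Rightarrow> real) \<Rightarrow> 'v" where "X n s x = (\<Sum>m<n. u m s (x m))"
definition V :: "nat \<Rightarrow> real \<Rightarrow> (nat \<Rightarrow> real) \<Rightarrow> complex" where "V n s x = (\<Sum>m<n. v m s (x m))"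

definition K :: "nat \<Rightarrow> real \<Rightarrow> 'v \<Rightarrow> complex" where
  "K m s y = (\<integral>t. cis (y \<bullet> u m s t) \<partial>unit_interval)"
definition Kv :: "nat \<Rightarrow> real \<Rightarrow> 'v \<Rightarrow> complex" where
  "Kv m s y = (\<integral>t. cis (y \<bullet> u m s t) * v m s t \<partial>unit_interval)"
definition Kw :: "nat \<Rightarrow> real \<Rightarrow> 'v \<Rightarrow> complex" where
  "Kw m s y = (\<integral>t. cis (y \<bullet> u m s t) * cnj (v m s t) \<partial>unit_interval)"
definition Kvv :: "nat \<Rightarrow> real \<Rightarrow> 'v \<Rightarrow> complex" where
  "Kvv m s y = (\<integral>t. cis (y \<bullet> u m s t) * (v m s t * cnj (v m s t)) \<partial>unit_interval)"

definition P :: "nat \<Rightarrow> real \<Rightarrow> 'v \<Rightarrow> complex" where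
  "P n s y = (\<integral>x. cis (y \<bullet> X n s x) \<partial>unit_cube n)"
definition Q :: "nat \<Rightarrow> real \<Rightarrow> 'v \<Rightarrow> complex" where
  "Q n s y = (\<integral>x. cis (y \<bullet> X n s x) * V n s x \<partial>unit_cube n)"
definition Qc :: "nat \<Rightarrow> real \<Rightarrow> 'v \<Rightarrow> complex" where
  "Qc n s y = (\<integral>x. cis (y \<bullet> X n s x) * cnj (V n s x) \<partial>unit_cube n)"
definition R :: "nat \<Rightarrow> real \<Rightarrow> 'v \<Rightarrow> complex" where
  "R n s y = (\<integral>x. cis (y \<bullet> X n s x) * (V n s x * cnj (V n s x)) \<partial>unit_cube n)"

lemma W_nonneg: "0 \<le> W m"
  using order_trans[OF norm_ge_zero bound_u[of 1 m 0]] by simp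

lemma continuous_u: "1 \<le> s \<Longrightarrow> continuous_on UNIV (u m s)"
  using continuous_on_compose2[OF cont_u[of m] continuous_on_Pair[OF continuous_on_const[of UNIV s] continuous_on_id]] by auto

lemma continuous_v: "1 \<le> s \<Longrightarrow> continuous_on UNIV (v m s)"
  using continuous_on_compose2[OF cont_v[of m] continuous_on_Pair[OF continuous_on_const[of UNIV s] continuous_on_id]] by auto

lemma measurable_u: "1 \<le> s \<Longrightarrow> u m s \<in> borel_measurable borel"
  by (rule borel_measurable_continuous_onI[OF continuous_u])

lemma measurable_v: "1 \<le> s \<Longrightarrow> v m s \<in> borel_measurable borel"
  by (rule borel_measurable_continuous_onI[OF continuous_v])

lemma measurable_uv:
  assumes "1 \<le> s"
  shows "u m s \<in> borel_measurable unit_interval" "v m s \<in> borel_measurable unit_interval"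
  using assms by (auto intro!: borel_measurable_unit_interval measurable_u measurable_v)

lemma measurable_XV:
  assumes "1 \<le> s"
  shows "X n s \<in> borel_measurable (unit_cube n)" "V n s \<in> borel_measurable (unit_cube n)"
proof -
  have [measurable]: "(\<lambda>x. x m) \<in> unit_cube n \<rightarrow>\<^sub>M unit_interval" if "m < n" for m
    unfolding unit_cube_def using that by (intro measurable_component_singleton) auto
  show "X n s \<in> borel_measurable (unit_cube n)" "V n s \<in> borel_measurable (unit_cube n)"
    unfolding X_def[abs_def] V_def[abs_def] using measurable_uv[OF assms]
    by (auto intro!: borel_measurable_sum measurable_compose[of "\<lambda>x. x _"])
qed

lemma norm_V_le: "1 \<le> s \<Longrightarrow> norm (V n s x) \<le> (\<Sum>m<n. W m)"
  unfolding V_def by (intro sum_norm_le bound_v)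

lemma X_Suc: "X (Suc n) s (x(n := t)) = X n s x + u n s t"
  and V_Suc: "V (Suc n) s (x(n := t)) = V n s x + v n s t"
  unfolding X_def V_def by (auto intro!: sum.cong arg_cong2[where f = "(+)"])

lemma integrable_unit_interval:
  fixes f :: "real \<Rightarrow> 'b::{banach, second_countable_topology}"
  assumes "f \<in> borel_measurable unit_interval" "\<And>t. norm (f t) \<le> B"
  shows "integrable unit_interval f"
  by (rule unit_interval.integrable_const_bound[where B = B]) (use assms in auto)

lemma integrable_unit_cube:
  fixes f :: "(nat \<Rightarrow> real) \<Rightarrow> 'b::{banach, second_countable_topology}"
  assumes "f \<in> borel_measurable (unit_cube n)" "\<And>x. norm (f x) \<le> B"
  shows "integrable (unit_cube n) f"
proof -
  interpret prob_space "unit_cube n" by (rule prob_space_unit_cube)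
  show ?thesis by (rule integrable_const_bound[where B = B]) (use assms in auto)
qed

lemma norm_V2_le: "1 \<le> s \<Longrightarrow> norm (V n s x * cnj (V n s x)) \<le> (\<Sum>m<n. W m) * (\<Sum>m<n. W m)"
  unfolding norm_mult complex_mod_cnj using norm_V_le[of s n x]
  by (intro mult_mono) (auto intro: order_trans[OF norm_ge_zero])

lemma norm_v2_le: "1 \<le> s \<Longrightarrow> norm (v n s x * cnj (v n s x)) \<le> (W n)\<^sup>2"
  unfolding norm_mult complex_mod_cnj power2_eq_square using bound_v[of s n x]
  by (intro mult_mono) (auto intro: order_trans[OF norm_ge_zero])

lemma integrables:
  assumes "1 \<le> s"
  shows "integrable (unit_cube n) (\<lambda>x. cis (y \<bullet> X n s x))"
    "integrable (unit_cube n) (\<lambda>x. cis (y \<bullet> X n s x) * V n s x)"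
    "integrable (unit_cube n) (\<lambda>x. cis (y \<bullet> X n s x) * cnj (V n s x))"
    "integrable (unit_cube n) (\<lambda>x. cis (y \<bullet> X n s x) * (V n s x * cnj (V n s x)))"
    "integrable unit_interval (\<lambda>t. cis (y \<bullet> u m s t))"
    "integrable unit_interval (\<lambda>t. cis (y \<bullet> u m s t) * v m s t)"
    "integrable unit_interval (\<lambda>t. cis (y \<bullet> u m s t) * cnj (v m s t))"
    "integrable unit_interval (\<lambda>t. cis (y \<bullet> u m s t) * (v m s t * cnj (v m s t)))"
    "integrable unit_interval (u m s)" "integrable unit_interval (v m s)"
proof -
  note [measurable] = measurable_XV[OF assms] measurable_uv[OF assms]
  note b = norm_V_le[OF assms] norm_V2_le[OF assms] bound_u[OF assms] bound_v[OF assms] norm_v2_le[OF assms]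
  show "integrable (unit_cube n) (\<lambda>x. cis (y \<bullet> X n s x))"
    by (rule integrable_unit_cube[where B = 1]) auto
  show "integrable (unit_cube n) (\<lambda>x. cis (y \<bullet> X n s x) * V n s x)"
    by (rule integrable_unit_cube[where B = "\<Sum>m<n. W m"]) (use b in \<open>auto simp: norm_mult\<close>)
  show "integrable (unit_cube n) (\<lambda>x. cis (y \<bullet> X n s x) * cnj (V n s x))"
    by (rule integrable_unit_cube[where B = "\<Sum>m<n. W m"]) (use b in \<open>auto simp: norm_mult\<close>)
  show "integrable (unit_cube n) (\<lambda>x. cis (y \<bullet> X n s x) * (V n s x * cnj (V n s x)))"
    by (rule integrable_unit_cube[where B = "(\<Sum>m<n. W m) * (\<Sum>m<n. W m)"]) (use b(2) in \<open>auto simp: norm_mult\<close>)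
  show "integrable unit_interval (\<lambda>t. cis (y \<bullet> u m s t))"
    by (rule integrable_unit_interval[where B = 1]) auto
  show "integrable unit_interval (\<lambda>t. cis (y \<bullet> u m s t) * v m s t)"
    by (rule integrable_unit_interval[where B = "W m"]) (use b in \<open>auto simp: norm_mult\<close>)
  show "integrable unit_interval (\<lambda>t. cis (y \<bullet> u m s t) * cnj (v m s t))"
    by (rule integrable_unit_interval[where B = "W m"]) (use b in \<open>auto simp: norm_mult\<close>)
  show "integrable unit_interval (\<lambda>t. cis (y \<bullet> u m s t) * (v m s t * cnj (v m s t)))"
    by (rule integrable_unit_interval[where B = "(W m)\<^sup>2"]) (use b(5) in \<open>auto simp: norm_mult\<close>)
  show "integrable unit_interval (u m s)" "integrable unit_interval (v m s)"
    using b by (auto intro!: integrable_unit_interval[where B = "W m"])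
qed

lemma cis_X_Suc: "cis (y \<bullet> X (Suc n) s (x(n := t))) = cis (y \<bullet> X n s x) * cis (y \<bullet> u n s t)"
  by (simp add: X_Suc inner_add_right cis_mult)

text \<open>After splitting off the last coordinate, |V + v|^2 expands into four products that
  factor by independence. The mixed ones bring in \<open>Q\<close> and \<open>Qc\<close>, so the
  recursion does not close for \<open>R\<close> alone.\<close>

lemma recursion:
  assumes s: "1 \<le> s"
  shows "P (Suc n) s y = K n s y * P n s y"
    "Q (Suc n) s y = K n s y * Q n s y + Kv n s y * P n s y"
    "Qc (Suc n) s y = K n s y * Qc n s y + Kw n s y * P n s y"
    "R (Suc n) s y = K n s y * R n s y + Kw n s y * Q n s y + Kv n s y * Qc n s y + Kvv n s y * P n s y"
proof -
  note [measurable] = measurable_XV[OF s]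
  note i = integrables[OF s]
  let ?c = "\<lambda>x. cis (y \<bullet> X n s x)" and ?d = "\<lambda>t. cis (y \<bullet> u n s t)"
  have "P (Suc n) s y = (\<integral>x. (\<integral>t. ?c x * ?d t \<partial>unit_interval) \<partial>unit_cube n)"
    unfolding P_def by (subst unit_cube_Suc[where B = 1]) (auto simp: cis_X_Suc)
  also have "\<dots> = (\<integral>x. K n s y * ?c x \<partial>unit_cube n)"
    by (simp add: K_def mult_ac)
  finally show "P (Suc n) s y = K n s y * P n s y" by (simp add: P_def)
  have "Q (Suc n) s y = (\<integral>x. (\<integral>t. (?c x * V n s x) * ?d t + ?c x * (?d t * v n s t) \<partial>unit_interval) \<partial>unit_cube n)"
    unfolding Q_def using norm_V_le[OF s, of "Suc n"] 
    by (subst unit_cube_Suc[where B = "\<Sum>m<Suc n. W m"]) (auto simp: cis_X_Suc V_Suc norm_mult algebra_simps)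
  also have "\<dots> = (\<integral>x. (\<integral>t. (?c x * V n s x) * ?d t \<partial>unit_interval) + (\<integral>t. ?c x * (?d t * v n s t) \<partial>unit_interval) \<partial>unit_cube n)"
    by (intro Bochner_Integration.integral_cong refl Bochner_Integration.integral_add integrable_mult_right i)
  also have "\<dots> = (\<integral>x. K n s y * (?c x * V n s x) + Kv n s y * ?c x \<partial>unit_cube n)"
    unfolding integral_mult_right_zero K_def Kv_def by (simp only: mult_ac)
  also have "\<dots> = (\<integral>x. K n s y * (?c x * V n s x) \<partial>unit_cube n) + (\<integral>x. Kv n s y * ?c x \<partial>unit_cube n)"
    by (intro Bochner_Integration.integral_add integrable_mult_right i)
  finally show "Q (Suc n) s y = K n s y * Q n s y + Kv n s y * P n s y" by (simp add: P_def Q_def)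
  have "Qc (Suc n) s y = (\<integral>x. (\<integral>t. (?c x * cnj (V n s x)) * ?d t + ?c x * (?d t * cnj (v n s t)) \<partial>unit_interval) \<partial>unit_cube n)"
    unfolding Qc_def using norm_V_le[OF s, of "Suc n"] 
    by (subst unit_cube_Suc[where B = "\<Sum>m<Suc n. W m"]) (auto simp: cis_X_Suc V_Suc norm_mult algebra_simps)
  also have "\<dots> = (\<integral>x. (\<integral>t. (?c x * cnj (V n s x)) * ?d t \<partial>unit_interval) + (\<integral>t. ?c x * (?d t * cnj (v n s t)) \<partial>unit_interval) \<partial>unit_cube n)"
    by (intro Bochner_Integration.integral_cong refl Bochner_Integration.integral_add integrable_mult_right i)
  also have "\<dots> = (\<integral>x. K n s y * (?c x * cnj (V n s x)) + Kw n s y * ?c x \<partial>unit_cube n)"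
    unfolding integral_mult_right_zero K_def Kw_def by (simp only: mult_ac)
  also have "\<dots> = (\<integral>x. K n s y * (?c x * cnj (V n s x)) \<partial>unit_cube n) + (\<integral>x. Kw n s y * ?c x \<partial>unit_cube n)"
    by (intro Bochner_Integration.integral_add integrable_mult_right i)
  finally show "Qc (Suc n) s y = K n s y * Qc n s y + Kw n s y * P n s y" by (simp add: P_def Qc_def)
  have "R (Suc n) s y = (\<integral>x. (\<integral>t. (?c x * (V n s x * cnj (V n s x))) * ?d t + (?c x * V n s x) * (?d t * cnj (v n s t))
      + (?c x * cnj (V n s x)) * (?d t * v n s t) + ?c x * (?d t * (v n s t * cnj (v n s t))) \<partial>unit_interval) \<partial>unit_cube n)"
    unfolding R_def using norm_V2_le[OF s, of "Suc n"] 
    by (subst unit_cube_Suc[where B = "(\<Sum>m<Suc n. W m) * (\<Sum>m<Suc n. W m)"]) (auto simp: cis_X_Suc V_Suc norm_mult algebra_simps)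
  also have "\<dots> = (\<integral>x. (\<integral>t. (?c x * (V n s x * cnj (V n s x))) * ?d t \<partial>unit_interval) + (\<integral>t. (?c x * V n s x) * (?d t * cnj (v n s t)) \<partial>unit_interval)
      + (\<integral>t. (?c x * cnj (V n s x)) * (?d t * v n s t) \<partial>unit_interval) + (\<integral>t. ?c x * (?d t * (v n s t * cnj (v n s t))) \<partial>unit_interval) \<partial>unit_cube n)"
    by (subst Bochner_Integration.integral_add, intro Bochner_Integration.integrable_add integrable_mult_right i, intro integrable_mult_right i)+ (rule refl)
  also have "\<dots> = (\<integral>x. K n s y * (?c x * (V n s x * cnj (V n s x))) + Kw n s y * (?c x * V n s x) + Kv n s y * (?c x * cnj (V n s x)) + Kvv n s y * ?c x \<partial>unit_cube n)"
    unfolding integral_mult_right_zero K_def Kv_def Kw_def Kvv_def by (simp only: mult_ac)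
  also have "\<dots> = (\<integral>x. K n s y * (?c x * (V n s x * cnj (V n s x))) \<partial>unit_cube n) + (\<integral>x. Kw n s y * (?c x * V n s x) \<partial>unit_cube n)
      + (\<integral>x. Kv n s y * (?c x * cnj (V n s x)) \<partial>unit_cube n) + (\<integral>x. Kvv n s y * ?c x \<partial>unit_cube n)"
    by (subst Bochner_Integration.integral_add, intro Bochner_Integration.integrable_add integrable_mult_right i, intro integrable_mult_right i)+ (rule refl)
  finally show "R (Suc n) s y = K n s y * R n s y + Kw n s y * Q n s y + Kv n s y * Qc n s y + Kvv n s y * P n s y"
    by (simp add: P_def Q_def Qc_def R_def)
qed

lemma recursion_init: "P 0 s y = 1" "Q 0 s y = 0" "Qc 0 s y = 0" "R 0 s y = 0"
proof -
  interpret prob_space "unit_cube 0" by (rule prob_space_unit_cube)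
  show "P 0 s y = 1" "Q 0 s y = 0" "Qc 0 s y = 0" "R 0 s y = 0"
    using prob_space by (simp_all add: P_def Q_def Qc_def R_def X_def V_def)
qed

lemma norm_K_le: "norm (K m s y) \<le> 1"
proof -
  have "norm (K m s y) \<le> (\<integral>t. norm (cis (y \<bullet> u m s t)) \<partial>unit_interval)"
    unfolding K_def by (rule integral_norm_bound)
  then show ?thesis using unit_interval.prob_space by simp
qed

lemma norm_integral_unit_interval_le:
  fixes f :: "real \<Rightarrow> complex"
  assumes "integrable unit_interval f" "\<And>t. norm (f t) \<le> (B::real)"
  shows "norm (\<integral>t. f t \<partial>unit_interval) \<le> B"
proof -
  have "norm (\<integral>t. f t \<partial>unit_interval) \<le> (\<integral>t. norm (f t) \<partial>unit_interval)"
    by (rule integral_norm_bound)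
  also have "\<dots> \<le> (\<integral>t. B \<partial>unit_interval)" using assms by (intro integral_mono) auto
  finally show ?thesis using unit_interval.prob_space by simp
qed

lemma inner_u_le: "1 \<le> s \<Longrightarrow> \<bar>y \<bullet> u m s t\<bar> \<le> norm y * W m"
  using Cauchy_Schwarz_ineq2[of y "u m s t"] mult_left_mono[OF bound_u[of s m t] norm_ge_zero[of y]]
  by linarith

text \<open>As \<open>v\<close> has mean zero, \<open>cis\<close> may be replaced by
  \<open>cis - 1\<close>, which gains a factor |y| \<open>W m\<close>. The bound for the conjugate
  weight follows by conjugation at -y.\<close>

lemma norm_Kv_le:
  assumes s: "1 \<le> s"
  shows "norm (Kv m s y) \<le> norm y * (W m)\<^sup>2" "norm (Kw m s y) \<le> norm y * (W m)\<^sup>2"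
proof -
  have "cnj (Kv m s (- y)) = (\<integral>t. cnj (cis (- y \<bullet> u m s t) * v m s t) \<partial>unit_interval)"
    unfolding Kv_def by (rule Bochner_Integration.integral_cnj[symmetric])
  then have cnj: "Kw m s y = cnj (Kv m s (- y))" by (simp add: Kw_def cis_cnj)
  have "norm (Kv m s y) \<le> norm y * (W m)\<^sup>2" for y
  proof -
    have "Kv m s y = (\<integral>t. (cis (y \<bullet> u m s t) - 1) * v m s t \<partial>unit_interval)"
      using integrables[OF s] mean_v[OF s] by (simp add: Kv_def left_diff_distrib)
    also have "norm \<dots> \<le> norm y * (W m)\<^sup>2"
    proof (rule norm_integral_unit_interval_le)
      show "integrable unit_interval (\<lambda>t. (cis (y \<bullet> u m s t) - 1) * v m s t)"
        using integrables[OF s] by (simp add: left_diff_distrib)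
      show "norm ((cis (y \<bullet> u m s t) - 1) * v m s t) \<le> norm y * (W m)\<^sup>2" for t
      proof -
        have "norm (cis (y \<bullet> u m s t) - 1) \<le> norm y * W m"
          using norm_cis_diff[of "y \<bullet> u m s t" 0] inner_u_le[OF s, of y m t] by simp
        then show ?thesis unfolding norm_mult power2_eq_square mult.assoc[symmetric]
          using bound_v[OF s, of m t] W_nonneg[of m] by (intro mult_mono) auto
      qed
    qed
    finally show ?thesis .
  qed
  then show "norm (Kv m s y) \<le> norm y * (W m)\<^sup>2" "norm (Kw m s y) \<le> norm y * (W m)\<^sup>2"
    unfolding cnj complex_mod_cnj by (metis norm_minus_cancel)+
qed

lemma norm_Kvv_le: "1 \<le> s \<Longrightarrow> norm (Kvv m s y) \<le> (W m)\<^sup>2"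
  unfolding Kvv_def using norm_v2_le[of s m]
  by (intro norm_integral_unit_interval_le integrables) (auto simp: norm_mult)

text \<open>As \<open>u\<close> has mean zero, the linear Taylor term of the exponential integrates
  to 0 and may be subtracted.\<close>

lemma norm_K_diff_le:
  assumes s: "1 \<le> s"
  shows "norm (K m s y - 1) \<le> (norm y * W m)\<^sup>2"
proof -
  have iu: "integrable unit_interval (\<lambda>t. y \<bullet> u m s t)"
    using integrables(9)[OF s] by (rule integrable_inner_right)
  have "(\<integral>t. y \<bullet> u m s t \<partial>unit_interval) = 0"
    using integral_inner_right[OF integrables(9)[OF s], of y] mean_u[OF s] by simp
  then have m: "(\<integral>t. \<i> * of_real (y \<bullet> u m s t) \<partial>unit_interval) = 0"
    using iu by simp
  have ii: "integrable unit_interval (\<lambda>t. \<i> * complex_of_real (y \<bullet> u m s t))"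
    using iu by (intro integrable_mult_right integrable_of_real)
  have "K m s y - 1 = (\<integral>t. cis (y \<bullet> u m s t) - 1 - \<i> * of_real (y \<bullet> u m s t) \<partial>unit_interval)"
    using integrables(5)[OF s] ii m unit_interval.prob_space
    by (simp add: K_def Bochner_Integration.integral_diff del: integral_mult_right_zero)
  also have "norm \<dots> \<le> (norm y * W m)\<^sup>2"
  proof (rule norm_integral_unit_interval_le)
    show "integrable unit_interval (\<lambda>t. cis (y \<bullet> u m s t) - 1 - \<i> * of_real (y \<bullet> u m s t))"
      using integrables(5)[OF s] ii by (intro Bochner_Integration.integrable_diff) auto
    fix t
    let ?a = "y \<bullet> u m s t"
    have "norm (cis ?a - 1 - \<i> * of_real ?a) \<le> \<bar>?a\<bar>\<^sup>2 / 2"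
      using iexp_approx1[of ?a 1] by (simp add: cis_conv_exp algebra_simps power2_eq_square)
    also have "\<dots> \<le> \<bar>?a\<bar>\<^sup>2" by simp
    also have "\<dots> \<le> (norm y * W m)\<^sup>2" using inner_u_le[OF s] by (intro power_mono) auto
    finally show "norm (cis ?a - 1 - \<i> * of_real ?a) \<le> (norm y * W m)\<^sup>2" .
  qed
  finally show ?thesis .
qed

end

section \<open>An integrable majorant and limits of densities\<close>

lemma integrable_inverse_1_plus_square_real:
  "integrable lborel (\<lambda>x::real. 1 / (1 + x\<^sup>2))"
  using integrable_inverse_1_plus_square by (simp add: set_integrable_def inverse_eq_divide)

text \<open>The product form reduces integrability to one variable. It dominates (1 + |y|)^(-2d),
  which is the origin of the exponent 2d in the decay estimates.\<close>

definition majorant :: "'a::euclidean_space \<Rightarrow> real" where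
  "majorant y = (\<Prod>b\<in>Basis. 1 / (1 + (y \<bullet> b)\<^sup>2))"

lemma integrable_majorant: "integrable lborel (majorant :: 'a::euclidean_space \<Rightarrow> real)"
proof -
  have "integrable lborel (\<lambda>x::'a. \<Prod>b\<in>Basis. complex_of_real (1 / (1 + (x \<bullet> b)\<^sup>2)))"
    by (rule lborel_prod_integral) (rule integrable_of_real[OF integrable_inverse_1_plus_square_real])
  then have "integrable lborel (\<lambda>x::'a. complex_of_real (majorant x))" by (simp add: majorant_def)
  from integrable_Re[OF this] show ?thesis by simp
qed

lemma one_plus_square_pos: "0 < 1 + (x::real)\<^sup>2"
  by (simp add: add_pos_nonneg)

lemma majorant_ge: "1 / (1 + norm (y::'a)) ^ (2 * DIM('a::euclidean_space)) \<le> majorant y"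
proof -
  have "(\<Prod>b\<in>(Basis::'a set). 1 + (y \<bullet> b)\<^sup>2) \<le> (\<Prod>b\<in>(Basis::'a set). (1 + norm y)\<^sup>2)"
  proof (rule prod_mono)
    fix b :: 'a assume "b \<in> Basis"
    then have "\<bar>y \<bullet> b\<bar>\<^sup>2 \<le> (norm y)\<^sup>2" by (intro power_mono Basis_le_norm) auto
    then have "(y \<bullet> b)\<^sup>2 \<le> (norm y)\<^sup>2" by simp
    moreover have "(1 + norm y)\<^sup>2 = 1 + (norm y)\<^sup>2 + 2 * norm y" by (simp add: power2_sum)
    ultimately show "0 \<le> 1 + (y \<bullet> b)\<^sup>2 \<and> 1 + (y \<bullet> b)\<^sup>2 \<le> (1 + norm y)\<^sup>2"
      using norm_ge_zero[of y] one_plus_square_pos[of "y \<bullet> b"] by linarith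
  qed
  also have "\<dots> = (1 + norm y) ^ (2 * DIM('a))" by (simp add: power_mult)
  finally have "1 / (1 + norm y) ^ (2 * DIM('a)) \<le> 1 / (\<Prod>b\<in>(Basis::'a set). 1 + (y \<bullet> b)\<^sup>2)"
    by (intro divide_left_mono mult_pos_pos prod_pos one_plus_square_pos) (auto simp: add_pos_nonneg)
  then show ?thesis by (simp add: majorant_def prod_dividef)
qed

text \<open>Properties that the transform of a finite measure with density shares with the limit
  transform. The latter is handled through this predicate because no measure belongs to it
  beforehand.\<close>

definition nice :: "('a::euclidean_space \<Rightarrow> complex) \<Rightarrow> bool" where
  "nice \<phi> \<longleftrightarrow> \<phi> \<in> borel_measurable borel \<and> (\<forall>x. 0 \<le> dens \<phi> x) \<and> integrable lborel (dens \<phi>)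
     \<and> (\<integral>x. dens \<phi> x \<partial>lborel) = Re (\<phi> 0)"

lemma nice_finite_borel:
  assumes "nice \<phi>"
  shows "finite_borel (density lborel (\<lambda>x. ennreal (dens \<phi> x)))"
    "has_density (density lborel (\<lambda>x. ennreal (dens \<phi> x))) (dens \<phi>)"
proof -
  show "finite_borel (density lborel (\<lambda>x. ennreal (dens \<phi> x)))"
    unfolding finite_borel_def using assms
    by (auto simp: nice_def emeasure_density nn_integral_eq_integral intro!: finite_measureI)
  show "has_density (density lborel (\<lambda>x. ennreal (dens \<phi> x))) (dens \<phi>)"
    using assms by (auto simp: has_density_def nice_def)
qed

text \<open>Dominated convergence under the inverse transform gives pointwise convergence of the
  densities, evaluation at 0 that of the total masses; \<open>scheffe_bounded\<close> combines the
  two.\<close>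

lemma weak_tendsto_dens:
  fixes \<phi> :: "'a::euclidean_space \<Rightarrow> complex" and h :: "'a \<Rightarrow> real"
  assumes f: "\<And>n. nice (f n)" and \<phi>: "nice \<phi>" and lim: "\<And>y. (\<lambda>n. f n y) \<longlonglongrightarrow> \<phi> y"
    and H: "integrable lborel H" "\<And>n y. norm (f n y) \<le> H y"
    and h: "continuous_on UNIV h" "bounded (range h)"
  shows "(\<lambda>n. \<integral>x. h x \<partial>density lborel (\<lambda>x. ennreal (dens (f n) x)))
     \<longlonglongrightarrow> (\<integral>x. h x \<partial>density lborel (\<lambda>x. ennreal (dens \<phi> x)))"
proof -
  obtain B where B: "\<And>x. \<bar>h x\<bar> \<le> B" using h(2) by (auto simp: bounded_iff)
  have hm: "h \<in> borel_measurable borel" using h(1) by (rule borel_measurable_continuous_onI)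
  have eq: "(\<integral>x. h x \<partial>density lborel (\<lambda>x. ennreal (dens p x))) = (\<integral>x. h x * dens p x \<partial>lborel)"
    if "nice p" for p :: "'a \<Rightarrow> complex"
    using that hm by (subst integral_density) (auto simp: nice_def mult.commute)
  have "(\<lambda>n. \<integral>x. h x * dens (f n) x \<partial>lborel) \<longlonglongrightarrow> (\<integral>x. h x * dens \<phi> x \<partial>lborel)"
  proof (rule scheffe_bounded)
    show "(\<lambda>n. \<integral>x. dens (f n) x \<partial>lborel) \<longlonglongrightarrow> (\<integral>x. dens \<phi> x \<partial>lborel)"
      using f \<phi> tendsto_Re[OF lim[of 0]] by (simp add: nice_def)
    show "(\<lambda>n. dens (f n) x) \<longlonglongrightarrow> dens \<phi> x" for x
      by (rule dens_tendsto[where H = H]) (use f \<phi> lim H in \<open>auto simp: nice_def\<close>)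
  qed (use f \<phi> hm B in \<open>auto simp: nice_def\<close>)
  then show ?thesis using f \<phi> by (simp add: eq)
qed

lemma nice_charf:
  fixes M :: "'a::euclidean_space measure"
  assumes "finite_measure M" "sets M = sets borel" "integrable lborel (charf M)"
  shows "nice (charf M)" "has_density M (dens (charf M))" "M = density lborel (\<lambda>x. ennreal (dens (charf M) x))"
    "Im (ift (charf M) x) = 0"
proof -
  note F = fourier_inversion[OF assms, folded dens_def]
  have "charf M 0 = of_real (measure M UNIV)"
    using assms(2) sets_eq_imp_space_eq[of M borel] by (simp add: charf_def scaleR_conv_of_real)
  then show "nice (charf M)"
    using F assms(3) by (auto simp: nice_def has_density_def)
  show "has_density M (dens (charf M))" by (rule F(1))
  then show "M = density lborel (\<lambda>x. ennreal (dens (charf M) x))" by (simp add: has_density_def)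
  show "Im (ift (charf M) x) = 0" unfolding F(4) by (simp only: Im_complex_of_real)
qed

section \<open>Convergence of the weighted transforms\<close>

context torus
begin

definition S :: real where "S = (\<Sum>m. (W m)\<^sup>2)"

lemma S_nonneg: "0 \<le> S"
  unfolding S_def by (rule suminf_nonneg[OF sumW]) simp

lemma sum_W_le: "(\<Sum>m<n. (W m)\<^sup>2) \<le> S"
  unfolding S_def by (rule sum_le_suminf[OF sumW]) auto

text \<open>This is \<open>recursion_bound\<close> with \<beta> m = |y| (W m)^2 and \<gamma> m = (W
  m)^2, whose partial sums are at most |y| S and S whatever n and s are.\<close>

lemma expectation_bounds:
  assumes s: "1 \<le> s" and D: "0 \<le> D" "D \<le> 1" and G: "\<And>m. m \<in> G \<Longrightarrow> norm (K m s y) \<le> D"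
  shows "norm (P n s y) \<le> 1" "norm (Q n s y) \<le> norm y * S" "norm (Qc n s y) \<le> norm y * S"
    "norm (R n s y) \<le> ((norm y * S)\<^sup>2 + S) * D ^ (card (G \<inter> {..<n}) - 2)"
proof -
  let ?\<beta> = "\<lambda>m. norm y * (W m)\<^sup>2"
  have *: "norm (P n s y) \<le> D ^ card (G \<inter> {..<n}) \<and> norm (Q n s y) \<le> sum ?\<beta> {..<n} * D ^ (card (G \<inter> {..<n}) - 1) \<and>
     norm (Qc n s y) \<le> sum ?\<beta> {..<n} * D ^ (card (G \<inter> {..<n}) - 1) \<and>
     norm (R n s y) \<le> ((sum ?\<beta> {..<n})\<^sup>2 + (\<Sum>m<n. (W m)\<^sup>2)) * D ^ (card (G \<inter> {..<n}) - 2)"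
    by (rule recursion_bound[where K = "\<lambda>n. K n s y" and Kv = "\<lambda>n. Kv n s y" and Kw = "\<lambda>n. Kw n s y" and Kvv = "\<lambda>n. Kvv n s y"])
       (use D G in \<open>auto simp: recursion_init recursion[OF s] norm_K_le norm_Kv_le[OF s] norm_Kvv_le[OF s]\<close>)
  have D1: "D ^ k \<le> 1" for k using D by (simp add: power_le_one)
  have b0: "0 \<le> sum ?\<beta> {..<n}" by (intro sum_nonneg) auto
  have b: "sum ?\<beta> {..<n} \<le> norm y * S"
    unfolding sum_distrib_left[symmetric] by (intro mult_left_mono sum_W_le) auto
  have b1: "sum ?\<beta> {..<n} * D ^ k \<le> norm y * S" for k
    using mult_mono[OF b D1[of k]] b0 D S_nonneg by simp
  show "norm (P n s y) \<le> 1" "norm (Q n s y) \<le> norm y * S" "norm (Qc n s y) \<le> norm y * S"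
    using * D1[of "card (G \<inter> {..<n})"] b1[of "card (G \<inter> {..<n}) - 1"] by linarith+
  have "(sum ?\<beta> {..<n})\<^sup>2 + (\<Sum>m<n. (W m)\<^sup>2) \<le> (norm y * S)\<^sup>2 + S"
    using b b0 by (intro add_mono power_mono sum_W_le)
  then show "norm (R n s y) \<le> ((norm y * S)\<^sup>2 + S) * D ^ (card (G \<inter> {..<n}) - 2)"
    using * mult_right_mono[of _ _ "D ^ (card (G \<inter> {..<n}) - 2)"] D order_trans zero_le_power by blast
qed

lemma expectation_bounds_trivial:
  assumes "1 \<le> s"
  shows "norm (P n s y) \<le> 1" "norm (Q n s y) \<le> norm y * S" "norm (Qc n s y) \<le> norm y * S"
    "norm (R n s y) \<le> (norm y * S)\<^sup>2 + S"
  using expectation_bounds[OF assms, of 1 "{}" y n] by auto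

text \<open>The coefficient of (W n)^2 in one step of the recursion for \<open>R\<close>: the first
  summand comes from K - 1, the second from the two mixed weights, the last from
  \<open>Kvv\<close>.\<close>

definition Z :: "real \<Rightarrow> real" where
  "Z r = r\<^sup>2 * ((r * S)\<^sup>2 + S) + 2 * (r * (r * S)) + 1"

lemma Z_mono: "0 \<le> r \<Longrightarrow> r \<le> r' \<Longrightarrow> Z r \<le> Z r'"
  unfolding Z_def using S_nonneg
  by (intro add_mono mult_mono power_mono mult_left_mono order_refl) auto

lemma R_diff:
  assumes s: "1 \<le> s"
  shows "norm (R (Suc n) s y - R n s y) \<le> Z (norm y) * (W n)\<^sup>2"
proof -
  let ?r = "norm y"
  have eq: "R (Suc n) s y - R n s y = (K n s y - 1) * R n s y + Kw n s y * Q n s y + Kv n s y * Qc n s y + Kvv n s y * P n s y"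
    unfolding recursion[OF s] by (simp add: algebra_simps)
  note b = expectation_bounds_trivial[OF s]
  have "norm (R (Suc n) s y - R n s y) \<le> norm ((K n s y - 1) * R n s y) + norm (Kw n s y * Q n s y) + norm (Kv n s y * Qc n s y) + norm (Kvv n s y * P n s y)"
    unfolding eq by (intro norm_triangle_le add_mono order_refl)
  also have "\<dots> \<le> (?r * W n)\<^sup>2 * ((?r * S)\<^sup>2 + S) + (?r * (W n)\<^sup>2) * (?r * S) + (?r * (W n)\<^sup>2) * (?r * S) + (W n)\<^sup>2 * 1"
    unfolding norm_mult using S_nonneg
    by (intro add_mono mult_mono norm_K_diff_le[OF s] norm_Kv_le[OF s] norm_Kvv_le[OF s] b) auto
  also have "\<dots> = Z ?r * (W n)\<^sup>2"
    unfolding Z_def by (simp add: power_mult_distrib algebra_simps)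
  finally show ?thesis .
qed

text \<open>The limit of \<open>R n\<close>, written as a telescoping series so that the M-test
  gives uniform convergence directly.\<close>

definition Rl :: "real \<Rightarrow> 'v \<Rightarrow> complex" where
  "Rl s y = (\<Sum>n. R (Suc n) s y - R n s y)"

lemma R_telescope: "R n s y = (\<Sum>k<n. R (Suc k) s y - R k s y)"
  by (subst sum_lessThan_telescope) (simp add: recursion_init)

lemma R_lim:
  assumes "1 \<le> s"
  shows "(\<lambda>n. R n s y) \<longlonglongrightarrow> Rl s y"
proof -
  have "summable (\<lambda>n. Z (norm y) * (W n)\<^sup>2)" using sumW by (rule summable_mult)
  then have "summable (\<lambda>n. R (Suc n) s y - R n s y)"
    by (rule summable_comparison_test'[where N = 0]) (use R_diff[OF assms] in auto)
  then show ?thesis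
    unfolding Rl_def by (subst R_telescope) (rule summable_LIMSEQ)
qed

lemma R_uniform_s: "uniform_limit {1..} (\<lambda>n s. R n s y) (\<lambda>s. Rl s y) sequentially"
  unfolding Rl_def
  by (subst R_telescope, rule Weierstrass_m_test[where M = "\<lambda>n. Z (norm y) * (W n)\<^sup>2"])
     (auto intro: R_diff summable_mult sumW)

text \<open>The restriction to balls is due to the growth of \<open>Z\<close> with |y|.\<close>

lemma R_uniform_y:
  assumes "1 \<le> s"
  shows "uniform_limit (ball 0 r) (\<lambda>n y. R n s y) (\<lambda>y. Rl s y) sequentially"
  unfolding Rl_def
proof (subst R_telescope, rule Weierstrass_m_test[where M = "\<lambda>n. Z r * (W n)\<^sup>2"])
  fix n y assume "y \<in> ball (0::'v) r"
  then have "Z (norm y) * (W n)\<^sup>2 \<le> Z r * (W n)\<^sup>2" by (intro mult_right_mono Z_mono) auto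
  then show "norm (R (Suc n) s y - R n s y) \<le> Z r * (W n)\<^sup>2"
    using R_diff[OF assms, of n y] by linarith
qed (intro summable_mult sumW)

text \<open>Joint continuity in s and y: for fixed n only finitely many local terms occur, so the
  integrand is dominated by a constant.\<close>

lemma R_tendsto:
  assumes a: "\<And>i. 1 \<le> a i" "a \<longlonglongrightarrow> s" "1 \<le> s" and z: "z \<longlonglongrightarrow> y"
  shows "(\<lambda>i. R n (a i) (z i)) \<longlonglongrightarrow> R n s y"
  unfolding R_def
proof (rule integral_dominated_convergence[where w = "\<lambda>_. (\<Sum>m<n. W m) * (\<Sum>m<n. W m)"])
  interpret prob_space "unit_cube n" by (rule prob_space_unit_cube)
  show "integrable (unit_cube n) (\<lambda>_. (\<Sum>m<n. W m) * (\<Sum>m<n. W m))" by simp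
  note [measurable] = measurable_XV
  show "(\<lambda>x. cis (y \<bullet> X n s x) * (V n s x * cnj (V n s x))) \<in> borel_measurable (unit_cube n)"
    "(\<lambda>x. cis (z i \<bullet> X n (a i) x) * (V n (a i) x * cnj (V n (a i) x))) \<in> borel_measurable (unit_cube n)" for i
    using a by measurable
  show "AE x in unit_cube n. norm (cis (z i \<bullet> X n (a i) x) * (V n (a i) x * cnj (V n (a i) x))) \<le> (\<Sum>m<n. W m) * (\<Sum>m<n. W m)" for i
    using norm_V2_le[OF a(1)[of i]] by (intro AE_I2) (simp add: norm_mult)
  have ul: "(\<lambda>i. u m (a i) t) \<longlonglongrightarrow> u m s t" and vl: "(\<lambda>i. v m (a i) t) \<longlonglongrightarrow> v m s t" for m t
  proof -
    have p: "(\<lambda>i. (a i, t)) \<longlonglongrightarrow> (s, t)" by (intro tendsto_intros a)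
    show "(\<lambda>i. u m (a i) t) \<longlonglongrightarrow> u m s t"
      using continuous_on_tendsto_compose[OF cont_u p] a by simp
    show "(\<lambda>i. v m (a i) t) \<longlonglongrightarrow> v m s t"
      using continuous_on_tendsto_compose[OF cont_v p] a by simp
  qed
  show "AE x in unit_cube n. (\<lambda>i. cis (z i \<bullet> X n (a i) x) * (V n (a i) x * cnj (V n (a i) x))) \<longlonglongrightarrow> cis (y \<bullet> X n s x) * (V n s x * cnj (V n s x))"
    unfolding X_def V_def
    by (intro AE_I2 tendsto_intros isCont_tendsto_compose[of _ cis] ul vl z)
qed

lemma continuous_R_y: "1 \<le> s \<Longrightarrow> continuous_on A (R n s)"
  unfolding continuous_on_sequentially comp_def using R_tendsto[of "\<lambda>_. s" s _ _ n] by auto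

lemma continuous_R_s: "continuous_on {1..} (\<lambda>s. R n s y)"
  unfolding continuous_on_sequentially comp_def using R_tendsto[of _ _ "\<lambda>_. y" y n] by auto

lemma continuous_Rl_s: "continuous_on {1..} (\<lambda>s. Rl s y)"
  by (rule uniform_limit_theorem[OF _ R_uniform_s]) (auto intro: continuous_R_s always_eventually)

lemma continuous_Rl_y: "1 \<le> s \<Longrightarrow> isCont (Rl s) y"
proof -
  assume s: "1 \<le> s"
  have "continuous_on (ball 0 (norm y + 1)) (Rl s)"
    by (rule uniform_limit_theorem[OF _ R_uniform_y[OF s]]) (auto intro: continuous_R_y[OF s] always_eventually)
  then show ?thesis
    by (subst (asm) continuous_on_eq_continuous_at) auto
qed

lemma measurable_R: "1 \<le> s \<Longrightarrow> R n s \<in> borel_measurable borel" "1 \<le> s \<Longrightarrow> Rl s \<in> borel_measurable borel"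
  using continuous_Rl_y[of s]
  by (auto intro!: borel_measurable_continuous_onI continuous_R_y simp: continuous_on_eq_continuous_at)

text \<open>For suitable local summands \<open>v\<close> this is \<open>lam_single\<close> or
  \<open>lam_pair\<close>.\<close>

definition lam :: "nat \<Rightarrow> real \<Rightarrow> 'v measure" where
  "lam n s = distr (density (unit_cube n) (\<lambda>x. ennreal ((norm (V n s x))\<^sup>2))) borel (X n s)"

lemma lam_charf:
  assumes s: "1 \<le> s"
  shows "finite_measure (lam n s)" "sets (lam n s) = sets borel" "charf (lam n s) = R n s"
proof -
  interpret prob_space "unit_cube n" by (rule prob_space_unit_cube)
  note [measurable] = measurable_XV[OF s]
  show "sets (lam n s) = sets borel" by (simp add: lam_def)
  have "norm ((norm (V n s x))\<^sup>2) \<le> (\<Sum>m<n. W m)\<^sup>2" for x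
    using power_mono[OF norm_V_le[OF s, of n x] norm_ge_zero, of 2] by simp
  then have i: "integrable (unit_cube n) (\<lambda>x. (norm (V n s x))\<^sup>2)"
    by (intro integrable_unit_cube[where B = "(\<Sum>m<n. W m)\<^sup>2"]) auto
  have "finite_measure (density (unit_cube n) (\<lambda>x. ennreal ((norm (V n s x))\<^sup>2)))"
    using i by (intro finite_measureI) (simp add: emeasure_density nn_integral_eq_integral)
  then show "finite_measure (lam n s)"
    unfolding lam_def by (intro finite_measure.finite_measure_distr) auto
  show "charf (lam n s) = R n s"
  proof
    fix y
    have "charf (lam n s) y = (\<integral>x. (norm (V n s x))\<^sup>2 *\<^sub>R cis (y \<bullet> X n s x) \<partial>unit_cube n)"
      unfolding charf_def lam_def by (subst integral_distr) (auto simp: integral_density)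
    also have "\<dots> = R n s y"
      unfolding R_def scaleR_conv_of_real complex_norm_square by (simp add: mult_ac)
    finally show "charf (lam n s) y = R n s y" .
  qed
qed

end

section \<open>Polynomial decay and its consequences for the densities\<close>

text \<open>The set of good indices may vary with y and s, but \<open>nq\<close> may not.
  Monotonicity of \<open>C\<close> in s makes the resulting bounds uniform for all s below a given
  s'.\<close>

locale torus_decay = torus u v W
  for u :: "nat \<Rightarrow> real \<Rightarrow> real \<Rightarrow> 'v::euclidean_space" and v W +
  fixes nq :: "nat \<Rightarrow> nat" and C :: "nat \<Rightarrow> real \<Rightarrow> real"
  assumes C_mono: "\<And>q s s'. 1 \<le> s \<Longrightarrow> s \<le> s' \<Longrightarrow> C q s \<le> C q s'"
    and C_nonneg: "\<And>q s. 1 \<le> s \<Longrightarrow> 0 \<le> C q s"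
    and decay: "\<And>q s y. 1 \<le> s \<Longrightarrow> y \<noteq> 0 \<Longrightarrow> \<exists>G\<subseteq>{..<nq q}. 4 * DIM('v) + 2 * q + 6 \<le> card G \<and>
        (\<forall>m\<in>G. norm (K m s y) \<le> C q s / sqrt (norm y))"
begin

definition H :: "nat \<Rightarrow> real \<Rightarrow> 'v \<Rightarrow> real" where
  "H q s y = ((S\<^sup>2 + S) * (1 + (C q s)\<^sup>2) ^ (2 * DIM('v) + q + 2)) * majorant y"

lemma integrable_H: "integrable lborel (H q s)"
  unfolding H_def[abs_def] by (intro integrable_mult_right integrable_majorant)

text \<open>Two of the good indices may be lost to the weight. The remaining 2k, with k = 2d + q +
  2, contribute |y|^(-1/2) each, hence (1 + |y|)^(-k) up to a constant: q powers pay for the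
  derivatives, 2 for the quadratic growth of the prefactor, and 2d for the majorant.\<close>

lemma R_decay:
  assumes s: "1 \<le> s" "s \<le> s'" and n: "nq q \<le> n"
  shows "(1 + norm y) ^ q * norm (R n s y) \<le> H q s' y"
proof -
  let ?d = "DIM('v)" and ?c = "C q s'" and ?r = "norm y"
  let ?k = "2 * ?d + q + 2"
  have c0: "0 \<le> ?c" using C_nonneg[of s'] s by simp
  \<comment> \<open>At y = 0 the quotient would be 0 by the convention for division by 0, whereas
    \<open>K m s 0\<close> is 1; hence the separate value.\<close>
  define D where "D = (if y = 0 then 1 else min 1 (?c / sqrt ?r))"
  have D: "0 \<le> D" "D \<le> 1" using c0 by (auto simp: D_def)
  \<comment> \<open>Replaces the minimum by a single rational function of |y| that is also valid
    near 0.\<close>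
  have D2: "D\<^sup>2 \<le> (1 + ?c\<^sup>2) / (1 + ?r)"
  proof (cases "?r \<le> ?c\<^sup>2")
    case True
    then have "1 \<le> (1 + ?c\<^sup>2) / (1 + ?r)" by (simp add: le_divide_eq add_pos_nonneg)
    moreover have "D\<^sup>2 \<le> 1" using D by (simp add: power_le_one)
    ultimately show ?thesis by linarith
  next
    case False
    then have y: "y \<noteq> 0" using zero_le_power2[of ?c] by auto
    have "D\<^sup>2 \<le> (?c / sqrt ?r)\<^sup>2" using y D by (intro power_mono) (auto simp: D_def)
    also have "\<dots> = ?c\<^sup>2 / ?r" by (simp add: power_divide)
    also have "\<dots> \<le> (1 + ?c\<^sup>2) / (1 + ?r)"
      using y False by (simp add: field_simps add_pos_nonneg)
    finally show ?thesis .
  qed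
  have "\<exists>G. (\<forall>m\<in>G. norm (K m s y) \<le> D) \<and> 2 * ?k + 2 \<le> card (G \<inter> {..<n})"
  proof (cases "y = 0")
    case False
    obtain G where G: "G \<subseteq> {..<nq q}" "4 * ?d + 2 * q + 6 \<le> card G" "\<forall>m\<in>G. norm (K m s y) \<le> C q s / sqrt ?r"
      using decay[OF s(1) False] by blast
    have "norm (K m s y) \<le> D" if "m \<in> G" for m
    proof -
      have "C q s / sqrt ?r \<le> ?c / sqrt ?r" using C_mono[OF s] by (intro divide_right_mono) auto
      then have "norm (K m s y) \<le> ?c / sqrt ?r" using G(3) that by fastforce
      then show ?thesis using False norm_K_le by (simp add: D_def)
    qed
    moreover have "G \<inter> {..<n} = G" using G(1) n by auto
    ultimately show ?thesis using G(2) by (intro exI[of _ G]) auto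
  next
    case True
    \<comment> \<open>The decay hypothesis excludes y = 0. Any nonzero vector supplies a set of the
      required size, and for D = 1 its bounds are trivial.\<close>
    obtain G where "G \<subseteq> {..<nq q}" "4 * ?d + 2 * q + 6 \<le> card G"
      using decay[OF s(1), of "SOME b. b \<in> Basis"] nonzero_Basis some_in_eq[of Basis] nonempty_Basis by metis
    moreover from this have "G \<inter> {..<n} = G" using n by auto
    ultimately show ?thesis using True norm_K_le by (intro exI[of _ G]) (auto simp: D_def)
  qed
  then obtain G where G: "\<And>m. m \<in> G \<Longrightarrow> norm (K m s y) \<le> D" "2 * ?k + 2 \<le> card (G \<inter> {..<n})" by blast
  have "norm (R n s y) \<le> ((?r * S)\<^sup>2 + S) * D ^ (card (G \<inter> {..<n}) - 2)"
    by (rule expectation_bounds[OF s(1) D G(1)])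
  also have "\<dots> \<le> ((S\<^sup>2 + S) * (1 + ?r)\<^sup>2) * D ^ (2 * ?k)"
  proof (rule mult_mono)
    have "(?r * S)\<^sup>2 + S \<le> S\<^sup>2 * (1 + ?r)\<^sup>2 + S * (1 + ?r)\<^sup>2"
    proof (rule add_mono)
      show "(?r * S)\<^sup>2 \<le> S\<^sup>2 * (1 + ?r)\<^sup>2"
        unfolding power_mult_distrib by (subst mult.commute) (intro mult_left_mono power_mono, auto)
      have "1 \<le> (1 + ?r)\<^sup>2" by (simp add: one_le_power)
      then show "S \<le> S * (1 + ?r)\<^sup>2" using S_nonneg mult_left_mono[of 1 "(1 + ?r)\<^sup>2" S] by simp
    qed
    then show "(?r * S)\<^sup>2 + S \<le> (S\<^sup>2 + S) * (1 + ?r)\<^sup>2" by (simp add: distrib_right)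
    show "D ^ (card (G \<inter> {..<n}) - 2) \<le> D ^ (2 * ?k)"
      using D G(2) by (intro power_decreasing) auto
  qed (use S_nonneg D in auto)
  also have "D ^ (2 * ?k) \<le> ((1 + ?c\<^sup>2) / (1 + ?r)) ^ ?k"
    unfolding power_mult using D2 by (intro power_mono) auto
  then have "((S\<^sup>2 + S) * (1 + ?r)\<^sup>2) * D ^ (2 * ?k) \<le> ((S\<^sup>2 + S) * (1 + ?r)\<^sup>2) * ((1 + ?c\<^sup>2) / (1 + ?r)) ^ ?k"
    using S_nonneg by (intro mult_left_mono) auto
  finally have "(1 + ?r) ^ q * norm (R n s y) \<le> (1 + ?r) ^ q * (((S\<^sup>2 + S) * (1 + ?r)\<^sup>2) * ((1 + ?c\<^sup>2) / (1 + ?r)) ^ ?k)"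
    by (intro mult_left_mono) auto
  also have "\<dots> = ((S\<^sup>2 + S) * (1 + ?c\<^sup>2) ^ ?k) * ((1 + ?r) ^ (q + 2) / (1 + ?r) ^ ?k)"
    by (simp only: power_divide power_add[of "1 + ?r" q 2] mult_ac times_divide_eq_left times_divide_eq_right)
  also have "(1 + ?r) ^ ?k = (1 + ?r) ^ (2 * ?d) * (1 + ?r) ^ (q + 2)"
    by (simp only: power_add[symmetric] add.assoc)
  also have "(1 + ?r) ^ (q + 2) / ((1 + ?r) ^ (2 * ?d) * (1 + ?r) ^ (q + 2)) = 1 / (1 + ?r) ^ (2 * ?d)"
    using norm_ge_zero[of y] by (simp add: add_eq_0_iff_both_eq_0)
  also have "((S\<^sup>2 + S) * (1 + ?c\<^sup>2) ^ ?k) * (1 / (1 + ?r) ^ (2 * ?d)) \<le> H q s' y"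
    unfolding H_def using majorant_ge[of y] S_nonneg by (intro mult_left_mono) auto
  finally show ?thesis .
qed

lemma Rl_decay:
  assumes s: "1 \<le> s" "s \<le> s'"
  shows "(1 + norm y) ^ q * norm (Rl s y) \<le> H q s' y"
proof (rule Lim_bounded[of "\<lambda>n. (1 + norm y) ^ q * norm (R n s y)" _ "nq q"])
  show "(\<lambda>n. (1 + norm y) ^ q * norm (R n s y)) \<longlonglongrightarrow> (1 + norm y) ^ q * norm (Rl s y)"
    by (intro tendsto_intros R_lim s)
qed (use R_decay[OF s] in auto)

lemma R_decay0:
  assumes "1 \<le> s" "s \<le> s'"
  shows "nq 0 \<le> n \<Longrightarrow> norm (R n s y) \<le> H 0 s' y" "norm (Rl s y) \<le> H 0 s' y"
  using R_decay[OF assms, of 0 n y] Rl_decay[OF assms, of y 0] by auto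

lemma weighted_integrable_R:
  assumes s: "1 \<le> s"
  shows "nq q \<le> n \<Longrightarrow> weighted_integrable q (R n s)" "weighted_integrable q (Rl s)"
  unfolding weighted_integrable_def using measurable_R[OF s]
  by (auto intro!: Bochner_Integration.integrable_bound[OF integrable_H[of q s]] AE_I2
      order_trans[OF R_decay[OF s order_refl] abs_ge_self] order_trans[OF Rl_decay[OF s order_refl] abs_ge_self]
      simp: abs_mult)

lemma nice_R:
  assumes s: "1 \<le> s" and n: "integrable lborel (R n s)"
  shows "nice (R n s)" "has_density (lam n s) (dens (R n s))"
    "lam n s = density lborel (\<lambda>x. ennreal (dens (R n s) x))" "Im (ift (R n s) x) = 0"
  using nice_charf[OF lam_charf(1,2)[OF s, of n]] n unfolding lam_charf(3)[OF s] by auto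

lemma integrable_R:
  assumes s: "1 \<le> s"
  shows "nq q \<le> n \<Longrightarrow> integrable lborel (R n s)" "integrable lborel (Rl s)"
  using weighted_integrable_0[OF weighted_integrable_R(1)[OF s]] weighted_integrable_0[OF weighted_integrable_R(2)[OF s]] by auto

text \<open>Reality and positivity of the density pass to the limit pointwise; integrability and
  mass come from \<open>ift_mass\<close>, by continuity of \<open>Rl s\<close> at 0. The shift by
  \<open>nq 0\<close> restricts to those n for which decay has been established.\<close>

lemma nice_Rl:
  assumes s: "1 \<le> s"
  shows "nice (Rl s)"
proof -
  have iR: "integrable lborel (R (n + nq 0) s)" for n by (rule integrable_R(1)[OF s, of 0]) simp
  note nR = nice_R[OF s iR]
  have lim: "(\<lambda>n. R (n + nq 0) s y) \<longlonglongrightarrow> Rl s y" for y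
    by (rule LIMSEQ_ignore_initial_segment) (rule R_lim[OF s])
  have 1: "(\<lambda>n. ift (R (n + nq 0) s) x) \<longlonglongrightarrow> ift (Rl s) x" for x
    by (rule ift_tendsto[where H = "H 0 s"]) (use lim measurable_R[OF s] integrable_H R_decay0[OF s order_refl] in auto)
  have im: "Im (ift (Rl s) x) = 0" for x
    using tendsto_Im[OF 1[of x]] by (simp add: nR LIMSEQ_const_iff)
  have "(\<lambda>n. dens (R (n + nq 0) s) x) \<longlonglongrightarrow> dens (Rl s) x" for x
    unfolding dens_def by (intro tendsto_intros 1) auto
  then have nn: "0 \<le> dens (Rl s) x" for x
    by (rule LIMSEQ_le_const) (use nR(1) in \<open>auto simp: nice_def\<close>)
  let ?k = "(2 * pi) ^ DIM('v)"
  have bd: "norm (Rl s y) \<le> (S\<^sup>2 + S) * (1 + (C 0 s)\<^sup>2) ^ (2 * DIM('v) + 0 + 2)" for y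
  proof -
    have "majorant y \<le> 1" unfolding majorant_def by (intro prod_le_1) (auto simp: one_plus_square_pos less_imp_le divide_le_eq)
    then have "H 0 s y \<le> ((S\<^sup>2 + S) * (1 + (C 0 s)\<^sup>2) ^ (2 * DIM('v) + 0 + 2)) * 1"
      unfolding H_def using S_nonneg by (intro mult_left_mono) auto
    then show ?thesis using R_decay0(2)[OF s order_refl, of y] by simp
  qed
  have m: "integrable lborel (\<lambda>x. ?k * dens (Rl s) x)" "of_real (\<integral>x. ?k * dens (Rl s) x \<partial>lborel) = ?k * Rl s 0"
  proof -
    have 1: "ift (Rl s) x = of_real (?k * dens (Rl s) x)" for x by (simp add: dens_def complex_eq_iff im)
    have 2: "0 \<le> ?k * dens (Rl s) x" for x by (intro mult_nonneg_nonneg nn) simp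
    have 3: "(\<lambda>x. ?k * dens (Rl s) x) \<in> borel_measurable borel"
      unfolding dens_def using borel_measurable_ift[OF measurable_R(2)[OF s]] by measurable
    show "integrable lborel (\<lambda>x. ?k * dens (Rl s) x)" "of_real (\<integral>x. ?k * dens (Rl s) x \<partial>lborel) = ?k * Rl s 0"
      using ift_mass[OF integrable_R(2)[OF s] bd continuous_Rl_y[OF s] 1 2 3] by auto
  qed
  have "Re (of_real (\<integral>x. ?k * dens (Rl s) x \<partial>lborel)) = Re (of_real ?k * Rl s 0)" unfolding m(2) by simp
  then have "(\<integral>x. dens (Rl s) x \<partial>lborel) = Re (Rl s 0)" by (simp del: of_real_power)
  then show ?thesis using m(1) nn measurable_R[OF s] by (simp add: nice_def)
qed

definition lam_lim :: "real \<Rightarrow> 'v measure" where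
  "lam_lim s = density lborel (\<lambda>x. ennreal (dens (Rl s) x))"

lemma bounded_seq:
  assumes "a \<longlonglongrightarrow> (s::real)"
  obtains B where "\<And>i. a i \<le> B"
  using convergent_imp_Bseq[OF convergentI[OF assms]] by (auto simp: Bseq_def abs_le_iff)

text \<open>Limits in s are tested along sequences. A convergent sequence of parameters has an upper
  bound B, and \<open>H q B\<close> is then a common integrable majorant of all the weighted
  transforms involved.\<close>

theorem density_and_continuity:
  shows "n \<ge> nq q \<Longrightarrow> 1 \<le> s \<Longrightarrow> has_density (lam n s) (dens (R n s)) \<and> C_k q (dens (R n s))"
    and "1 \<le> s \<Longrightarrow> weakly_converges (\<lambda>n. lam n s) (lam_lim s) sequentially"
    and "1 \<le> s \<Longrightarrow> has_density (lam_lim s) (dens (Rl s)) \<and> C_k q (dens (Rl s))"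
    and "1 \<le> s \<Longrightarrow> weakly_converges lam_lim (lam_lim s) (at s within {1..})"
    and "n \<ge> nq 0 \<Longrightarrow> 1 \<le> s \<Longrightarrow> weakly_converges (lam n) (lam n s) (at s within {1..})"
    and "set vs \<subseteq> Basis \<Longrightarrow> continuous_on {1..} (\<lambda>s. partials vs (dens (Rl s)) x)"
    and "n \<ge> nq q \<Longrightarrow> set vs \<subseteq> Basis \<Longrightarrow> length vs \<le> q \<Longrightarrow> continuous_on {1..} (\<lambda>s. partials vs (dens (R n s)) x)"
proof -
  show "has_density (lam n s) (dens (R n s)) \<and> C_k q (dens (R n s))" if "n \<ge> nq q" "1 \<le> s"
    using nice_R[OF that(2) integrable_R(1)[OF that(2,1)]] C_k_dens[OF weighted_integrable_R(1)[OF that(2,1)]] by simp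
  have fl: "finite_borel (lam_lim s)" "has_density (lam_lim s) (dens (Rl s))" if "1 \<le> s" for s
    unfolding lam_lim_def using nice_finite_borel[OF nice_Rl[OF that]] by auto
  have fb: "finite_borel (lam n s)" if "1 \<le> s" for n s
    using lam_charf[OF that] by (simp add: finite_borel_def)
  have nR: "nice (R n s)" "lam n s = density lborel (\<lambda>x. ennreal (dens (R n s) x))" if "n \<ge> nq 0" "1 \<le> s" for n s
    using nice_R[OF that(2) integrable_R(1)[OF that(2,1)]] by auto
  show "has_density (lam_lim s) (dens (Rl s)) \<and> C_k q (dens (Rl s))" if "1 \<le> s"
    using fl(2) C_k_dens[OF weighted_integrable_R(2)[OF that]] that by simp
  show "weakly_converges (\<lambda>n. lam n s) (lam_lim s) sequentially" if s: "1 \<le> s"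
    unfolding weakly_converges_def
  proof (intro conjI allI impI)
    fix h :: "'v \<Rightarrow> real" assume h: "continuous_on UNIV h \<and> bounded (range h)"
    \<comment> \<open>For small n the measure need not have a density, hence the shift; weak
      convergence does not see it.\<close>
    have "(\<lambda>n. \<integral>x. h x \<partial>density lborel (\<lambda>x. ennreal (dens (R (n + nq 0) s) x)))
       \<longlonglongrightarrow> (\<integral>x. h x \<partial>density lborel (\<lambda>x. ennreal (dens (Rl s) x)))"
    proof (rule weak_tendsto_dens[where H = "H 0 s"])
      show "(\<lambda>n. R (n + nq 0) s y) \<longlonglongrightarrow> Rl s y" for y
        by (rule LIMSEQ_ignore_initial_segment) (rule R_lim[OF s])
    qed (use h nR[OF _ s] nice_Rl[OF s] integrable_H R_decay0[OF s order_refl] in auto)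
    then have "(\<lambda>n. \<integral>x. h x \<partial>lam (n + nq 0) s) \<longlonglongrightarrow> (\<integral>x. h x \<partial>lam_lim s)"
      by (simp add: nR(2)[OF _ s] lam_lim_def)
    then show "(\<lambda>n. \<integral>x. h x \<partial>lam n s) \<longlonglongrightarrow> (\<integral>x. h x \<partial>lam_lim s)" by (rule LIMSEQ_offset)
  qed (use fl fb s in auto)
  have ev: "\<forall>\<^sub>F i in at s within {1..}. Pr i" if "\<And>i. 1 \<le> i \<Longrightarrow> Pr i" for Pr and s :: real
    using that by (auto simp: eventually_at_filter)
  show "weakly_converges lam_lim (lam_lim s) (at s within {1..})" if s: "1 \<le> s"
    unfolding weakly_converges_def
  proof (intro conjI allI impI ev)
    fix h :: "'v \<Rightarrow> real" assume h: "continuous_on UNIV h \<and> bounded (range h)"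
    show "((\<lambda>i. \<integral>x. h x \<partial>lam_lim i) \<longlongrightarrow> (\<integral>x. h x \<partial>lam_lim s)) (at s within {1..})"
      unfolding tendsto_at_iff_sequentially comp_def lam_lim_def
    proof (intro allI impI)
      fix a assume a: "\<forall>i. a i \<in> {1..} - {s}" "a \<longlonglongrightarrow> s"
      obtain B where B: "\<And>i. a i \<le> B" using bounded_seq[OF a(2)] by blast
      show "(\<lambda>n. \<integral>x. h x \<partial>density lborel (\<lambda>x. ennreal (dens (Rl (a n)) x)))
       \<longlonglongrightarrow> (\<integral>x. h x \<partial>density lborel (\<lambda>x. ennreal (dens (Rl s) x)))"
      proof (rule weak_tendsto_dens[where H = "H 0 B"])
        show "(\<lambda>n. Rl (a n) y) \<longlonglongrightarrow> Rl s y" for y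
          using continuous_on_tendsto_compose[OF continuous_Rl_s a(2)] a s by auto
      qed (use h nice_Rl[OF s] nice_Rl a integrable_H R_decay0(2)[OF _ B] in auto)
    qed
  qed (use fl s in auto)
  show "weakly_converges (lam n) (lam n s) (at s within {1..})" if n: "n \<ge> nq 0" and s: "1 \<le> s"
    unfolding weakly_converges_def
  proof (intro conjI allI impI ev)
    fix h :: "'v \<Rightarrow> real" assume h: "continuous_on UNIV h \<and> bounded (range h)"
    show "((\<lambda>i. \<integral>x. h x \<partial>lam n i) \<longlongrightarrow> (\<integral>x. h x \<partial>lam n s)) (at s within {1..})"
      unfolding tendsto_at_iff_sequentially comp_def
    proof (intro allI impI)
      fix a assume a: "\<forall>i. a i \<in> {1..} - {s}" "a \<longlonglongrightarrow> s"
      then have a1: "1 \<le> a i" for i by auto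
      obtain B where B: "\<And>i. a i \<le> B" using bounded_seq[OF a(2)] by blast
      show "(\<lambda>i. \<integral>x. h x \<partial>lam n (a i)) \<longlonglongrightarrow> (\<integral>x. h x \<partial>lam n s)"
        unfolding nR(2)[OF n s] nR(2)[OF n a1]
      proof (rule weak_tendsto_dens[where H = "H 0 B"])
        show "(\<lambda>i. R n (a i) y) \<longlonglongrightarrow> R n s y" for y
          by (rule R_tendsto[OF a1 a(2) s tendsto_const])
      qed (use h nR(1)[OF n s] nR(1)[OF n a1] integrable_H R_decay0(1)[OF a1 B n] in auto)
    qed
  qed (use fb s in auto)
  show "continuous_on {1..} (\<lambda>s. partials vs (dens (Rl s)) x)" if vs: "set vs \<subseteq> Basis"
    unfolding continuous_on_sequentially comp_def
  proof (intro allI ballI impI, elim conjE)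
    fix a and s :: real assume s: "s \<in> {1..}" and a: "\<forall>n. a n \<in> {1..}" "a \<longlonglongrightarrow> s"
    obtain B where B: "\<And>i. a i \<le> B" using bounded_seq[OF a(2)] by blast
    show "(\<lambda>n. partials vs (dens (Rl (a n))) x) \<longlonglongrightarrow> partials vs (dens (Rl s)) x"
    proof (rule partials_dens_tendsto[where H = "H (length vs) B" and q = "length vs"])
      show "(\<lambda>n. Rl (a n) y) \<longlonglongrightarrow> Rl s y" for y
        using continuous_on_tendsto_compose[OF continuous_Rl_s a(2)] a s by auto
    qed (use vs a s measurable_R integrable_H Rl_decay[OF _ B] in auto)
  qed
  show "continuous_on {1..} (\<lambda>s. partials vs (dens (R n s)) x)"
    if n: "n \<ge> nq q" and vs: "set vs \<subseteq> Basis" "length vs \<le> q"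
    unfolding continuous_on_sequentially comp_def
  proof (intro allI ballI impI, elim conjE)
    fix a and s :: real assume s: "s \<in> {1..}" and a: "\<forall>n. a n \<in> {1..}" "a \<longlonglongrightarrow> s"
    then have a1: "1 \<le> a i" for i by auto
    obtain B where B: "\<And>i. a i \<le> B" using bounded_seq[OF a(2)] by blast
    show "(\<lambda>i. partials vs (dens (R n (a i))) x) \<longlonglongrightarrow> partials vs (dens (R n s)) x"
    proof (rule partials_dens_tendsto[where H = "H q B" and q = q])
      show "(\<lambda>i. R n (a i) y) \<longlonglongrightarrow> R n s y" for y
        by (rule R_tendsto[OF a1 a(2) _ tendsto_const]) (use s in auto)
    qed (use vs a1 s measurable_R integrable_H R_decay[OF a1 B n] in auto)
  qed
qed

end

section \<open>Coefficients of Dirichlet series at primes\<close>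

lemma has_sum_diff:
  fixes f g :: "'a \<Rightarrow> complex"
  assumes "(f has_sum a) A" "(g has_sum b) A"
  shows "((\<lambda>x. f x - g x) has_sum (a - b)) A"
  using has_sum_add[OF assms(1) has_sum_uminusI[OF assms(2)]] by simp

lemma norm_nat_powr: "norm (of_nat n powr s :: complex) = real n powr Re s"
  using norm_powr_real_powr[of "of_nat n" s] by simp

text \<open>After multiplication by N^(k + 2), a term of index n > N is at most (N / (N + 1))^k
  times its value for k = 0, so only the coefficient at N survives. The offset 2 keeps the argument
  in the region of absolute convergence.\<close>

lemma dirichlet_leading_coeff:
  assumes f: "abs_conv_dirichlet_series f c" and N: "N \<ge> 1" and z: "\<And>n. 1 \<le> n \<Longrightarrow> n < N \<Longrightarrow> c n = 0"
  shows "(\<lambda>k. f (of_nat (k + 2)) * of_nat N ^ (k + 2)) \<longlonglongrightarrow> c N"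
proof -
  have pw: "of_nat n powr - of_nat (k + 2) * of_nat N ^ (k + 2) = (complex_of_real (real N / real n)) ^ (k + 2)" if "n \<ge> 1" for n k
  proof -
    have "of_nat n powr - of_nat (k + 2) = 1 / (complex_of_nat n) ^ (k + 2)"
      using that by (simp only: powr_minus powr_nat' powr_nat) (simp add: field_simps)
    then show ?thesis by (simp only: power_divide of_real_divide of_real_of_nat_eq times_divide_eq_left mult_1_left)
  qed
  have hs: "((\<lambda>n. c n * (complex_of_real (real N / real n)) ^ (k + 2)) has_sum (f (of_nat (k + 2)) * of_nat N ^ (k + 2))) {1..}" for k
  proof -
    have "((\<lambda>n. c n * of_nat n powr (- of_nat (k + 2))) has_sum f (of_nat (k + 2))) {1..}"
    proof -
      have "Re (of_nat (k + 2)) > 1" by simp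
      then show ?thesis using f unfolding abs_conv_dirichlet_series_def by blast
    qed
    note 1 = has_sum_cmult_left[OF this, of "of_nat N ^ (k + 2)"]
    have e: "c n * (complex_of_real (real N / real n)) ^ (k + 2) = c n * of_nat n powr (- of_nat (k + 2)) * of_nat N ^ (k + 2)"
      if "n \<in> {1..}" for n
      using that by (simp only: mult.assoc pw atLeast_iff)
    show ?thesis by (rule has_sum_cong[OF e, THEN iffD2, OF _ 1])
  qed
  define M where "M = (\<Sum>\<^sub>\<infinity>n\<in>{1..}. norm (c n * (complex_of_real (real N / real n)) ^ 2))"
  have sM: "(\<lambda>n. norm (c n * (complex_of_real (real N / real n)) ^ 2)) summable_on {1..}"
  proof -
    have "(\<lambda>n. norm (c n * of_nat n powr (- of_nat (0 + 2)))) summable_on {1..}"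
      using f unfolding abs_conv_dirichlet_series_def by simp
    then have "(\<lambda>n. norm (c n * of_nat n powr (- of_nat (0 + 2))) * norm (complex_of_nat N ^ (0 + 2))) summable_on {1..}"
      by (rule summable_on_cmult_left)
    note 1 = this
    have e: "norm (c n * (complex_of_real (real N / real n)) ^ 2) = norm (c n * of_nat n powr (- of_nat (0 + 2))) * norm (complex_of_nat N ^ (0 + 2))"
      if "n \<in> {1..}" for n
      using that pw[of n 0] by (simp only: norm_mult[symmetric] mult.assoc atLeast_iff add_0)
    show ?thesis by (rule summable_on_cong[OF e, THEN iffD2, OF _ 1])
  qed
  let ?q = "real N / real (Suc N)"
  have q: "0 \<le> ?q" "?q < 1" by auto
  have bound: "norm (f (of_nat (k + 2)) * of_nat N ^ (k + 2) - c N) \<le> ?q ^ k * M" for k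
  proof -
    let ?g = "\<lambda>n. c n * (complex_of_real (real N / real n)) ^ (k + 2) - (if n = N then c N else 0)"
    have "((\<lambda>n. if n = N then c N else 0) has_sum c N) {1..}"
      by (rule has_sum_finite_neutralI[of "{N}"]) (use N in auto)
    from has_sum_diff[OF hs[of k] this] have g: "(?g has_sum (f (of_nat (k + 2)) * of_nat N ^ (k + 2) - c N)) {1..}" .
    have le: "norm (?g n) \<le> ?q ^ k * norm (c n * (complex_of_real (real N / real n)) ^ 2)" if n: "n \<in> {1..}" for n
    proof (cases "n \<le> N")
      case True
      then show ?thesis using z[of n] n N by (cases "n = N") auto
    next
      case False
      have "(real N / real n) ^ k \<le> ?q ^ k"
        using False N by (intro power_mono divide_left_mono) auto
      then have "(real N / real n) ^ k * (norm (c n) * (real N / real n) ^ 2) \<le> ?q ^ k * (norm (c n) * (real N / real n) ^ 2)"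
        by (intro mult_right_mono) auto
      moreover have "norm (?g n) = (real N / real n) ^ k * (norm (c n) * (real N / real n) ^ 2)"
        using False by (simp add: norm_mult norm_power norm_divide power_add power_divide power2_eq_square mult_ac)
      ultimately show ?thesis
        by (simp add: norm_mult norm_power norm_divide power_divide power2_eq_square)
    qed
    have s: "(\<lambda>n. ?q ^ k * norm (c n * (complex_of_real (real N / real n)) ^ 2)) summable_on {1..}"
      by (rule summable_on_cmult_right[OF sM])
    have "norm (f (of_nat (k + 2)) * of_nat N ^ (k + 2) - c N) \<le> (\<Sum>\<^sub>\<infinity>n\<in>{1..}. ?q ^ k * norm (c n * (complex_of_real (real N / real n)) ^ 2))"
      using norm_infsum_le[OF g has_sum_infsum[OF s]] le by blast
    also have "\<dots> = ?q ^ k * M" unfolding M_def by (rule infsum_cmult_right) (use sM in auto)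
    finally show ?thesis .
  qed
  have "(\<lambda>k. ?q ^ k * M) \<longlonglongrightarrow> 0"
    using tendsto_mult[OF LIMSEQ_realpow_zero[OF q] tendsto_const[of M]] by simp
  then have "(\<lambda>k. f (of_nat (k + 2)) * of_nat N ^ (k + 2) - c N) \<longlonglongrightarrow> 0"
    by (rule Lim_null_comparison[rotated]) (use bound in auto)
  then show ?thesis by (rule LIM_zero_cancel)
qed

text \<open>The difference of the two series represents the zero function; its first nonzero
  coefficient would be a limit of zeros.\<close>

lemma dirichlet_unique:
  assumes f: "abs_conv_dirichlet_series f c" "abs_conv_dirichlet_series f d" and n: "n \<ge> 1"
  shows "c n = d n"
proof -
  have 0: "abs_conv_dirichlet_series (\<lambda>_. 0) (\<lambda>n. c n - d n)"
    unfolding abs_conv_dirichlet_series_def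
  proof (intro allI impI conjI)
    fix s :: complex assume s: "Re s > 1"
    have a: "(\<lambda>n. norm (c n * of_nat n powr - s) + norm (d n * of_nat n powr - s)) summable_on {1..}"
      using f s unfolding abs_conv_dirichlet_series_def by (intro summable_on_add) auto
    show "(\<lambda>n. norm ((c n - d n) * of_nat n powr - s)) summable_on {1..}"
      by (rule Infinite_Sum.abs_summable_on_comparison_test'[OF a]) (simp add: left_diff_distrib norm_triangle_ineq4)
    have "((\<lambda>n. c n * of_nat n powr - s - d n * of_nat n powr - s) has_sum (f s - f s)) {1..}"
      using f s unfolding abs_conv_dirichlet_series_def by (intro has_sum_diff) auto
    then show "((\<lambda>n. (c n - d n) * of_nat n powr - s) has_sum 0) {1..}" by (simp add: left_diff_distrib)
  qed
  have "c n - d n = 0" if "n \<ge> 1" for n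
    using that
  proof (induction n rule: less_induct)
    case (less n)
    have "(\<lambda>k. 0 * of_nat n ^ (k + 2)) \<longlonglongrightarrow> c n - d n"
      by (rule dirichlet_leading_coeff[OF 0]) (use less in auto)
    then show ?case using LIMSEQ_unique[OF tendsto_const] by force
  qed
  then show ?thesis using n by auto
qed

text \<open>Absolute convergence permits regrouping the double sum by the product of the indices,
  along the bijection between pairs of positive numbers and pairs of a number with one of its
  divisors.\<close>

lemma dirichlet_mult:
  assumes f: "abs_conv_dirichlet_series f c" and g: "abs_conv_dirichlet_series g d"
  shows "abs_conv_dirichlet_series (\<lambda>s. f s * g s) (\<lambda>n. \<Sum>e | e dvd n. c e * d (n div e))"
  unfolding abs_conv_dirichlet_series_def
proof (intro allI impI)
  fix s :: complex assume s: "Re s > 1"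
  let ?x = "\<lambda>n. c n * of_nat n powr - s" and ?y = "\<lambda>n. d n * of_nat n powr - s"
  have x: "(\<lambda>n. norm (?x n)) summable_on {1..}" "(?x has_sum f s) {1..}"
   and y: "(\<lambda>n. norm (?y n)) summable_on {1..}" "(?y has_sum g s) {1..}"
    using f g s unfolding abs_conv_dirichlet_series_def by auto
  let ?P = "\<lambda>(m, n). ?x m * ?y n"
  let ?S = "Sigma {1..} (\<lambda>n::nat. {e. e dvd n})"
  have ab: "(\<lambda>z. norm (?P z)) summable_on ({1..} \<times> {1..})"
  proof -
    have "(\<lambda>(m, n). norm (?x m) * norm (?y n)) summable_on ({1..} \<times> {1..})"
    proof (rule summable_on_SigmaI)
      show "((\<lambda>n. case (m, n) of (m, n) \<Rightarrow> norm (?x m) * norm (?y n)) has_sum norm (?x m) * (\<Sum>\<^sub>\<infinity>n\<in>{1..}. norm (?y n))) {1..}" for m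
        unfolding prod.case by (rule has_sum_cmult_right[OF has_sum_infsum[OF y(1)]])
      show "(\<lambda>m. norm (?x m) * (\<Sum>\<^sub>\<infinity>n\<in>{1..}. norm (?y n))) summable_on {1..}"
        by (rule summable_on_cmult_left[OF x(1)])
    qed auto
    then show ?thesis by (simp add: norm_mult split_def)
  qed
  have hs: "(?P has_sum (f s * g s)) ({1..} \<times> {1..})"
  proof (rule has_sum_SigmaI)
    show "((\<lambda>n. ?P (m, n)) has_sum ?x m * g s) {1..}" for m
      using has_sum_cmult_right[OF y(2), of "?x m"] by simp
    show "((\<lambda>m. ?x m * g s) has_sum (f s * g s)) {1..}"
      by (rule has_sum_cmult_left[OF x(2)])
    show "?P summable_on {1..} \<times> {1..}" by (rule abs_summable_summable[OF ab])
  qed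
  let ?T = "\<lambda>(n, e). c e * d (n div e) * of_nat n powr - s"
  have bij: "bij_betw (\<lambda>(n, e). (e, n div e)) ?S ({1..} \<times> {1..})"
    by (rule bij_betwI[where g = "\<lambda>(m, n). (m * n, m)"]) (auto simp: Suc_le_eq div_greater_zero_iff dvd_imp_le intro: dvd_pos_nat)
  have eqT: "?P ((\<lambda>(n, e). (e, n div e)) z) = ?T z" if z: "z \<in> ?S" for z
  proof -
    obtain n e where ne: "z = (n, e)" "n \<ge> 1" "e dvd n" using z by auto
    then obtain m where m: "n = e * m" by auto
    then have pos: "e > 0" "m > 0" using ne by auto
    have "of_nat n powr - s = (of_nat e powr - s) * (of_nat m powr - s :: complex)"
      unfolding m of_nat_mult by (rule powr_times_real) auto
    then show ?thesis using pos by (simp add: ne m)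
  qed
  have T: "(?T has_sum (f s * g s)) ?S"
    by (rule has_sum_cong[OF eqT, THEN iffD1, OF _ has_sum_reindex_bij_betw[OF bij, THEN iffD2, OF hs]])
  have Tn: "(\<lambda>z. norm (?T z)) summable_on ?S"
  proof -
    have "(\<lambda>z. norm (?P ((\<lambda>(n, e). (e, n div e)) z))) summable_on ?S"
      by (rule summable_on_reindex_bij_betw[OF bij, THEN iffD2, OF ab])
    note 1 = this
    have "norm (?T z) = norm (?P ((\<lambda>(n, e). (e, n div e)) z))" if "z \<in> ?S" for z
      using eqT[OF that] by (simp only:)
    then show ?thesis by (rule summable_on_cong[THEN iffD2, OF _ 1])
  qed
  have fin: "finite {e. e dvd n}" if "n \<in> {1..}" for n :: nat using that by auto
  let ?c = "\<lambda>n. \<Sum>e | e dvd n. c e * d (n div e)"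
  show "(\<lambda>n. norm (?c n * of_nat n powr - s)) summable_on {1..} \<and>
        ((\<lambda>n. ?c n * of_nat n powr - s) has_sum (f s * g s)) {1..}"
  proof
    have in1: "((\<lambda>e. ?T (n, e)) has_sum (?c n * of_nat n powr - s)) {e. e dvd n}" if "n \<in> {1..}" for n
      by (rule has_sum_finiteI) (use fin[OF that] in \<open>auto simp: sum_distrib_right\<close>)
    show "((\<lambda>n. ?c n * of_nat n powr - s) has_sum (f s * g s)) {1..}"
      by (rule has_sum_SigmaD[OF T in1])
    have in2: "((\<lambda>e. norm (?T (n, e))) has_sum (\<Sum>e | e dvd n. norm (?T (n, e)))) {e. e dvd n}" if "n \<in> {1..}" for n
      by (rule has_sum_finiteI) (use fin[OF that] in auto)
    have "(\<lambda>n. \<Sum>e | e dvd n. norm (?T (n, e))) summable_on {1..}"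
      using has_sum_SigmaD[OF has_sum_infsum[OF Tn] in2] by (rule has_sum_imp_summable)
    then show "(\<lambda>n. norm (?c n * of_nat n powr - s)) summable_on {1..}"
      by (rule Infinite_Sum.abs_summable_on_comparison_test') (auto simp: sum_distrib_right intro!: order_trans[OF norm_sum])
  qed
qed

text \<open>For 1 < y < x the factor ln n is at most n^(x - y) / (x - y), so the differentiated
  terms are dominated by the absolutely convergent series at y, uniformly on the half-plane Re s >
  x.\<close>

lemma dirichlet_deriv:
  assumes f: "abs_conv_dirichlet_series f c"
  shows "abs_conv_dirichlet_series (deriv f) (\<lambda>n. - of_real (ln n) * c n)"
    and "Re s > 1 \<Longrightarrow> f field_differentiable at s"
proof -
  define u where "u n s = c (Suc n) * of_nat (Suc n) powr - s" for n s
  define u' where "u' n s = - of_real (ln (Suc n)) * c (Suc n) * of_nat (Suc n) powr - s" for n s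
  have bijS: "bij_betw Suc UNIV {1..}"
    by (rule bij_betwI[where g = "\<lambda>n. n - 1"]) auto
  have us: "(\<lambda>n. norm (u n s)) summable_on UNIV" "((\<lambda>n. u n s) has_sum f s) UNIV" if "Re s > 1" for s
    using f that has_sum_reindex_bij_betw[OF bijS, of "\<lambda>n. c n * of_nat n powr - s"]
      summable_on_reindex_bij_betw[OF bijS, of "\<lambda>n. norm (c n * of_nat n powr - s)"]
    unfolding abs_conv_dirichlet_series_def u_def by auto
  have u'b: "norm (u' n s) \<le> norm (u n (of_real y)) / (x - y)" if "1 < y" "y < x" "x \<le> Re s" for n s x y
  proof -
    have "ln (real (Suc n)) \<le> real (Suc n) powr (x - y) / (x - y)"
      using that by (intro ln_powr_bound) auto
    then have "ln (real (Suc n)) * real (Suc n) powr - Re s \<le> (real (Suc n) powr (x - y) / (x - y)) * real (Suc n) powr - x"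
      using that by (intro mult_mono powr_mono) auto
    also have "\<dots> = real (Suc n) powr - y / (x - y)" by (simp add: powr_add[symmetric])
    finally have "norm (c (Suc n)) * (ln (real (Suc n)) * real (Suc n) powr - Re s) \<le> norm (c (Suc n)) * (real (Suc n) powr - y / (x - y))"
      by (intro mult_left_mono) auto
    moreover have "norm (complex_of_real (ln (real (Suc n)))) = ln (real (Suc n))" by simp
    moreover have "norm (complex_of_nat (Suc n) powr - s) = real (Suc n) powr - Re s" "norm (complex_of_nat (Suc n) powr - of_real y) = real (Suc n) powr - y"
      unfolding norm_nat_powr by auto
    ultimately show ?thesis
      unfolding u_def u'_def norm_mult norm_minus_cancel by (simp only: mult_ac times_divide_eq_right times_divide_eq_left)
  qed
  have main: "(f has_field_derivative (\<Sum>n. u' n s)) (at s)" if s: "Re s > 1" for s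
  proof -
    define x where "x = (1 + Re s) / 2"
    define y where "y = (1 + x) / 2"
    have xy: "1 < y" "y < x" "x < Re s" using s by (auto simp: x_def y_def)
    have op: "open {z. x < Re z}" by (rule open_halfspace_Re_gt)
    have "((\<lambda>z. \<Sum>n. u n z) has_field_derivative (\<Sum>n. u' n s)) (at s)"
    proof (rule has_field_derivative_series'(2)[where S = "{z. x < Re z}"])
      show "(u n has_field_derivative u' n z) (at z within {z. x < Re z})" for n z
      proof -
        have *: "complex_of_nat (Suc n) powr w = exp (w * of_real (ln (real (Suc n))))" for w
          by (simp add: powr_def Ln_of_nat del: of_nat_Suc)
        show ?thesis
          unfolding u_def[abs_def] u'_def * by (auto intro!: derivative_eq_intros simp del: of_nat_Suc)
      qed
      have "uniform_limit {z. x < Re z} (\<lambda>n z. \<Sum>i<n. u' i z) (\<lambda>z. \<Sum>i. u' i z) sequentially"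
      proof (rule Weierstrass_m_test)
        show "norm (u' n z) \<le> norm (u n (of_real y)) / (x - y)" if "z \<in> {z. x < Re z}" for n z
          by (rule u'b) (use xy that in auto)
        show "summable (\<lambda>n. norm (u n (of_real y)) / (x - y))"
          using us(1)[of "of_real y"] xy by (intro summable_divide summable_on_imp_summable) auto
      qed
      then show "uniformly_convergent_on {z. x < Re z} (\<lambda>n z. \<Sum>i<n. u' i z)"
        by (rule uniformly_convergentI)
      show "summable (\<lambda>n. u n s)" using has_sum_imp_sums[OF us(2)[OF s]] by (auto simp: sums_iff)
      show "s \<in> interior {z. x < Re z}" using xy op by (simp add: interior_open)
      show "convex {z. x < Re z}" by (rule convex_halfspace_Re_gt)
    qed (use xy in auto)
    moreover have "(\<Sum>n. u n z) = f z" if "z \<in> {z. x < Re z}" for z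
      using has_sum_imp_sums[OF us(2)[of z]] xy that by (auto simp: sums_iff)
    ultimately show ?thesis
      using has_field_derivative_transform_within_open[OF _ op] xy by auto
  qed
  then show "Re s > 1 \<Longrightarrow> f field_differentiable at s" by (auto simp: field_differentiable_def)
  show "abs_conv_dirichlet_series (deriv f) (\<lambda>n. - of_real (ln n) * c n)"
    unfolding abs_conv_dirichlet_series_def
  proof (intro allI impI)
    fix s :: complex assume s: "Re s > 1"
    define y where "y = (1 + Re s) / 2"
    have y: "1 < y" "y < Re s" using s by (auto simp: y_def)
    have n: "summable (\<lambda>n. norm (u' n s))"
    proof (rule summable_comparison_test'[where N = 0])
      show "summable (\<lambda>n. norm (u n (of_real y)) / (Re s - y))"
        using us(1)[of "of_real y"] y by (intro summable_divide summable_on_imp_summable) auto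
      show "norm (norm (u' n s)) \<le> norm (u n (of_real y)) / (Re s - y)" for n
        using u'b[of y "Re s" s n] y by simp
    qed
    have 1: "(\<lambda>n. norm (u' n s)) summable_on UNIV" by (rule summable_nonneg_imp_summable_on[OF n]) simp
    have 2: "((\<lambda>n. u' n s) has_sum deriv f s) UNIV"
      unfolding DERIV_imp_deriv[OF main[OF s]]
      by (rule norm_summable_imp_has_sum[OF n summable_sums[OF summable_norm_cancel[OF n]]])
    show "(\<lambda>n. norm (- of_real (ln n) * c n * of_nat n powr - s)) summable_on {1..} \<and>
        ((\<lambda>n. - of_real (ln n) * c n * of_nat n powr - s) has_sum deriv f s) {1..}"
      using 1 2 has_sum_reindex_bij_betw[OF bijS, of "\<lambda>n. - of_real (ln n) * c n * of_nat n powr - s"]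
      summable_on_reindex_bij_betw[OF bijS, of "\<lambda>n. norm (- of_real (ln n) * c n * of_nat n powr - s)"]
      unfolding u'_def by blast
  qed
qed

text \<open>Links orthogonality, which concerns \<open>a\<close>, with the local factors, which
  involve \<open>b\<close>. With Z the logarithm of F, the relation F' = Z' F is an identity of
  Dirichlet series whose coefficient at p involves only a(p), b(p) and a(1) = 1. Differentiating
  avoids expanding the exponential of a Dirichlet series.\<close>

lemma coeff_prime_eq:
  assumes F: "abs_conv_dirichlet_series F a" and E: "log_euler_product F b" and p: "prime p"
  shows "a p = b p"
proof -
  define I where "I = {p::nat. prime p} \<times> {1::nat..}"
  define PP where "PP = (\<lambda>(p, k). p ^ k) ` I"
  \<comment> \<open>The coefficients of Z as an ordinary Dirichlet series; by unique factorisation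
    each prime power comes from one pair (p, k).\<close>
  define \<beta> where "\<beta> n = (if n \<in> PP then b n else 0)" for n
  define Z where "Z s = (\<Sum>\<^sub>\<infinity>(p, k)\<in>I. b (p ^ k) * of_nat p powr (- (of_nat k * s)))" for s
  have inj: "inj_on (\<lambda>(p, k). p ^ k) I"
  proof (rule inj_onI)
    fix x y assume *: "x \<in> I" "y \<in> I" "(case x of (p, k) \<Rightarrow> p ^ k) = (case y of (p, k) \<Rightarrow> p ^ k)"
    obtain p k q l where "x = (p, k)" "y = (q, l)" by (cases x, cases y)
    then show "x = y" using * prime_power_inj'[of p q k l] by (auto simp: I_def Suc_le_eq)
  qed
  have bij: "bij_betw (\<lambda>(p, k). p ^ k) I PP" unfolding PP_def using inj by (rule inj_on_imp_bij_betw)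
  have PP1: "n > 1" if n: "n \<in> PP" for n
    proof -
    obtain z where "z \<in> I" "n = (case z of (p, k) \<Rightarrow> p ^ k)" using n unfolding PP_def by blast
    then obtain p k where "prime p" "k \<ge> 1" "n = p ^ k" by (cases z) (auto simp: I_def)
    then show ?thesis using one_less_power[OF prime_gt_1_nat, of p k] by simp
  qed
  have FZ: "F s = exp (Z s)" if "Re s > 1" for s
    using E that unfolding log_euler_product_def Z_def I_def by blast
  have Z: "abs_conv_dirichlet_series Z \<beta>"
    unfolding abs_conv_dirichlet_series_def
  proof (intro allI impI)
    fix s :: complex assume s: "Re s > 1"
    let ?g = "\<lambda>n. b n * of_nat n powr - s"
    have eq: "(case z of (p, k) \<Rightarrow> b (p ^ k) * of_nat p powr (- (of_nat k * s))) = ?g (case z of (p, k) \<Rightarrow> p ^ k)"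
      if zI: "z \<in> I" for z
    proof -
      obtain p k where z: "z = (p, k)" "prime p" using zI by (auto simp: I_def)
      have "of_nat (p ^ k) powr - s = complex_of_nat p powr (- (of_nat k * s))"
      proof (induction k)
        case (Suc k)
        have "of_nat (p ^ Suc k) powr - s = of_nat p powr - s * (of_nat (p ^ k) powr - s :: complex)"
          unfolding power_Suc of_nat_mult by (rule powr_times_real) auto
        also have "\<dots> = of_nat p powr - s * complex_of_nat p powr (- (of_nat k * s))" using Suc by simp
        also have "\<dots> = complex_of_nat p powr (- (of_nat (Suc k) * s))"
          unfolding powr_add[symmetric] by (simp add: algebra_simps)
        finally show ?case .
      qed (use z in \<open>simp add: prime_gt_0_nat\<close>)
      then show ?thesis by (simp add: z)
    qed
    have "(\<lambda>z. norm (case z of (p, k) \<Rightarrow> b (p ^ k) * of_nat p powr (- (of_nat k * s)))) summable_on I"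
      using E s unfolding log_euler_product_def I_def by (simp add: split_def)
    moreover from abs_summable_summable[OF this]
    have "((\<lambda>z. case z of (p, k) \<Rightarrow> b (p ^ k) * of_nat p powr (- (of_nat k * s))) has_sum Z s) I"
      unfolding Z_def by (rule has_sum_infsum)
    ultimately have 1: "(\<lambda>z. norm (case z of (p, k) \<Rightarrow> b (p ^ k) * of_nat p powr (- (of_nat k * s)))) summable_on I"
      and 2: "((\<lambda>z. case z of (p, k) \<Rightarrow> b (p ^ k) * of_nat p powr (- (of_nat k * s))) has_sum Z s) I" .
    have eqn: "norm (case z of (p, k) \<Rightarrow> b (p ^ k) * of_nat p powr (- (of_nat k * s))) = norm (?g (case z of (p, k) \<Rightarrow> p ^ k))"
      if "z \<in> I" for z by (simp only: eq[OF that])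
    have gP: "(\<lambda>n. norm (?g n)) summable_on PP" "(?g has_sum Z s) PP"
      by (rule summable_on_reindex_bij_betw[OF bij, THEN iffD1], rule summable_on_cong[OF eqn, THEN iffD1, OF _ 1], assumption)
         (rule has_sum_reindex_bij_betw[OF bij, THEN iffD1], rule has_sum_cong[OF eq, THEN iffD1, OF _ 2], assumption)
    have sub: "PP \<subseteq> {1..}" using PP1 by force
    show "(\<lambda>n. norm (\<beta> n * of_nat n powr - s)) summable_on {1..} \<and>
        ((\<lambda>n. \<beta> n * of_nat n powr - s) has_sum Z s) {1..}"
    proof
      show "(\<lambda>n. norm (\<beta> n * of_nat n powr - s)) summable_on {1..}"
        by (rule summable_on_cong_neutral[THEN iffD1, OF _ _ _ gP(1)]) (use sub in \<open>auto simp: \<beta>_def\<close>)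
      show "((\<lambda>n. \<beta> n * of_nat n powr - s) has_sum Z s) {1..}"
        by (rule has_sum_cong_neutral[THEN iffD1, OF _ _ _ gP(2)]) (use sub in \<open>auto simp: \<beta>_def\<close>)
    qed
  qed
  have \<beta>1: "\<beta> 1 = 0" using PP1[of 1] by (auto simp: \<beta>_def)
  \<comment> \<open>Z has no constant term, so F tends to 1 along the integers; the same limit is
    also a(1).\<close>
  have "(\<lambda>k. Z (of_nat (k + 2))) \<longlonglongrightarrow> 0"
    using dirichlet_leading_coeff[OF Z, of 1] \<beta>1 by simp
  from tendsto_exp[OF this] have "(\<lambda>k. F (of_nat (k + 2))) \<longlonglongrightarrow> 1"
    by (subst FZ) auto
  moreover have "(\<lambda>k. F (of_nat (k + 2))) \<longlonglongrightarrow> a 1"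
    using dirichlet_leading_coeff[OF F, of 1] by simp
  ultimately have a1: "a 1 = 1" using LIMSEQ_unique by blast
  have dF: "deriv F s = deriv Z s * F s" if s: "Re s > 1" for s
  proof -
    have "((\<lambda>s. exp (Z s)) has_field_derivative exp (Z s) * deriv Z s) (at s)"
      by (intro derivative_eq_intros) (use dirichlet_deriv(2)[OF Z s] in \<open>auto simp: DERIV_deriv_iff_field_differentiable\<close>)
    then have "(F has_field_derivative exp (Z s) * deriv Z s) (at s)"
      by (rule has_field_derivative_transform_within_open[OF _ open_halfspace_Re_gt[of 1]]) (use s FZ in auto)
    then show ?thesis using FZ[OF s] by (simp add: DERIV_imp_deriv)
  qed
  have "abs_conv_dirichlet_series (deriv F) (\<lambda>n. \<Sum>e | e dvd n. (- of_real (ln e) * \<beta> e) * a (n div e))"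
    using dirichlet_mult[OF dirichlet_deriv(1)[OF Z] F] dF unfolding abs_conv_dirichlet_series_def by simp
  from dirichlet_unique[OF dirichlet_deriv(1)[OF F] this, of p]
  have "- of_real (ln p) * a p = (\<Sum>e | e dvd p. (- of_real (ln e) * \<beta> e) * a (p div e))"
    using p prime_gt_0_nat[OF p] by simp
  also have "{e. e dvd p} = {1, p}" using p by (auto simp: prime_nat_iff)
  \<comment> \<open>The divisor 1 contributes nothing since ln 1 = 0; the divisor p leaves the
    factor a(1) = 1.\<close>
  also have "(\<Sum>e\<in>{1, p}. (- of_real (ln e) * \<beta> e) * a (p div e)) = - of_real (ln p) * \<beta> p"
    using p prime_gt_1_nat[OF p] by (simp add: a1[simplified])
  finally have "a p = \<beta> p" using prime_gt_1_nat[OF p] by simp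
  moreover have "p \<in> PP"
    unfolding PP_def I_def using p by (auto intro!: image_eqI[of _ _ "(p, 1)"])
  ultimately show ?thesis by (simp add: \<beta>_def)
qed

section \<open>Local Euler factors\<close>

lemma integral_unit_interval_eq:
  fixes f :: "real \<Rightarrow> complex"
  assumes "continuous_on {0..1} f"
  shows "(\<integral>t. f t \<partial>unit_interval) = integral {0..1} f"
proof -
  have s: "set_integrable lborel {0..<1} f"
    by (rule set_integrable_subset[OF borel_integrable_atLeastAtMost'[OF assms]]) auto
  have "(\<integral>t. f t \<partial>unit_interval) = set_lebesgue_integral lborel {0..<1} f"
    unfolding set_lebesgue_integral_def by (rule integral_restrict_space) simp
  also have "\<dots> = integral {0..<1} f" by (rule set_borel_integral_eq_integral(2)[OF s])
  also have "\<dots> = integral {0..1} f"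
    by (rule integral_spike_set; rule negligible_subset[of "{1::real}"]; auto)
  finally show ?thesis .
qed

text \<open>Dividing the coefficients by k, which loses nothing since \<open>c 0 = 0\<close>,
  exhibits the series as an angular derivative; over a full turn it integrates to 0.\<close>

lemma ps_circle_mean:
  fixes c :: "nat \<Rightarrow> complex" and z :: complex
  assumes conv: "\<And>z::complex. norm z < R \<Longrightarrow> summable (\<lambda>k. norm (c k * z ^ k))" and zR: "norm z < R" and c0: "c 0 = 0"
  shows "integral {0..1} (\<lambda>t. ps c r (z * cis (- (2 * pi * t)))) = 0"
proof -
  define c' where "c' k = c k / of_nat k" for k
  have kc: "of_nat k * c' k = c k" for k
    by (cases "k = 0") (simp_all add: c'_def c0)
  have le: "norm (c' k) \<le> norm (c k)" for k
  proof (cases "k = 0")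
    case False
    then have "1 * norm (c' k) \<le> real k * norm (c' k)" by (intro mult_right_mono) auto
    then show ?thesis unfolding kc[of k, symmetric] norm_mult norm_of_nat by simp
  qed (simp add: c'_def c0)
  have conv': "summable (\<lambda>k. c' k * z ^ k)" if "norm z < R" for z :: complex
    by (rule summable_comparison_test'[OF conv[OF that], of 0]) (simp add: norm_mult mult_right_mono le)
  have eq: "ps c r w = ps c' (Suc r) w" for w
    unfolding ps_def kc[symmetric] power_Suc by (simp only: mult_ac)
  let ?g = "\<lambda>t. ps c' r (z * cis (- (2 * pi * t)))"
  have "((\<lambda>t. - (2 * pi) * \<i> * ps c' (Suc r) (z * cis (- (2 * pi * t)))) has_integral (?g 1 - ?g 0)) {0..1}"
    by (rule fundamental_theorem_of_calculus)
       (simp, rule has_vector_derivative_at_within, rule ps_circle_derivative[OF conv' zR])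
  moreover have "cis (- (2 * pi * 1)) = cis (- (2 * pi * 0))" by (simp add: complex_eq_iff)
  then have "?g 1 - ?g 0 = 0" by (simp only: diff_self)
  ultimately have "((\<lambda>t. - (2 * pi) * \<i> * ps c r (z * cis (- (2 * pi * t)))) has_integral 0) {0..1}"
    by (simp add: eq)
  from integral_unique[OF this] show ?thesis by simp
qed

lemma continuous_on_ps:
  fixes c :: "nat \<Rightarrow> complex"
  assumes "\<And>z::complex. norm z < R \<Longrightarrow> summable (\<lambda>k. c k * z ^ k)"
  shows "continuous_on (ball 0 R) (ps c r)"
proof (rule continuous_at_imp_continuous_on, rule ballI)
  fix z :: complex assume "z \<in> ball 0 R"
  then have "norm z < R" by simp
  from ps_has_derivative[OF assms this] obtain D where "(ps c r has_field_derivative D) (at z)" by metis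
  then show "isCont (ps c r) z" by (rule DERIV_isCont)
qed

section \<open>Primes and uniform constants for the local series\<close>

lemma prime_nth_prime: "prime (nth_prime m)"
  unfolding nth_prime_def using enumerate_in_set[OF primes_infinite, of m] by simp

lemma strict_mono_nth_prime: "strict_mono nth_prime"
  unfolding nth_prime_def[abs_def] by (rule strict_mono_enumerate[OF primes_infinite])

lemma nth_prime_ge: "m \<le> nth_prime m"
  by (rule seq_suble[OF strict_mono_nth_prime])

lemma range_nth_prime: "range nth_prime = {p. prime p}"
  unfolding nth_prime_def[abs_def] by (rule range_enumerate[OF primes_infinite])

lemma nth_prime_gt1: "1 < real (nth_prime m)" "0 < real (nth_prime m)" "2 \<le> real (nth_prime m)"
  using prime_ge_2_nat[OF prime_nth_prime[of m]] by auto

text \<open>The value of p^(-1/2) at the smallest prime: a common geometric ratio for all local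
  series when s \<ge> 1.\<close>

definition h0 :: real where "h0 = 2 powr (-1/2)"
text \<open>The cube accommodates three angular derivatives, the shift by 2 the removal of the
  linear term.\<close>

definition T0 :: real where "T0 = (\<Sum>k. real (k + 2) ^ 3 * h0 ^ k)"

lemma h0: "0 < h0" "h0 < 1"
  unfolding h0_def by (auto simp: powr_less_one)

lemma summable_T0: "summable (\<lambda>k. real (k + 2) ^ 3 * h0 ^ k)"
proof -
  have "summable (\<lambda>k. of_nat k ^ 3 * 1 * (of_real h0) ^ k :: complex)"
    by (rule ps_summable[where R = 1]) (use h0 in \<open>auto intro: summable_geometric\<close>)
  then have "summable (\<lambda>k. complex_of_real (real k ^ 3 * h0 ^ k))" by simp
  then have "summable (\<lambda>k. real k ^ 3 * h0 ^ k)" by (simp only: summable_of_real_iff)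
  then have "summable (\<lambda>k. real (k + 2) ^ 3 * h0 ^ (k + 2))" by (rule summable_ignore_initial_segment)
  then have "summable (\<lambda>k. (1 / h0\<^sup>2) * (real (k + 2) ^ 3 * h0 ^ (k + 2)))" by (rule summable_mult)
  then show ?thesis using h0 by (simp add: power_add field_simps)
qed

lemma T0_pos: "0 < T0"
proof -
  have "0 < real (0 + 2) ^ 3 * h0 ^ 0" by simp
  then show ?thesis unfolding T0_def
    by (intro suminf_pos2[OF summable_T0, of 0]) (use h0 in auto)
qed

lemma T0_bound:
  assumes "0 \<le> x" "x \<le> h0"
  shows "summable (\<lambda>k. real (k + 2) ^ 3 * x ^ k)" "(\<Sum>k. real (k + 2) ^ 3 * x ^ k) \<le> T0"
proof -
  have le: "real (k + 2) ^ 3 * x ^ k \<le> real (k + 2) ^ 3 * h0 ^ k" for k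
    using assms by (intro mult_left_mono power_mono) auto
  show s: "summable (\<lambda>k. real (k + 2) ^ 3 * x ^ k)"
    by (rule summable_comparison_test'[OF summable_T0, of 0]) (use le assms in auto)
  show "(\<Sum>k. real (k + 2) ^ 3 * x ^ k) \<le> T0" unfolding T0_def by (rule suminf_le[OF le s summable_T0])
qed

definition loc_arg :: "nat \<Rightarrow> real \<Rightarrow> real \<Rightarrow> complex" where
  "loc_arg m s t = Complex s (2 * pi * t / ln (real (nth_prime m)))"

definition log_loc :: "('n::finite \<Rightarrow> nat \<Rightarrow> complex) \<Rightarrow> nat \<Rightarrow> real \<Rightarrow> real \<Rightarrow> complex ^ 'n" where
  "log_loc b m s t = (\<chi> j. log_local_factor (b j) (nth_prime m) (loc_arg m s t))"

text \<open>\<open>w\<close> selects the combination of logarithmic derivatives: the indicator of j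
  for a single function, the indicator of j plus \<tau> times that of l for a pair. This is why its
  entries are later bounded by 2.\<close>

definition logderiv_loc :: "('n::finite \<Rightarrow> nat \<Rightarrow> complex) \<Rightarrow> ('n \<Rightarrow> complex) \<Rightarrow> nat \<Rightarrow> real \<Rightarrow> real \<Rightarrow> complex" where
  "logderiv_loc b w m s t = (\<Sum>j\<in>UNIV. w j * (deriv (local_factor (b j) (nth_prime m)) (loc_arg m s t)
      / local_factor (b j) (nth_prime m) (loc_arg m s t)))"

section \<open>Local factors as power series in p^(-s)\<close>

text \<open>One exponent 1/2 - 2\<eta> serves all functions. For the square summability of
  logarithmic derivatives one \<eta> of the reserve is spent on their factor log p, and the other
  one remains.\<close>

locale euler_coeffs =
  fixes b :: "'n::finite \<Rightarrow> nat \<Rightarrow> complex" and C \<eta> :: real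
  assumes \<eta>: "0 < \<eta>" "\<eta> \<le> 1 / 8" and C: "0 < C"
    and bound: "\<And>j p k. prime p \<Longrightarrow> 1 \<le> k \<Longrightarrow> norm (b j (p ^ k)) \<le> C * (real p powr (1 / 2 - 2 * \<eta>)) ^ k"
begin

text \<open>Coefficients of the local logarithm as a power series in z = p^(-s). It has no constant
  term, so the value 0 at index 0 keeps \<open>b j 1\<close> out.\<close>

definition cf :: "'n \<Rightarrow> nat \<Rightarrow> nat \<Rightarrow> complex" where
  "cf j m k = (if k = 0 then 0 else b j (nth_prime m ^ k))"

definition Rq :: "nat \<Rightarrow> real" where "Rq m = real (nth_prime m) powr (1 / 2 - 2 * \<eta>)"

definition zz :: "nat \<Rightarrow> real \<Rightarrow> complex" where "zz m s = of_real (real (nth_prime m) powr - s)"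

lemma Rq_pos: "0 < Rq m" unfolding Rq_def using nth_prime_gt1[of m] by simp

lemma cf_bound: "norm (cf j m k) \<le> C * Rq m ^ k"
  using bound[OF prime_nth_prime, of k j m] C Rq_pos[of m] by (auto simp: cf_def Rq_def)

text \<open>Stated for arbitrary coefficients so as to serve also the linear combinations of
  \<open>cf\<close> that arise from inner products.\<close>

lemma cf_conv:
  assumes c: "\<And>k. norm (c k) \<le> B * Rq m ^ k" and z: "norm z < 1 / Rq m"
  shows "summable (\<lambda>k. norm (c k * z ^ k :: complex))"
proof (rule summable_comparison_test'[where N = 0])
  have "norm z * Rq m < 1" using z Rq_pos[of m] by (simp add: field_simps)
  then show "summable (\<lambda>k. B * (Rq m * norm z) ^ k)"
    using Rq_pos[of m] by (intro summable_mult summable_geometric) (simp add: abs_mult mult.commute)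
  show "norm (norm (c k * z ^ k)) \<le> B * (Rq m * norm z) ^ k" for k
    using mult_right_mono[OF c[of k], of "norm z ^ k"] by (simp add: norm_mult norm_power power_mult_distrib mult.assoc)
qed

lemma zz_lt:
  assumes "1 \<le> s"
  shows "norm (zz m s) < 1 / Rq m" "Rq m * norm (zz m s) \<le> h0"
    "Rq m * norm (zz m s) \<le> real (nth_prime m) powr (- 1 / 2 - 2 * \<eta>)"
    "Rq m * norm (zz m s) = real (nth_prime m) powr (1 / 2 - 2 * \<eta> - s)"
proof -
  let ?q = "real (nth_prime m)"
  show e: "Rq m * norm (zz m s) = ?q powr (1 / 2 - 2 * \<eta> - s)"
    unfolding Rq_def zz_def by (simp add: powr_add[symmetric])
  also have "\<dots> \<le> ?q powr (- 1 / 2 - 2 * \<eta>)" using nth_prime_gt1[of m] assms by (intro powr_mono) auto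
  finally show 1: "Rq m * norm (zz m s) \<le> ?q powr (- 1 / 2 - 2 * \<eta>)" .
  also have "\<dots> \<le> ?q powr (- 1 / 2)" using nth_prime_gt1[of m] \<eta> by (intro powr_mono) auto
  also have "\<dots> \<le> 2 powr (- 1 / 2)" using nth_prime_gt1[of m] by (intro powr_mono2') auto
  finally show 2: "Rq m * norm (zz m s) \<le> h0" by (simp add: h0_def)
  then have "Rq m * norm (zz m s) < 1" using h0 by simp
  then show "norm (zz m s) < 1 / Rq m" using Rq_pos[of m] by (simp add: field_simps)
qed

text \<open>The index i is the order of the first term kept: 1 for the whole series, 2 for what lies
  beyond the linear term.\<close>

lemma tail_bound:
  assumes c: "\<And>k. norm (c k) \<le> B * Rq m ^ k" and s: "1 \<le> s" and B: "0 \<le> B"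
  shows "summable (\<lambda>k. real (k + 2) ^ 3 * norm (c (k + i) * zz m s ^ (k + i)))"
    "(\<Sum>k. real (k + 2) ^ 3 * norm (c (k + i) * zz m s ^ (k + i))) \<le> B * (Rq m * norm (zz m s)) ^ i * T0"
proof -
  let ?x = "Rq m * norm (zz m s)"
  have x: "0 \<le> ?x" "?x \<le> h0" using zz_lt(2)[OF s, of m] Rq_pos[of m] by auto
  have le: "real (k + 2) ^ 3 * norm (c (k + i) * zz m s ^ (k + i)) \<le> (B * ?x ^ i) * (real (k + 2) ^ 3 * ?x ^ k)" for k
  proof -
    have "norm (c (k + i) * zz m s ^ (k + i)) \<le> B * ?x ^ (k + i)"
      using mult_right_mono[OF c[of "k + i"], of "norm (zz m s) ^ (k + i)"]
      by (simp add: norm_mult norm_power power_mult_distrib mult.assoc)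
    then have "real (k + 2) ^ 3 * norm (c (k + i) * zz m s ^ (k + i)) \<le> real (k + 2) ^ 3 * (B * ?x ^ (k + i))"
      by (intro mult_left_mono) auto
    then show ?thesis by (simp only: power_add mult_ac)
  qed
  have s1: "summable (\<lambda>k. (B * ?x ^ i) * (real (k + 2) ^ 3 * ?x ^ k))"
    by (rule summable_mult[OF T0_bound(1)[OF x]])
  show s2: "summable (\<lambda>k. real (k + 2) ^ 3 * norm (c (k + i) * zz m s ^ (k + i)))"
    by (rule summable_comparison_test'[OF s1, of 0]) (use le in auto)
  have "(\<Sum>k. real (k + 2) ^ 3 * norm (c (k + i) * zz m s ^ (k + i))) \<le> (\<Sum>k. (B * ?x ^ i) * (real (k + 2) ^ 3 * ?x ^ k))"
    by (rule suminf_le[OF le s2 s1])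
  also have "\<dots> = (B * ?x ^ i) * (\<Sum>k. real (k + 2) ^ 3 * ?x ^ k)"
    by (rule suminf_mult[OF T0_bound(1)[OF x]])
  also have "\<dots> \<le> (B * ?x ^ i) * T0" using B x by (intro mult_left_mono T0_bound) auto
  finally show "(\<Sum>k. real (k + 2) ^ 3 * norm (c (k + i) * zz m s ^ (k + i))) \<le> B * ?x ^ i * T0" .
qed

lemma ps_bound:
  assumes s: "1 \<le> s" and r: "r \<le> 3" and w: "norm w = norm (zz m s)"
  shows "norm (ps (cf j m) r w) \<le> C * real (nth_prime m) powr (- 1 / 2 - 2 * \<eta>) * T0"
proof -
  have lt: "norm w < 1 / Rq m" unfolding w by (rule zz_lt(1)[OF s])
  have sm: "summable (\<lambda>k. of_nat k ^ r * cf j m k * w ^ k)"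
    by (rule ps_summable[OF summable_norm_cancel[OF cf_conv[OF cf_bound]] lt])
  have "ps (cf j m) r w = (\<Sum>k. of_nat (Suc k) ^ r * cf j m (Suc k) * w ^ Suc k)"
    unfolding ps_def using suminf_split_head[OF sm] by (simp add: cf_def)
  also have "norm \<dots> \<le> (\<Sum>k. real (k + 2) ^ 3 * norm (cf j m (k + 1) * zz m s ^ (k + 1)))"
  proof (rule norm_suminf_le)
    fix k
    have "real (Suc k) ^ r \<le> real (Suc k) ^ 3" using r by (intro power_increasing) auto
    also have "\<dots> \<le> real (k + 2) ^ 3" by (intro power_mono) auto
    finally show "norm (of_nat (Suc k) ^ r * cf j m (Suc k) * w ^ Suc k) \<le> real (k + 2) ^ 3 * norm (cf j m (k + 1) * zz m s ^ (k + 1))"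
      unfolding norm_mult norm_power w norm_of_nat mult.assoc Suc_eq_plus1 by (intro mult_right_mono) auto
  qed (rule tail_bound(1)[OF cf_bound s, where i = 1], use C in simp)
  also have "\<dots> \<le> C * (Rq m * norm (zz m s)) ^ 1 * T0"
    by (rule tail_bound(2)[OF cf_bound s]) (use C in simp)
  also have "\<dots> \<le> C * real (nth_prime m) powr (- 1 / 2 - 2 * \<eta>) * T0"
    using zz_lt(3)[OF s] C T0_pos by (intro mult_right_mono mult_left_mono) auto
  finally show ?thesis .
qed

text \<open>The imaginary part 2 pi t / log p is scaled so that t running through a unit interval
  turns p^(-s) once around its circle.\<close>

lemma powr_loc_arg: "of_nat (nth_prime m) powr - loc_arg m s t = zz m s * cis (- (2 * pi * t))"
proof -
  let ?q = "real (nth_prime m)"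
  have l: "ln ?q > 0" using nth_prime_gt1[of m] by simp
  have "complex_of_nat (nth_prime m) powr - loc_arg m s t = exp (- loc_arg m s t * of_real (ln ?q))"
    using nth_prime_gt1[of m] by (simp add: powr_def Ln_of_nat)
  also have "- loc_arg m s t * of_real (ln ?q) = of_real (- s * ln ?q) + \<i> * of_real (- (2 * pi * t))"
    using l by (simp add: loc_arg_def complex_eq_iff)
  also have "exp \<dots> = of_real (exp (- s * ln ?q)) * cis (- (2 * pi * t))"
    by (simp only: exp_add exp_of_real cis_conv_exp)
  also have "exp (- s * ln ?q) = ?q powr - s" using nth_prime_gt1[of m] by (simp add: powr_def)
  finally show ?thesis by (simp add: zz_def)
qed

lemma log_local_factor_ps:
  assumes "Re w > 1 / 2 - 2 * \<eta>"
  shows "log_local_factor (b j) (nth_prime m) w = ps (cf j m) 0 (of_nat (nth_prime m) powr - w)"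
    "norm (of_nat (nth_prime m) powr - w) < 1 / Rq m"
proof -
  let ?q = "nth_prime m"
  let ?z = "of_nat ?q powr - w :: complex"
  have "norm ?z = real ?q powr - Re w" using norm_powr_real_powr[of "of_nat ?q" "- w"] by simp
  also have "\<dots> < real ?q powr - (1 / 2 - 2 * \<eta>)"
    using assms nth_prime_gt1[of m] by (intro powr_less_mono) auto
  also have "\<dots> = 1 / Rq m" unfolding Rq_def powr_minus by (simp add: inverse_eq_divide)
  finally show lt: "norm ?z < 1 / Rq m" .
  have pw: "of_nat ?q powr (- (of_nat k * w)) = ?z ^ k" for k
  proof -
    have "of_nat ?q powr (- (of_nat k * w)) = exp (of_nat k * (- w * Ln (of_nat ?q)))"
      using nth_prime_gt1[of m] by (simp add: powr_def mult_ac)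
    also have "\<dots> = ?z ^ k" unfolding exp_of_nat_mult using nth_prime_gt1[of m] by (simp add: powr_def)
    finally show ?thesis .
  qed
  have sm: "summable (\<lambda>k. of_nat k ^ 0 * cf j m k * ?z ^ k)"
    by (rule ps_summable[OF summable_norm_cancel[OF cf_conv[OF cf_bound]] lt])
  show "log_local_factor (b j) ?q w = ps (cf j m) 0 ?z"
    unfolding log_local_factor_def pw ps_def using suminf_split_head[OF sm]
    by (simp add: cf_def del: power_Suc)
qed

text \<open>The local factor is an exponential, so its logarithmic derivative is the derivative of
  the local logarithm; the chain rule through z = p^(-w) gives - log p times z d/dz.\<close>

lemma logderiv_ps:
  assumes s: "1 \<le> s"
  shows "deriv (local_factor (b j) (nth_prime m)) (loc_arg m s t) / local_factor (b j) (nth_prime m) (loc_arg m s t)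
     = - of_real (ln (real (nth_prime m))) * ps (cf j m) 1 (zz m s * cis (- (2 * pi * t)))"
proof -
  let ?w = "loc_arg m s t" and ?q = "nth_prime m"
  let ?z = "\<lambda>w. of_nat ?q powr - w :: complex"
  have w: "Re ?w > 1 / 2 - 2 * \<eta>" using s \<eta> by (simp add: loc_arg_def)
  obtain D where D: "(ps (cf j m) 0 has_field_derivative D) (at (?z ?w))" "?z ?w * D = ps (cf j m) (Suc 0) (?z ?w)"
    by (rule ps_has_derivative[OF summable_norm_cancel[OF cf_conv[OF cf_bound]] log_local_factor_ps(2)[OF w], where r = 0])
  have ze: "?z w = exp (- w * of_real (ln (real ?q)))" for w
    using nth_prime_gt1[of m] by (simp add: powr_def Ln_of_nat)
  have "((\<lambda>w. exp (- w * of_real (ln (real ?q)))) has_field_derivative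
      (- of_real (ln (real ?q)) * exp (- ?w * of_real (ln (real ?q))))) (at ?w)"
    by (auto intro!: derivative_eq_intros)
  then have "(?z has_field_derivative (- of_real (ln (real ?q)) * ?z ?w)) (at ?w)"
    by (simp only: ze)
  note DERIV_chain2[OF D(1) this]
  moreover have "D * (- of_real (ln (real ?q)) * ?z ?w) = - of_real (ln (real ?q)) * (?z ?w * D)"
    by (simp only: mult_ac)
  ultimately have "((\<lambda>w. ps (cf j m) 0 (?z w)) has_field_derivative (- of_real (ln (real ?q)) * ps (cf j m) 1 (?z ?w))) (at ?w)"
    unfolding D(2) One_nat_def by (simp only:)
  then have "(log_local_factor (b j) ?q has_field_derivative (- of_real (ln (real ?q)) * ps (cf j m) 1 (?z ?w))) (at ?w)"
    by (rule has_field_derivative_transform_within_open[OF _ open_halfspace_Re_gt[of "1 / 2 - 2 * \<eta>"]])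
       (use w in \<open>auto simp: log_local_factor_ps\<close>)
  then have "(local_factor (b j) ?q has_field_derivative
      exp (log_local_factor (b j) ?q ?w) * (- of_real (ln (real ?q)) * ps (cf j m) 1 (?z ?w))) (at ?w)"
    unfolding local_factor_def[abs_def] by (auto intro!: derivative_eq_intros)
  then show ?thesis unfolding powr_loc_arg[symmetric] by (simp add: DERIV_imp_deriv local_factor_def)
qed

lemma log_loc_ps:
  assumes "1 \<le> s"
  shows "log_loc b m s t $ j = ps (cf j m) 0 (zz m s * cis (- (2 * pi * t)))"
proof -
  have "Re (loc_arg m s t) > 1 / 2 - 2 * \<eta>" using assms \<eta> by (simp add: loc_arg_def)
  from log_local_factor_ps(1)[OF this, of j] show ?thesis by (simp add: log_loc_def powr_loc_arg)
qed

lemma norm_zz_cis: "norm (zz m s * cis x) = norm (zz m s)" by (simp add: norm_mult)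

text \<open>A joint bound for local logarithms and local weights: \<open>CARD('n)\<close> accounts
  for the sum over components, 2 for the entries of w, and p^\<eta> / \<eta> for log p.\<close>

definition W :: "nat \<Rightarrow> real" where
  "W m = real CARD('n) * 2 * C * T0 * (1 + 1 / \<eta>) * real (nth_prime m) powr (- 1 / 2 - \<eta>)"

lemma W_aux:
  fixes m
  defines "q \<equiv> real (nth_prime m)"
  shows "real CARD('n) * (C * q powr (- 1 / 2 - 2 * \<eta>) * T0) \<le> W m"
    "real CARD('n) * (2 * (ln q * (C * q powr (- 1 / 2 - 2 * \<eta>) * T0))) \<le> W m"
proof -
  have q: "1 < q" unfolding q_def by (rule nth_prime_gt1)
  have p: "q powr \<eta> * q powr (- 1 / 2 - 2 * \<eta>) = q powr (- 1 / 2 - \<eta>)"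
    unfolding powr_add[symmetric] by (rule arg_cong[where f = "\<lambda>a. q powr a"]) simp
  have l: "ln q \<le> q powr \<eta> / \<eta>" using q \<eta> by (intro ln_powr_bound) auto
  have one: "1 \<le> q powr \<eta>" using q \<eta> by (simp add: ge_one_powr_ge_zero)
  have A: "2 * a * (C * q powr (- 1 / 2 - 2 * \<eta>) * T0) \<le> 2 * C * T0 * (1 + 1 / \<eta>) * q powr (- 1 / 2 - \<eta>)"
    if "a \<le> q powr \<eta> * (1 + 1 / \<eta>)" for a
  proof -
    have "a * (q powr (- 1 / 2 - 2 * \<eta>) * (2 * C * T0)) \<le> (q powr \<eta> * (1 + 1 / \<eta>)) * (q powr (- 1 / 2 - 2 * \<eta>) * (2 * C * T0))"
      using that C T0_pos by (intro mult_right_mono) auto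
    also have "\<dots> = (q powr \<eta> * q powr (- 1 / 2 - 2 * \<eta>)) * (2 * C * T0 * (1 + 1 / \<eta>))" by (simp only: mult_ac)
    finally show ?thesis unfolding p by (simp only: mult_ac)
  qed
  have "q powr \<eta> * (1 + 1 / \<eta>) = q powr \<eta> + q powr \<eta> / \<eta>" by (simp add: algebra_simps)
  then have a1: "1 \<le> q powr \<eta> * (1 + 1 / \<eta>)" "ln q \<le> q powr \<eta> * (1 + 1 / \<eta>)"
    using one l \<eta> by (auto intro: add_increasing2 add_increasing)
  have Weq: "W m = real CARD('n) * (2 * C * T0 * (1 + 1 / \<eta>) * q powr (- 1 / 2 - \<eta>))"
    unfolding W_def q_def by (simp only: mult_ac)
  have "C * q powr (- 1 / 2 - 2 * \<eta>) * T0 \<le> 2 * 1 * (C * q powr (- 1 / 2 - 2 * \<eta>) * T0)"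
    using C T0_pos by simp
  also note A[OF a1(1)]
  finally show "real CARD('n) * (C * q powr (- 1 / 2 - 2 * \<eta>) * T0) \<le> W m"
    unfolding Weq by (intro mult_left_mono) auto
  show "real CARD('n) * (2 * (ln q * (C * q powr (- 1 / 2 - 2 * \<eta>) * T0))) \<le> W m"
    unfolding Weq using A[OF a1(2)] by (intro mult_left_mono) (auto simp only: mult.assoc of_nat_0_le_iff)
qed

text \<open>(W m)^2 is a constant times p^(-1 - 2\<eta>), and the prime of index m is at least
  m.\<close>

lemma summable_W: "summable (\<lambda>m. (W m)\<^sup>2)"
proof -
  define k where "k = real CARD('n) * 2 * C * T0 * (1 + 1 / \<eta>)"
  have "summable (\<lambda>m. k\<^sup>2 * real m powr (- 1 - 2 * \<eta>))"
    using \<eta> by (intro summable_mult) (simp add: summable_real_powr_iff)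
  then show ?thesis
  proof (rule summable_comparison_test'[where N = 1])
    fix m :: nat assume m: "1 \<le> m"
    have "(W m)\<^sup>2 = k\<^sup>2 * real (nth_prime m) powr (- 1 - 2 * \<eta>)"
      unfolding W_def k_def[symmetric] power_mult_distrib
      by (simp add: power2_eq_square powr_add[symmetric])
    also have "\<dots> \<le> k\<^sup>2 * real m powr (- 1 - 2 * \<eta>)"
      using m nth_prime_ge[of m] \<eta> by (intro mult_left_mono powr_mono2') auto
    finally show "norm ((W m)\<^sup>2) \<le> k\<^sup>2 * real m powr (- 1 - 2 * \<eta>)" by simp
  qed
qed

lemma continuous_ps_zz:
  assumes c: "\<And>k. norm (c k) \<le> B * Rq m ^ k"
  shows "continuous_on ({1..} \<times> UNIV) (\<lambda>(s, t). ps c r (zz m s * cis (- (2 * pi * t))))"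
proof -
  have "continuous_on ({1..} \<times> (UNIV :: real set)) (\<lambda>x. ps c r (zz m (fst x) * cis (- (2 * pi * snd x))))"
  proof (rule continuous_on_compose2[OF continuous_on_ps[of "1 / Rq m"]])
    show "summable (\<lambda>k. c k * z ^ k)" if "norm z < 1 / Rq m" for z
      by (rule summable_norm_cancel[OF cf_conv[OF c that]])
    show "continuous_on ({1..} \<times> UNIV) (\<lambda>x. zz m (fst x) * cis (- (2 * pi * snd x)))"
      unfolding zz_def using nth_prime_gt1[of m] by (intro continuous_intros) auto
  qed (auto simp: norm_mult zz_lt)
  then show ?thesis by (simp add: split_def)
qed

lemma continuous_ps_t:
  assumes c: "\<And>k. norm (c k) \<le> B * Rq m ^ k" and s: "1 \<le> s"
  shows "continuous_on A (\<lambda>t. ps c r (zz m s * cis (- (2 * pi * t))))"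
proof -
  have "continuous_on A (\<lambda>t. (s, t))" by (intro continuous_intros)
  from continuous_on_compose2[OF continuous_ps_zz[OF c] this] s show ?thesis by auto
qed

lemma ps_mean:
  assumes c: "\<And>k. norm (c k) \<le> B * Rq m ^ k" and c0: "c 0 = 0" and s: "1 \<le> s"
  shows "(\<integral>t. ps c r (zz m s * cis (- (2 * pi * t))) \<partial>unit_interval) = 0"
  unfolding integral_unit_interval_eq[OF continuous_ps_t[OF c s]]
  by (rule ps_circle_mean[OF cf_conv[OF c] zz_lt(1)[OF s] c0])

text \<open>The mean zero conditions hold because the local series have no constant term; continuity
  and bounds come from convergence on a disc that contains all the circles with s \<ge> 1.\<close>

lemma torus_loc:
  assumes w: "\<And>j. norm (w j) \<le> 2"
  shows "torus (log_loc b) (logderiv_loc b w) W"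
proof
  fix m
  have lv: "logderiv_loc b w m s t = (\<Sum>j\<in>UNIV. w j * (- of_real (ln (real (nth_prime m))) * ps (cf j m) 1 (zz m s * cis (- (2 * pi * t)))))"
    if "1 \<le> s" for s t
    unfolding logderiv_loc_def using logderiv_ps[OF that] by simp
  have lu: "log_loc b m s t = (\<chi> j. ps (cf j m) 0 (zz m s * cis (- (2 * pi * t))))" if "1 \<le> s" for s t
    using log_loc_ps[OF that] by (simp add: vec_eq_iff)
  have cu: "continuous_on ({1..} \<times> UNIV) (\<lambda>x. (\<chi> j. ps (cf j m) 0 (zz m (fst x) * cis (- (2 * pi * snd x)))))"
    using continuous_ps_zz[OF cf_bound] by (intro continuous_on_vec_lambda) (simp add: split_def)
  show "continuous_on ({1..} \<times> UNIV) (\<lambda>(s, t). log_loc b m s t)"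
    using cu by (rule continuous_on_eq) (auto simp: lu)
  have cv: "continuous_on ({1..} \<times> UNIV) (\<lambda>x. \<Sum>j\<in>UNIV. w j * (- of_real (ln (real (nth_prime m))) * ps (cf j m) 1 (zz m (fst x) * cis (- (2 * pi * snd x)))))"
    using continuous_ps_zz[OF cf_bound] by (intro continuous_intros) (simp add: split_def)
  show "continuous_on ({1..} \<times> UNIV) (\<lambda>(s, t). logderiv_loc b w m s t)"
    using cv by (rule continuous_on_eq) (auto simp: lv)
  show "summable (\<lambda>m. (W m)\<^sup>2)" by (rule summable_W)
  fix s :: real assume s: "1 \<le> s"
  let ?q = "real (nth_prime m)" and ?z = "\<lambda>t. zz m s * cis (- (2 * pi * t))"
  let ?B = "C * ?q powr (- 1 / 2 - 2 * \<eta>) * T0"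
  show "norm (log_loc b m s t) \<le> W m" for t
  proof -
    have "norm (log_loc b m s t) \<le> (\<Sum>j\<in>UNIV. norm (log_loc b m s t $ j))"
      unfolding norm_vec_def by (rule L2_set_le_sum) auto
    also have "\<dots> \<le> (\<Sum>j\<in>(UNIV::'n set). ?B)"
      unfolding log_loc_ps[OF s] by (intro sum_mono ps_bound[OF s] norm_zz_cis) auto
    also have "\<dots> \<le> W m" using W_aux(1)[of m] by simp
    finally show ?thesis .
  qed
  show "norm (logderiv_loc b w m s t) \<le> W m" for t
  proof -
    have "norm (logderiv_loc b w m s t) \<le> (\<Sum>j\<in>(UNIV::'n set). 2 * (ln ?q * ?B))"
      unfolding lv[OF s]
    proof (rule sum_norm_le)
      fix j
      have "norm (w j * (- of_real (ln ?q) * ps (cf j m) 1 (?z t))) = norm (w j) * (ln ?q * norm (ps (cf j m) 1 (?z t)))"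
        using nth_prime_gt1[of m] by (simp add: norm_mult)
      also have "\<dots> \<le> 2 * (ln ?q * ?B)"
        using nth_prime_gt1[of m] w by (intro mult_mono ps_bound[OF s] norm_zz_cis mult_nonneg_nonneg) auto
      finally show "norm (w j * (- of_real (ln ?q) * ps (cf j m) 1 (?z t))) \<le> 2 * (ln ?q * ?B)" .
    qed
    also have "\<dots> \<le> W m" using W_aux(2)[of m] by simp
    finally show ?thesis .
  qed
  have ip: "integrable unit_interval (\<lambda>t. ps (cf j m) r (?z t))" if "r \<le> 3" for j r
    by (rule unit_interval.integrable_const_bound[where B = ?B])
       (use ps_bound[OF s that norm_zz_cis] in \<open>auto intro!: borel_measurable_unit_interval borel_measurable_continuous_onI continuous_ps_t[OF cf_bound s]\<close>)
  have mean: "(\<integral>t. ps (cf j m) r (?z t) \<partial>unit_interval) = 0" for j r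
    by (rule ps_mean[OF cf_bound _ s]) (simp add: cf_def)
  show "(\<integral>t. logderiv_loc b w m s t \<partial>unit_interval) = 0"
    unfolding lv[OF s] by (subst Bochner_Integration.integral_sum) (auto intro!: integrable_mult_right ip simp: mean)
  show "(\<integral>t. log_loc b m s t \<partial>unit_interval) = 0"
  proof -
    have iu: "integrable unit_interval (log_loc b m s)"
    proof (rule unit_interval.integrable_const_bound[where B = "W m"])
      have "continuous_on UNIV (\<lambda>t. \<chi> j. ps (cf j m) 0 (?z t))"
        by (intro continuous_on_vec_lambda continuous_ps_t[OF cf_bound s])
      then show "log_loc b m s \<in> borel_measurable unit_interval"
        unfolding lu[OF s, abs_def] by (intro borel_measurable_unit_interval borel_measurable_continuous_onI)
    qed (use \<open>\<And>t. norm (log_loc b m s t) \<le> W m\<close> in auto)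
    have "(\<integral>t. log_loc b m s t \<partial>unit_interval) $ j = (\<integral>t. log_loc b m s t $ j \<partial>unit_interval)" for j
      by (rule integral_bounded_linear[OF bounded_linear_vec_nth iu, symmetric])
    also have "(\<integral>t. log_loc b m s t $ j \<partial>unit_interval) = 0" for j unfolding log_loc_ps[OF s] by (rule mean)
    finally show ?thesis by (simp add: vec_eq_iff)
  qed
qed

section \<open>Good primes and their decay\<close>

text \<open>The real inner product of y and x is the real part of the sum of cnj (y j) x j, whence
  the conjugate; \<open>beta\<close> is the coefficient of z in the resulting power series.\<close>

definition beta :: "nat \<Rightarrow> complex ^ 'n \<Rightarrow> complex" where
  "beta m y = (\<Sum>j\<in>UNIV. cnj (y $ j) * b j (nth_prime m))"

text \<open>The terms beyond the linear one are at most a constant times |y| p^(-4\<eta> - s). Half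
  of the gain 4\<eta> goes into the threshold for the linear coefficient; by the second condition
  the other half makes these terms at most an eighth of the linear one. Neither s nor the weight
  enters, and strictness makes the condition open in y.\<close>

definition good :: "nat \<Rightarrow> complex ^ 'n \<Rightarrow> bool" where
  "good m y \<longleftrightarrow> norm y * real (nth_prime m) powr (- 2 * \<eta>) < norm (beta m y) \<and>
     8 * real CARD('n) * C * T0 * real (nth_prime m) powr (- 2 * \<eta>) \<le> 1"

definition C0 :: real where "C0 = (2 * (2 * pi) ^ 3 + 1) * (4 * (2 * pi) ^ 3 + 1)"

text \<open>Inserting the threshold into \<open>circle_decay\<close> costs the power p^(\<eta> +
  s/2), which is harmless as only finitely many primes will be used.\<close>

lemma good_decay:
  assumes s: "1 \<le> s" and g: "good m y" and y: "y \<noteq> 0"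
  shows "norm (\<integral>t. cis (y \<bullet> log_loc b m s t) \<partial>unit_interval) \<le> C0 * real (nth_prime m) powr (\<eta> + s / 2) / sqrt (norm y)"
proof -
  let ?q = "real (nth_prime m)" and ?z = "\<lambda>t. zz m s * cis (- (2 * pi * t))"
  have q: "1 < ?q" "0 < ?q" using nth_prime_gt1[of m] by auto
  define c where "c k = (\<Sum>j\<in>UNIV. cnj (y $ j) * cf j m k)" for k
  define B where "B = real CARD('n) * norm y * C"
  have B0: "0 \<le> B" unfolding B_def using C by simp
  have cb: "norm (c k) \<le> B * Rq m ^ k" for k
  proof -
    have "norm (c k) \<le> (\<Sum>j\<in>(UNIV::'n set). norm y * (C * Rq m ^ k))"
      unfolding c_def
    proof (rule sum_norm_le)
      show "norm (cnj (y $ j) * cf j m k) \<le> norm y * (C * Rq m ^ k)" for j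
        unfolding norm_mult complex_mod_cnj by (intro mult_mono cf_bound Finite_Cartesian_Product.norm_nth_le) auto
    qed
    then show ?thesis by (simp add: B_def mult_ac)
  qed
  have c1: "c 1 = beta m y" by (simp add: c_def beta_def cf_def)
  have c0: "c 0 = 0" by (simp add: c_def cf_def)
  have inner: "y \<bullet> log_loc b m s t = Re (ps c 0 (?z t))" for t
  proof -
    have lt: "norm (?z t) < 1 / Rq m" unfolding norm_zz_cis by (rule zz_lt(1)[OF s])
    have sm: "summable (\<lambda>k. cf j m k * ?z t ^ k)" for j
      by (rule summable_norm_cancel[OF cf_conv[OF cf_bound lt]])
    have "ps c 0 (?z t) = (\<Sum>k. \<Sum>j\<in>UNIV. cnj (y $ j) * (cf j m k * ?z t ^ k))"
      unfolding ps_def c_def by (simp add: sum_distrib_right mult.assoc)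
    also have "\<dots> = (\<Sum>j\<in>UNIV. \<Sum>k. cnj (y $ j) * (cf j m k * ?z t ^ k))"
      by (rule suminf_sum) (intro summable_mult sm)
    also have "\<dots> = (\<Sum>j\<in>UNIV. cnj (y $ j) * ps (cf j m) 0 (?z t))"
      unfolding ps_def using suminf_mult[OF sm] by simp
    finally have e: "ps c 0 (?z t) = (\<Sum>j\<in>UNIV. cnj (y $ j) * ps (cf j m) 0 (?z t))" .
    show ?thesis unfolding inner_vec_def log_loc_ps[OF s] e by (simp add: inner_complex_def)
  qed
  have g1: "norm y * ?q powr (- 2 * \<eta>) < norm (beta m y)" and g2: "8 * real CARD('n) * C * T0 * ?q powr (- 2 * \<eta>) \<le> 1"
    using g by (auto simp: good_def)
  have nz: "norm (zz m s) = ?q powr - s" by (simp add: zz_def)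
  have A: "norm y * ?q powr (- 2 * \<eta> - s) \<le> norm (c 1 * zz m s)"
  proof -
    have "norm y * ?q powr (- 2 * \<eta> - s) = (norm y * ?q powr (- 2 * \<eta>)) * ?q powr - s"
      by (simp add: powr_add[symmetric])
    also have "\<dots> \<le> norm (beta m y) * ?q powr - s" using g1 by (intro mult_right_mono) auto
    finally show ?thesis by (simp add: norm_mult nz c1[simplified])
  qed
  have A0: "0 < norm y * ?q powr (- 2 * \<eta> - s)" using y q by simp
  have tail: "(\<Sum>k. real (k + 2) ^ 3 * norm (c (k + 2) * zz m s ^ (k + 2))) \<le> norm (c 1 * zz m s) / 8"
  proof -
    have "(\<Sum>k. real (k + 2) ^ 3 * norm (c (k + 2) * zz m s ^ (k + 2))) \<le> B * (Rq m * norm (zz m s)) ^ 2 * T0"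
      by (rule tail_bound(2)[OF cb s B0])
    also have "(Rq m * norm (zz m s)) ^ 2 = ?q powr (1 - 4 * \<eta> - 2 * s)"
      unfolding zz_lt(4)[OF s] power2_eq_square powr_add[symmetric]
      by (rule arg_cong[where f = "\<lambda>a. ?q powr a"]) simp
    \<comment> \<open>1 - 2 s \<le> - s is the condition s \<ge> 1.\<close>
    also have "\<dots> \<le> ?q powr (- 4 * \<eta> - s)" using q s by (intro powr_mono) auto
    then have "B * ?q powr (1 - 4 * \<eta> - 2 * s) * T0 \<le> B * ?q powr (- 4 * \<eta> - s) * T0"
      using B0 T0_pos by (intro mult_right_mono mult_left_mono) auto
    also have "\<dots> = (8 * real CARD('n) * C * T0 * ?q powr (- 2 * \<eta>)) * (norm y * ?q powr (- 2 * \<eta> - s)) / 8"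
      by (simp add: B_def powr_add[symmetric])
    also have "\<dots> \<le> 1 * (norm y * ?q powr (- 2 * \<eta> - s)) / 8"
      using g2 A0 by (intro divide_right_mono mult_right_mono) auto
    also have "\<dots> \<le> norm (c 1 * zz m s) / 8" using A by simp
    finally show ?thesis .
  qed
  have "(\<integral>t. cis (y \<bullet> log_loc b m s t) \<partial>unit_interval) = integral {0..1} (\<lambda>t. cis (Re (ps c 0 (?z t))))"
    unfolding inner by (rule integral_unit_interval_eq) (intro continuous_intros continuous_ps_t[OF cb s])
  also have "norm \<dots> \<le> C0 / sqrt (norm (c 1 * zz m s))"
    unfolding C0_def
  proof (rule circle_decay[of "1 / Rq m"])
    show "summable (\<lambda>k. c k * z ^ k)" if "norm z < 1 / Rq m" for z
      by (rule summable_norm_cancel[OF cf_conv[OF cb that]])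
    show "0 < norm (c 1 * zz m s)" using A A0 by linarith
  qed (rule zz_lt(1)[OF s] c0 tail tail_bound(1)[OF cb s B0])+
  also have "\<dots> \<le> C0 / sqrt (norm y * ?q powr (- 2 * \<eta> - s))"
    using A A0 unfolding C0_def by (intro divide_left_mono real_sqrt_le_mono mult_pos_pos) auto
  also have "\<dots> = C0 * ?q powr (\<eta> + s / 2) / sqrt (norm y)"
  proof -
    have "sqrt (?q powr (- 2 * \<eta> - s)) = ?q powr (- (\<eta> + s / 2))"
      using q by (simp add: powr_half_sqrt[symmetric] powr_powr algebra_simps add_divide_distrib)
    then show ?thesis by (simp add: real_sqrt_mult powr_minus field_simps)
  qed
  finally show ?thesis .
qed

end

section \<open>Nondegenerate primes\<close>

context euler_coeffs
begin

text \<open>With only finitely many good indices, |beta|^2 / p would be at most |y|^2 p^(-1 -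
  4\<eta>) from some point on, hence summable. By orthogonality, however, the sums over p \<le> x
  grow like c log log x, where c > 0 is the sum of |y_i|^2 m_(i,i); the mixed terms are of smaller
  order.\<close>

lemma many_good:
  assumes orth: "orthogonal_coeffs a" and ab: "\<And>j p. prime p \<Longrightarrow> a j p = b j p" and y: "y \<noteq> 0"
  shows "infinite {m. good m y}"
proof
  assume fin: "finite {m. good m y}"
  let ?q = "\<lambda>m. real (nth_prime m)"
  have "(\<lambda>m. 8 * real CARD('n) * C * T0 * real m powr (- 2 * \<eta>)) \<longlonglongrightarrow> 8 * real CARD('n) * C * T0 * 0"
    using \<eta> by (intro tendsto_intros tendsto_neg_powr filterlim_real_sequentially) auto
  then have "\<forall>\<^sub>F m in sequentially. 8 * real CARD('n) * C * T0 * real m powr (- 2 * \<eta>) < 1"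
    by (rule order_tendstoD(2)) simp
  \<comment> \<open>From M1 on the second condition of \<open>good\<close> holds automatically, so a
    bad index must miss the threshold.\<close>
  then obtain M1 where M1: "\<And>m. m \<ge> M1 \<Longrightarrow> 8 * real CARD('n) * C * T0 * real m powr (- 2 * \<eta>) < 1"
    by (auto simp: eventually_sequentially)
  obtain M2 where M2: "\<And>m. good m y \<Longrightarrow> m < M2" using fin finite_nat_set_iff_bounded by auto
  define f where "f m = (norm (beta m y))\<^sup>2 / ?q m" for m
  have f0: "0 \<le> f m" for m by (simp add: f_def)
  have fb: "f m \<le> (norm y)\<^sup>2 * real m powr (- 1 - 4 * \<eta>)" if m: "m \<ge> max 1 (max M1 M2)" for m
  proof -
    have q: "real m \<le> ?q m" "0 < ?q m" "1 \<le> real m" using nth_prime_ge[of m] nth_prime_gt1[of m] m by auto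
    have "?q m powr (- 2 * \<eta>) \<le> real m powr (- 2 * \<eta>)" using q \<eta> by (intro powr_mono2') auto
    then have "8 * real CARD('n) * C * T0 * ?q m powr (- 2 * \<eta>) \<le> 8 * real CARD('n) * C * T0 * real m powr (- 2 * \<eta>)"
      using C T0_pos by (intro mult_left_mono) auto
    also have "\<dots> < 1" using M1 m by simp
    finally have "norm (beta m y) \<le> norm y * ?q m powr (- 2 * \<eta>)"
      using M2[of m] m unfolding good_def by force
    then have "(norm (beta m y))\<^sup>2 \<le> (norm y * ?q m powr (- 2 * \<eta>))\<^sup>2" by (intro power_mono) auto
    also have "\<dots> = (norm y)\<^sup>2 * ?q m powr (- 4 * \<eta>)"
      by (simp add: power_mult_distrib power2_eq_square[of "?q m powr _"] powr_add[symmetric])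
    finally have "f m \<le> (norm y)\<^sup>2 * ?q m powr (- 4 * \<eta>) / ?q m"
      unfolding f_def using q by (intro divide_right_mono) auto
    also have "\<dots> = (norm y)\<^sup>2 * ?q m powr (- 4 * \<eta> - 1)"
      using q by (simp add: powr_diff)
    also have "\<dots> \<le> (norm y)\<^sup>2 * real m powr (- 4 * \<eta> - 1)"
      using q \<eta> by (intro mult_left_mono powr_mono2') auto
    finally have "f m \<le> (norm y)\<^sup>2 * real m powr (- 4 * \<eta> - 1)" .
    moreover have "- 4 * \<eta> - 1 = - 1 - 4 * \<eta>" by simp
    ultimately show ?thesis by (simp only:)
  qed
  have sf: "summable f"
  proof (rule summable_comparison_test'[where N = "max 1 (max M1 M2)"])
    show "summable (\<lambda>m. (norm y)\<^sup>2 * real m powr (- 1 - 4 * \<eta>))"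
      using \<eta> by (intro summable_mult) (simp add: summable_real_powr_iff)
  qed (use fb f0 in auto)
  define A where "A i j x = (\<Sum>p | prime p \<and> real p \<le> x. a i p * cnj (a j p) / of_nat p)" for i j x
  \<comment> \<open>The Hermitian form in y with matrix \<open>A\<close>; it equals the sum of
    |beta|^2 / p over the primes up to x.\<close>
  define S where "S x = (\<Sum>i\<in>UNIV. \<Sum>j\<in>UNIV. cnj (y $ i) * (y $ j) * A i j x)" for x
  define L where "L x = ln (ln (x::real))" for x
  obtain mm :: "'n \<Rightarrow> 'n \<Rightarrow> real" where mm: "\<And>i. mm i i > 0" "\<And>i j. i \<noteq> j \<Longrightarrow> mm i j = 0"
    "\<And>i j. (\<lambda>x. A i j x - of_real (mm i j * L x)) \<in> o[at_top](\<lambda>x. of_real (L x))"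
    using orth unfolding orthogonal_coeffs_def A_def L_def by blast
  have Linf: "filterlim L at_top at_top"
    unfolding L_def by (rule filterlim_compose[OF ln_at_top ln_at_top])
  then have L0: "\<forall>\<^sub>F x in at_top. 0 < L x" by (simp add: filterlim_at_top_dense)
  have A_lim: "((\<lambda>x. A i j x / of_real (L x)) \<longlongrightarrow> of_real (mm i j)) at_top" for i j
  proof -
    have "((\<lambda>x. (A i j x - of_real (mm i j * L x)) / of_real (L x) + of_real (mm i j)) \<longlongrightarrow> 0 + of_real (mm i j)) at_top"
      by (intro tendsto_add tendsto_const smalloD_tendsto mm)
    then have *: "((\<lambda>x. (A i j x - of_real (mm i j * L x)) / of_real (L x) + of_real (mm i j)) \<longlongrightarrow> of_real (mm i j)) at_top" by simp
    show ?thesis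
      by (rule Lim_transform_eventually[OF *]) (use L0 in eventually_elim, simp add: field_simps)
  qed
  define c where "c = (\<Sum>i\<in>UNIV. (norm (y $ i))\<^sup>2 * mm i i)"
  have "((\<lambda>x. \<Sum>i\<in>UNIV. \<Sum>j\<in>UNIV. cnj (y $ i) * (y $ j) * (A i j x / of_real (L x))) \<longlongrightarrow>
      (\<Sum>i\<in>UNIV. \<Sum>j\<in>UNIV. cnj (y $ i) * (y $ j) * of_real (mm i j))) at_top"
    by (intro tendsto_intros A_lim)
  also have "(\<Sum>i\<in>UNIV. \<Sum>j\<in>UNIV. cnj (y $ i) * (y $ j) * of_real (mm i j)) = of_real c"
  proof -
    have "(\<Sum>j\<in>UNIV. cnj (y $ i) * (y $ j) * of_real (mm i j)) = of_real ((norm (y $ i))\<^sup>2 * mm i i)" for i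
    proof -
      have "(\<Sum>j\<in>UNIV. cnj (y $ i) * (y $ j) * of_real (mm i j)) = (\<Sum>j\<in>UNIV. if j = i then cnj (y $ i) * (y $ i) * of_real (mm i i) else 0)"
        using mm(2) by (intro sum.cong) auto
      then show ?thesis using complex_norm_square[of "y $ i"] by (simp add: mult_ac)
    qed
    then show ?thesis by (simp add: c_def)
  qed
  also have "(\<lambda>x. \<Sum>i\<in>UNIV. \<Sum>j\<in>UNIV. cnj (y $ i) * (y $ j) * (A i j x / of_real (L x))) = (\<lambda>x. S x / of_real (L x))"
    by (simp add: S_def sum_divide_distrib)
  finally have lim: "((\<lambda>x. S x / of_real (L x)) \<longlongrightarrow> of_real c) at_top" .
  have cpos: "c > 0"
  proof -
    obtain i where "y $ i \<noteq> 0" using y by (auto simp: vec_eq_iff)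
    then show ?thesis unfolding c_def using mm(1)
      by (intro sum_pos2[of _ i]) (auto simp: less_imp_le)
  qed
  have finp: "finite {p. prime p \<and> real p \<le> x}" for x
    by (rule finite_subset[of _ "{..nat \<lfloor>x\<rfloor>}"]) (auto simp: le_nat_floor)
  have S_eq: "S x = of_real (\<Sum>p | prime p \<and> real p \<le> x. (norm (\<Sum>i\<in>UNIV. cnj (y $ i) * b i p))\<^sup>2 / real p)" for x
  proof -
    have sq: "of_real ((norm (\<Sum>i\<in>UNIV. cnj (y $ i) * b i p))\<^sup>2 / real p)
       = (\<Sum>i\<in>UNIV. \<Sum>j\<in>UNIV. cnj (y $ i) * (y $ j) * (a i p * cnj (a j p) / of_nat p))" if "prime p" for p
      unfolding of_real_divide complex_norm_square cnj_sum sum_product sum_divide_distrib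
      using ab[OF that] by (intro sum.cong refl) (simp add: mult_ac)
    have "S x = (\<Sum>i\<in>UNIV. \<Sum>j\<in>UNIV. \<Sum>p | prime p \<and> real p \<le> x. cnj (y $ i) * (y $ j) * (a i p * cnj (a j p) / of_nat p))"
      unfolding S_def A_def by (simp only: sum_distrib_left)
    also have "\<dots> = (\<Sum>i\<in>UNIV. \<Sum>p | prime p \<and> real p \<le> x. \<Sum>j\<in>UNIV. cnj (y $ i) * (y $ j) * (a i p * cnj (a j p) / of_nat p))"
      by (rule sum.cong[OF refl], rule sum.swap)
    also have "\<dots> = (\<Sum>p | prime p \<and> real p \<le> x. \<Sum>i\<in>UNIV. \<Sum>j\<in>UNIV. cnj (y $ i) * (y $ j) * (a i p * cnj (a j p) / of_nat p))"
      by (rule sum.swap)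
    also have "\<dots> = (\<Sum>p | prime p \<and> real p \<le> x. of_real ((norm (\<Sum>i\<in>UNIV. cnj (y $ i) * b i p))\<^sup>2 / real p))"
      by (rule sum.cong[OF refl]) (simp only: sq mem_Collect_eq)
    finally show ?thesis by simp
  qed
  have Sb: "norm (S x) \<le> suminf f" for x
  proof -
    define I where "I = {m. real (nth_prime m) \<le> x}"
    have im: "{p. prime p \<and> real p \<le> x} = nth_prime ` I"
    proof -
      have "{p. prime p \<and> real p \<le> x} = range nth_prime \<inter> {p. real p \<le> x}"
        unfolding range_nth_prime by auto
      then show ?thesis by (auto simp: I_def)
    qed
    have inj: "inj_on nth_prime I" 
      by (intro inj_onI) (simp add: strict_mono_eq[OF strict_mono_nth_prime])
    have finI: "finite I" 
      by (rule finite_imageD[OF _ inj]) (simp only: im[symmetric] finp)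
    have "(\<Sum>p | prime p \<and> real p \<le> x. (norm (\<Sum>i\<in>UNIV. cnj (y $ i) * b i p))\<^sup>2 / real p) = sum f I"
      unfolding im by (subst sum.reindex[OF inj]) (simp add: f_def beta_def)
    moreover have "sum f I \<le> suminf f" by (rule sum_le_suminf[OF sf finI]) (use f0 in auto)
    moreover have "0 \<le> sum f I" by (intro sum_nonneg f0)
    ultimately show ?thesis unfolding S_eq norm_of_real by linarith
  qed
  have "((\<lambda>x. S x / of_real (L x)) \<longlongrightarrow> 0) at_top"
  proof (rule Lim_null_comparison)
    show "\<forall>\<^sub>F x in at_top. norm (S x / of_real (L x)) \<le> suminf f / L x"
      using L0 by eventually_elim (use Sb in \<open>auto simp: norm_divide intro!: divide_right_mono\<close>)
    show "((\<lambda>x. suminf f / L x) \<longlongrightarrow> 0) at_top"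
      by (rule tendsto_divide_0[OF tendsto_const filterlim_at_top_imp_at_infinity[OF Linf]])
  qed
  then have "complex_of_real c = 0" using lim tendsto_unique[OF trivial_limit_at_top_linorder] by blast
  then show False using cpos by simp
qed

lemma beta_scaleR: "beta m (c *\<^sub>R y) = of_real c * beta m y"
proof -
  have "cnj ((c *\<^sub>R y) $ j) * b j (nth_prime m) = of_real c * (cnj (y $ j) * b j (nth_prime m))" for j
    by (simp add: scaleR_conv_of_real[of c "y $ j"])
  then show ?thesis unfolding beta_def by (simp only: sum_distrib_left)
qed

lemma open_good: "open {y. good m y}"
  unfolding good_def beta_def by (intro open_Collect_conj open_Collect_less open_Collect_const continuous_intros)

text \<open>Each finite set of r indices imposes an open condition on y, so finitely many sets cover
  the unit sphere, and N bounds all their elements. Positive scaling of y preserves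
  \<open>good\<close>, which extends the claim to every y \<noteq> 0.\<close>

lemma uniform_good:
  assumes inf: "\<And>y. y \<noteq> 0 \<Longrightarrow> infinite {m. good m y}"
  shows "\<exists>N. \<forall>y. y \<noteq> 0 \<longrightarrow> (\<exists>G\<subseteq>{..<N}. card G = r \<and> (\<forall>m\<in>G. good m y))"
proof -
  define T where "T = {G :: nat set. finite G \<and> card G = r}"
  define U where "U G = {y. \<forall>m\<in>G. good m y}" for G
  have "sphere 0 1 \<subseteq> (\<Union>G\<in>T. U G)"
  proof
    fix y :: "complex ^ 'n" assume "y \<in> sphere 0 1"
    then have "y \<noteq> 0" by auto
    then obtain G where "finite G" "card G = r" "G \<subseteq> {m. good m y}"
      using infinite_arbitrarily_large[OF inf] by blast
    then show "y \<in> (\<Union>G\<in>T. U G)" by (auto simp: T_def U_def)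
  qed
  moreover have "open (U G)" if "G \<in> T" for G
  proof -
    have "U G = (\<Inter>m\<in>G. {y. good m y})" by (auto simp: U_def)
    then show ?thesis using that open_good by (auto simp: T_def)
  qed
  ultimately obtain T' where T': "T' \<subseteq> T" "finite T'" "sphere 0 1 \<subseteq> (\<Union>G\<in>T'. U G)"
    using compactE_image[OF compact_sphere[of "0 :: complex ^ 'n" 1], of T U] by metis
  have "finite (\<Union>T')" using T' by (auto simp: T_def)
  from finite_nat_set_iff_bounded[THEN iffD1, OF this] obtain N where "\<forall>n\<in>\<Union>T'. n < N" ..
  then have N: "\<Union>T' \<subseteq> {..<N}" by blast
  show ?thesis
  proof (intro exI[of _ N] allI impI)
    fix y :: "complex ^ 'n" assume y: "y \<noteq> 0"
    let ?y = "(1 / norm y) *\<^sub>R y"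
    have "?y \<in> sphere 0 1" using y by simp
    then obtain G where G: "G \<in> T'" "?y \<in> U G" using T'(3) by blast
    have "good m y" if "good m ?y" for m
    proof -
      have "norm (beta m ?y) = norm (beta m y) / norm y" unfolding beta_scaleR by (simp add: norm_mult norm_divide)
      moreover have "norm ?y = 1" using y by simp
      ultimately show ?thesis using that y by (simp add: good_def pos_less_divide_eq mult.commute)
    qed
    then show "\<exists>G\<subseteq>{..<N}. card G = r \<and> (\<forall>m\<in>G. good m y)"
      using G N T'(1) by (intro exI[of _ G]) (auto simp: U_def T_def)
  qed
qed

text \<open>Every member of \<open>G\<close> lies below \<open>nq q\<close>, so the prime of that
  index bounds the factor p^(\<eta> + s/2) for all of them.\<close>

lemma torus_decay_loc:
  fixes nq :: "nat \<Rightarrow> nat"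
  assumes w: "\<And>j. norm (w j) \<le> 2"
    and nq: "\<And>q (y :: complex ^ 'n). y \<noteq> 0 \<Longrightarrow> \<exists>G\<subseteq>{..<nq q}. 4 * DIM(complex ^ 'n) + 2 * q + 6 \<le> card G \<and> (\<forall>m\<in>G. good m y)"
  shows "torus_decay (log_loc b) (logderiv_loc b w) W nq (\<lambda>q s. C0 * real (nth_prime (nq q)) powr (\<eta> + s / 2))"
proof -
  interpret torus "log_loc b" "logderiv_loc b w" W by (rule torus_loc[OF w])
  have C0: "0 \<le> C0" by (simp add: C0_def)
  show ?thesis
  proof
    fix q and s s' :: real
    show "C0 * real (nth_prime (nq q)) powr (\<eta> + s / 2) \<le> C0 * real (nth_prime (nq q)) powr (\<eta> + s' / 2)" if "s \<le> s'"
      using that C0 nth_prime_gt1[of "nq q"] by (intro mult_left_mono powr_mono) auto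
    show "0 \<le> C0 * real (nth_prime (nq q)) powr (\<eta> + s / 2)" using C0 by simp
    fix y :: "complex ^ 'n" assume s: "1 \<le> s" and y: "y \<noteq> 0"
    obtain G where G: "G \<subseteq> {..<nq q}" "4 * DIM(complex ^ 'n) + 2 * q + 6 \<le> card G" "\<forall>m\<in>G. good m y"
      using nq[OF y] by blast
    have "norm (K m s y) \<le> C0 * real (nth_prime (nq q)) powr (\<eta> + s / 2) / sqrt (norm y)" if "m \<in> G" for m
    proof -
      have "nth_prime m \<le> nth_prime (nq q)"
        using G(1) that strict_mono_less_eq[OF strict_mono_nth_prime] by auto
      then have "real (nth_prime m) powr (\<eta> + s / 2) \<le> real (nth_prime (nq q)) powr (\<eta> + s / 2)"
        using \<eta> s nth_prime_gt1[of m] by (intro powr_mono2) auto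
      then have "C0 * real (nth_prime m) powr (\<eta> + s / 2) / sqrt (norm y) \<le> C0 * real (nth_prime (nq q)) powr (\<eta> + s / 2) / sqrt (norm y)"
        using C0 by (intro divide_right_mono mult_left_mono) auto
      moreover have "norm (K m s y) \<le> C0 * real (nth_prime m) powr (\<eta> + s / 2) / sqrt (norm y)"
        unfolding K_def using good_decay[OF s] G(3) that y by blast
      ultimately show ?thesis by linarith
    qed
    then show "\<exists>G\<subseteq>{..<nq q}. 4 * DIM(complex ^ 'n) + 2 * q + 6 \<le> card G \<and>
        (\<forall>m\<in>G. norm (K m s y) \<le> C0 * real (nth_prime (nq q)) powr (\<eta> + s / 2) / sqrt (norm y))"
      using G by blast
  qed
qed

end

section \<open>Application to the given functions and measures\<close>

text \<open>Finitely many exponents below 1/2 have a maximum \<theta> < 1/2, and \<eta> = min (1/8)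
  (1/4 - \<theta>/2) gives \<theta> \<le> 1/2 - 2\<eta>.\<close>

lemma euler_coeffs_exists:
  fixes F :: "'n::finite \<Rightarrow> complex \<Rightarrow> complex"
  assumes "\<And>j. log_euler_product (F j) (b j)"
  shows "\<exists>C \<eta>. euler_coeffs b C \<eta>"
proof -
  have "\<forall>j. \<exists>\<theta> C. \<theta> < 1 / 2 \<and> (\<forall>p k. prime p \<and> k \<ge> 1 \<longrightarrow> norm (b j (p ^ k)) \<le> C * real p powr (real k * \<theta>))"
    using assms unfolding log_euler_product_def by blast
  then obtain th C where th: "\<And>j. th j < 1 / 2"
    and C: "\<And>j p k. prime p \<Longrightarrow> k \<ge> 1 \<Longrightarrow> norm (b j (p ^ k)) \<le> C j * real p powr (real k * th j)"
    by metis
  define \<theta> where "\<theta> = Max (range th)"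
  have \<theta>: "\<theta> < 1 / 2" "\<And>j. th j \<le> \<theta>"
    unfolding \<theta>_def by (subst Max_less_iff) (use th in \<open>auto intro: Max_ge\<close>)
  define \<eta> where "\<eta> = min (1 / 8) (1 / 4 - \<theta> / 2)"
  have \<eta>: "0 < \<eta>" "\<eta> \<le> 1 / 8" "\<theta> \<le> 1 / 2 - 2 * \<eta>" 
  proof -
    have "\<eta> \<le> 1 / 4 - \<theta> / 2" unfolding \<eta>_def by (rule min.cobounded2)
    then show "\<theta> \<le> 1 / 2 - 2 * \<eta>" by linarith
    show "\<eta> \<le> 1 / 8" unfolding \<eta>_def by (rule min.cobounded1)
    show "0 < \<eta>" unfolding \<eta>_def using \<theta>(1) by simp
  qed
  define D where "D = 1 + (\<Sum>j\<in>UNIV. \<bar>C j\<bar>)"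
  have D0: "0 < D" unfolding D_def by (simp add: add_pos_nonneg sum_nonneg)
  have CD: "C j \<le> D" for j
    using member_le_sum[of j UNIV "\<lambda>j. \<bar>C j\<bar>"] unfolding D_def by auto
  have "euler_coeffs b D \<eta>"
  proof
    fix j and p k :: nat assume p: "prime p" and k: "1 \<le> k"
    have p1: "1 < real p" using prime_gt_1_nat[OF p] by simp
    have "norm (b j (p ^ k)) \<le> C j * real p powr (real k * th j)" by (rule C[OF p k])
    also have "\<dots> \<le> D * real p powr (real k * th j)" using CD by (intro mult_right_mono) auto
    also have "\<dots> \<le> D * real p powr (real k * (1 / 2 - 2 * \<eta>))"
      using p1 D0 order_trans[OF \<theta>(2) \<eta>(3)] by (intro mult_left_mono powr_mono) auto
    also have "real p powr (real k * (1 / 2 - 2 * \<eta>)) = (real p powr (1 / 2 - 2 * \<eta>)) ^ k"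
      using p1 by (simp add: powr_power mult.commute)
    finally show "norm (b j (p ^ k)) \<le> D * (real p powr (1 / 2 - 2 * \<eta>)) ^ k" .
  qed (use \<eta> D0 in auto)
  then show ?thesis by blast
qed

lemma log_trunc_eq: "log_trunc b n \<sigma> \<theta> = (\<Sum>m<n. log_loc b m \<sigma> (\<theta> m))"
  by (simp add: log_trunc_def log_loc_def vec_eq_iff shifted_arg_def loc_arg_def sum_component)

lemma logderiv_trunc_eq:
  "(\<Sum>j\<in>UNIV. w j * logderiv_trunc (b j) n \<sigma> \<theta>) = (\<Sum>m<n. logderiv_loc b w m \<sigma> (\<theta> m))"
  unfolding logderiv_trunc_def logderiv_loc_def shifted_arg_def loc_arg_def sum_distrib_left
  by (rule sum.swap)

text \<open>The thresholds come from \<open>good\<close>, which knows neither the weight nor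
  \<sigma>, so one sequence serves all measures at once. The density is the inverse transform of
  \<open>R n\<close>, taken for every n, also where nothing is claimed about it.\<close>

theorem theorem12:
  fixes F :: "'n::finite \<Rightarrow> complex \<Rightarrow> complex"
    and a b :: "'n \<Rightarrow> nat \<Rightarrow> complex"
  assumes "\<And>j. abs_conv_dirichlet_series (F j) (a j)"
    and "\<And>j. log_euler_product (F j) (b j)"
    and "orthogonal_coeffs a"
  shows "\<exists>nq :: nat \<Rightarrow> nat. mono nq \<and>
    (\<forall>lam \<in> {lam_single b j | j. True} \<union>
            {lam_pair b j l \<tau> | j l \<tau>. j \<noteq> l \<and> \<tau> \<in> {1, -1, \<i>, -\<i>}}.
     \<exists>(lam_lim :: real \<Rightarrow> (complex ^ 'n) measure)
      (G :: nat \<Rightarrow> real \<Rightarrow> complex ^ 'n \<Rightarrow> real)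
      (G_lim :: real \<Rightarrow> complex ^ 'n \<Rightarrow> real).
       (\<forall>q. \<forall>n\<ge>nq q. \<forall>\<sigma>\<ge>1. has_density (lam n \<sigma>) (G n \<sigma>) \<and> C_k q (G n \<sigma>)) \<and>
       (\<forall>\<sigma>\<ge>1. weakly_converges (\<lambda>n. lam n \<sigma>) (lam_lim \<sigma>) sequentially \<and>
               has_density (lam_lim \<sigma>) (G_lim \<sigma>) \<and> (\<forall>q. C_k q (G_lim \<sigma>))) \<and>
       (\<forall>\<sigma>\<ge>1. weakly_converges lam_lim (lam_lim \<sigma>) (at \<sigma> within {1..})) \<and>
       (\<forall>n\<ge>nq 0. \<forall>\<sigma>\<ge>1. weakly_converges (lam n) (lam n \<sigma>) (at \<sigma> within {1..})) \<and>
       (\<forall>vs x. set vs \<subseteq> Basis \<longrightarrow>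
          continuous_on {1..} (\<lambda>\<sigma>. partials vs (G_lim \<sigma>) x)) \<and>
       (\<forall>q. \<forall>n\<ge>nq q. \<forall>vs x. set vs \<subseteq> Basis \<and> length vs \<le> q \<longrightarrow>
          continuous_on {1..} (\<lambda>\<sigma>. partials vs (G n \<sigma>) x)))"
proof -
  obtain C \<eta> where "euler_coeffs b C \<eta>" using euler_coeffs_exists[of F b, OF assms(2)] by blast
  then interpret euler_coeffs b C \<eta> .
  have ab: "a j p = b j p" if "prime p" for j p
    by (rule coeff_prime_eq[OF assms(1,2) that])
  obtain N where N: "\<And>r (y :: complex ^ 'n). y \<noteq> 0 \<Longrightarrow> \<exists>G\<subseteq>{..<N r}. card G = r \<and> (\<forall>m\<in>G. good m y)"
    using uniform_good[OF many_good[OF assms(3) ab]] by metis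
  \<comment> \<open>Cumulative sums make the sequence monotone while keeping each term large
    enough.\<close>
  define nq where "nq q = (\<Sum>i\<le>q. N (4 * DIM(complex ^ 'n) + 2 * i + 6))" for q
  have mono: "mono nq"
    unfolding nq_def by (intro monoI sum_mono2) auto
  have nq: "\<exists>G\<subseteq>{..<nq q}. 4 * DIM(complex ^ 'n) + 2 * q + 6 \<le> card G \<and> (\<forall>m\<in>G. good m y)"
    if "y \<noteq> 0" for q and y :: "complex ^ 'n"
  proof -
    have "N (4 * DIM(complex ^ 'n) + 2 * q + 6) \<le> nq q"
      unfolding nq_def by (rule member_le_sum) auto
    then have "{..<N (4 * DIM(complex ^ 'n) + 2 * q + 6)} \<subseteq> {..<nq q}" by auto
    then show ?thesis using N[OF that, of "4 * DIM(complex ^ 'n) + 2 * q + 6"] by (metis order_refl subset_trans)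
  qed
  \<comment> \<open>Both kinds of measures are instances of one construction with a weight vector w
    of entries at most 2.\<close>
  have lam_cases: "\<exists>w. (\<forall>j. norm (w j) \<le> 2) \<and> lam = torus.lam (log_loc b) (logderiv_loc b w)"
    if lam: "lam \<in> {lam_single b j | j. True} \<union> {lam_pair b j l \<tau> | j l \<tau>. j \<noteq> l \<and> \<tau> \<in> {1, -1, \<i>, -\<i>}}" for lam
  proof -
    have lamI: "torus.lam (log_loc b) (logderiv_loc b w) n \<sigma>
        = weighted_distr b n \<sigma> (\<lambda>\<theta>. (norm (\<Sum>j\<in>UNIV. w j * logderiv_trunc (b j) n \<sigma> \<theta>))\<^sup>2)"
      if w: "\<And>j. norm (w j) \<le> 2" for w n \<sigma>
    proof -
      interpret torus "log_loc b" "logderiv_loc b w" W by (rule torus_loc[OF w])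
      have "X n \<sigma> = log_trunc b n \<sigma>" by (simp add: fun_eq_iff X_def log_trunc_eq)
      then show ?thesis unfolding lam_def weighted_distr_def logderiv_trunc_eq V_def by simp
    qed
    consider (single) j where "lam = lam_single b j"
      | (pair) j l \<tau> where "lam = lam_pair b j l \<tau>" "\<tau> \<in> {1, -1, \<i>, -\<i>}"
      using lam by blast
    then show ?thesis
    proof cases
      case single
      let ?w = "\<lambda>i. if i = j then 1 else 0 :: complex"
      have s: "(\<Sum>i\<in>UNIV. ?w i * f i) = f j" for f :: "'n \<Rightarrow> complex"
        by (simp add: if_distrib[of "\<lambda>x. x * _"] cong: if_cong)
      have "lam = torus.lam (log_loc b) (logderiv_loc b ?w)"
        by (intro ext, subst lamI) (simp_all add: s single lam_single_def)
      then show ?thesis by (intro exI[of _ ?w]) auto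
    next
      case pair
      \<comment> \<open>Written as a sum of two indicators, so that summation against it gives the
        combination without comparing j and l.\<close>
      let ?w = "\<lambda>i. (if i = j then 1 else 0) + (if i = l then \<tau> else 0 :: complex)"
      have s: "(\<Sum>i\<in>UNIV. ?w i * f i) = f j + \<tau> * f l" for f :: "'n \<Rightarrow> complex"
        by (simp add: distrib_right sum.distrib if_distrib[of "\<lambda>x. x * _"] cong: if_cong)
      have w: "norm (?w i) \<le> 2" for i
        using norm_triangle_ineq[of "if i = j then 1 else 0" "if i = l then \<tau> else 0 :: complex"] pair(2) by (auto split: if_splits)
      have "lam = torus.lam (log_loc b) (logderiv_loc b ?w)"
        by (intro ext, subst lamI[OF w]) (simp add: s pair(1) lam_pair_def)
      moreover have "\<forall>i. norm (?w i) \<le> 2" using w by (rule allI)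
      ultimately show ?thesis by (intro exI[of _ ?w] conjI)
    qed
  qed
  show ?thesis
  proof (intro exI[of _ nq] conjI ballI mono)
    fix lam assume "lam \<in> {lam_single b j | j. True} \<union> {lam_pair b j l \<tau> | j l \<tau>. j \<noteq> l \<and> \<tau> \<in> {1, -1, \<i>, -\<i>}}"
    from lam_cases[OF this] obtain w where w': "\<forall>j. norm (w j) \<le> 2"
      and lam: "lam = torus.lam (log_loc b) (logderiv_loc b w)" by (elim exE conjE)
    have w: "norm (w j) \<le> 2" for j using w' ..
    interpret T: torus_decay "log_loc b" "logderiv_loc b w" W nq "\<lambda>q s. C0 * real (nth_prime (nq q)) powr (\<eta> + s / 2)"
      by (rule torus_decay_loc[OF w nq])
    show "\<exists>(lam_lim :: real \<Rightarrow> (complex ^ 'n) measure)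
      (G :: nat \<Rightarrow> real \<Rightarrow> complex ^ 'n \<Rightarrow> real)
      (G_lim :: real \<Rightarrow> complex ^ 'n \<Rightarrow> real).
       (\<forall>q. \<forall>n\<ge>nq q. \<forall>\<sigma>\<ge>1. has_density (lam n \<sigma>) (G n \<sigma>) \<and> C_k q (G n \<sigma>)) \<and>
       (\<forall>\<sigma>\<ge>1. weakly_converges (\<lambda>n. lam n \<sigma>) (lam_lim \<sigma>) sequentially \<and>
               has_density (lam_lim \<sigma>) (G_lim \<sigma>) \<and> (\<forall>q. C_k q (G_lim \<sigma>))) \<and>
       (\<forall>\<sigma>\<ge>1. weakly_converges lam_lim (lam_lim \<sigma>) (at \<sigma> within {1..})) \<and>
       (\<forall>n\<ge>nq 0. \<forall>\<sigma>\<ge>1. weakly_converges (lam n) (lam n \<sigma>) (at \<sigma> within {1..})) \<and>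
       (\<forall>vs x. set vs \<subseteq> Basis \<longrightarrow>
          continuous_on {1..} (\<lambda>\<sigma>. partials vs (G_lim \<sigma>) x)) \<and>
       (\<forall>q. \<forall>n\<ge>nq q. \<forall>vs x. set vs \<subseteq> Basis \<and> length vs \<le> q \<longrightarrow>
          continuous_on {1..} (\<lambda>\<sigma>. partials vs (G n \<sigma>) x))"
      unfolding lam
    proof (rule exI[of _ T.lam_lim], rule exI[of _ "\<lambda>n s. dens (T.R n s)"], rule exI[of _ "\<lambda>s. dens (T.Rl s)"], intro conjI)
      show "\<forall>q. \<forall>n\<ge>nq q. \<forall>\<sigma>\<ge>1. has_density (T.lam n \<sigma>) (dens (T.R n \<sigma>)) \<and> C_k q (dens (T.R n \<sigma>))"
        using T.density_and_continuity(1) by simp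
      show "\<forall>\<sigma>\<ge>1. weakly_converges (\<lambda>n. T.lam n \<sigma>) (T.lam_lim \<sigma>) sequentially \<and>
               has_density (T.lam_lim \<sigma>) (dens (T.Rl \<sigma>)) \<and> (\<forall>q. C_k q (dens (T.Rl \<sigma>)))"
        using T.density_and_continuity(2,3) by simp
      show "\<forall>\<sigma>\<ge>1. weakly_converges T.lam_lim (T.lam_lim \<sigma>) (at \<sigma> within {1..})"
        using T.density_and_continuity(4) by simp
      show "\<forall>n\<ge>nq 0. \<forall>\<sigma>\<ge>1. weakly_converges (T.lam n) (T.lam n \<sigma>) (at \<sigma> within {1..})"
        using T.density_and_continuity(5) by simp
      show "\<forall>vs x. set vs \<subseteq> Basis \<longrightarrow> continuous_on {1..} (\<lambda>\<sigma>. partials vs (dens (T.Rl \<sigma>)) x)"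
        using T.density_and_continuity(6) by simp
      show "\<forall>q. \<forall>n\<ge>nq q. \<forall>vs x. set vs \<subseteq> Basis \<and> length vs \<le> q \<longrightarrow>
          continuous_on {1..} (\<lambda>\<sigma>. partials vs (dens (T.R n \<sigma>)) x)"
        using T.density_and_continuity(7) by simp
    qed
  qed
qed

end
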